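(* Let $n$ be a positive integer and write $8n+9=3^{\beta}n_1$ with $n_1$ a positive integer and $3\nmid n_1$. Then $$t(1,1,3,4;n)=\frac 12\Big(3^{\beta+1}\Big(\frac 3{n_1}\Big)-1\Big)\sum_{d\mid n_1}d\Big(\frac 3d\Big)-\sum_{\substack{a,b\in\mathbb N,\ 2\nmid a\\ 4(8n+9)=a^2+3b^2}}(-1)^{\frac{a-1}2}a,$$ where $d$ runs over positive divisors of $n_1$.
   Context: $\mathbb N$ is the set of positive integers and $\left(\frac{a}{m}\right)$ is the Legendre–Jacobi–Kronecker symbol. For positive integers $a,b,c,d$ and a nonnegative integer $n$, $t(a,b,c,d;n)$ denotes the number of $(x,y,z,w)\in\mathbb Z^4$ with $n=a\frac{x(x-1)}2+b\frac{y(y-1)}2+c\frac{z(z-1)}2+d\frac{w(w-1)}2$. *)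

theory Defs
  imports Complex_Main "HOL-Number_Theory.Number_Theory"
begin

text \<open>The Kronecker symbol \<open>(a/p)\<close> for a prime \<open>p\<close>: the Legendre symbol for odd \<open>p\<close>, and the
  usual convention for \<open>p = 2\<close>.\<close>

definition kronecker_prime :: "int \<Rightarrow> int \<Rightarrow> int" where
  "kronecker_prime a p =
     (if p = 2 then (if even a then 0 else if a mod 8 = 1 \<or> a mod 8 = 7 then 1 else -1)
      else Legendre a p)"

text \<open>Extension to all \<open>m\<close> by complete multiplicativity, with \<open>(a/-1)\<close> the sign of \<open>a\<close>
  (\<open>+1\<close> for \<open>a = 0\<close>) and \<open>(a/0) = 1\<close> exactly for \<open>a = \<plusminus>1\<close>. The set \<open>prime_factors m\<close> consists of
  the positive prime divisors of \<open>m\<close>.\<close>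

definition kronecker :: "int \<Rightarrow> int \<Rightarrow> int" where
  "kronecker a m =
     (if m = 0 then (if \<bar>a\<bar> = 1 then 1 else 0)
      else (if m < 0 \<and> a < 0 then -1 else 1) *
           (\<Prod>p\<in>prime_factors m. kronecker_prime a p ^ multiplicity p m))"

text \<open>Each \<open>x * (x - 1)\<close> is even, so \<open>div\<close> is exact. The solution set is finite when all
  coefficients are positive, so \<open>card\<close> is then the number of solutions.\<close>

definition tri_reps :: "nat \<Rightarrow> nat \<Rightarrow> nat \<Rightarrow> nat \<Rightarrow> nat \<Rightarrow> nat" where
  "tri_reps a b c d n = card {(x::int, y::int, z::int, w::int).
     int n = int a * (x * (x - 1) div 2) + int b * (y * (y - 1) div 2)
           + int c * (z * (z - 1) div 2) + int d * (w * (w - 1) div 2)}"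

lemma tri_reps_finite:
  assumes "a > 0" "b > 0" "c > 0" "d > 0"
  shows "finite {(x::int, y::int, z::int, w::int).
     int n = int a * (x * (x - 1) div 2) + int b * (y * (y - 1) div 2)
           + int c * (z * (z - 1) div 2) + int d * (w * (w - 1) div 2)}" (is "finite ?S")
proof -
  let ?T = "\<lambda>x::int. x * (x - 1) div 2"
  have nn: "?T x \<ge> 0" for x
  proof -
    have "x * (x - 1) \<ge> 0"
      by (cases "x \<ge> 1") (auto intro: mult_nonneg_nonneg mult_nonpos_nonpos)
    then show ?thesis by simp
  qed
  have le: "?T x \<le> int k * ?T x" if "k > 0" for k x
    using mult_right_mono[of 1 "int k" "?T x"] nn[of x] that by simp
  have bd: "x \<in> {- (2 * int n + 1)..2 * int n + 1}" if "?T x \<le> int n" for x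
  proof -
    have t: "x * (x - 1) \<le> 2 * int n + 1" using that by linarith
    show ?thesis
    proof (cases "x \<ge> 2")
      case True
      then have "x * 1 \<le> x * (x - 1)" by (intro mult_left_mono) auto
      then have "x \<le> 2 * int n + 1" using t by linarith
      with True show ?thesis by simp
    next
      case False
      show ?thesis
      proof (cases "x \<ge> 0")
        case True
        with False show ?thesis by simp
      next
        case neg: False
        then have "(- x) * 1 \<le> (- x) * (1 - x)" by (intro mult_left_mono) auto
        also have "\<dots> = x * (x - 1)" by (simp add: algebra_simps)
        finally have "- x \<le> 2 * int n + 1" using t by linarith
        with neg show ?thesis by simp
      qed
    qed
  qed
  let ?I = "{- (2 * int n + 1)..2 * int n + 1}"
  have "?S \<subseteq> ?I \<times> ?I \<times> ?I \<times> ?I"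
  proof
    fix s assume "s \<in> ?S"
    then obtain x y z w where s: "s = (x, y, z, w)"
      and e: "int n = int a * ?T x + int b * ?T y + int c * ?T z + int d * ?T w"
      by auto
    have "?T x \<le> int n \<and> ?T y \<le> int n \<and> ?T z \<le> int n \<and> ?T w \<le> int n"
      using e le[OF assms(1), of x] le[OF assms(2), of y] le[OF assms(3), of z]
        le[OF assms(4), of w] nn[of x] nn[of y] nn[of z] nn[of w] by linarith
    with s bd show "s \<in> ?I \<times> ?I \<times> ?I \<times> ?I" by blast
  qed
  then show ?thesis by (rule finite_subset) simp
qed

end

theory Submission
  imports Defs
begin

text \<open>
  Put \<open>N = 8 n + 9\<close> and let \<open>\<chi>\<^sub>4\<close>, \<open>\<chi>\<^sub>3\<close> be the odd characters modulo 4 and 3, so that \<open>(3/d)\<close> is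
  \<open>\<chi>\<^sub>4(d) \<chi>\<^sub>3(d)\<close> for odd \<open>d\<close>. Completing squares, \<open>t(1,1,3,4;n)\<close> counts the solutions of
  \<open>X\<^sup>2 + Y\<^sup>2 + 3 Z\<^sup>2 + 4 W\<^sup>2 = N\<close> in odd integers, and therefore half of the solutions of
  \<open>x\<^sup>2 + y\<^sup>2 + 4 (p\<^sup>2 + p q + q\<^sup>2) = N\<close> with \<open>q\<close> odd. Comparing parities, this is a quarter
  of the number of all solutions minus a quarter of a signed count, and Jacobi's identity for \<open>\<eta>\<^sup>3\<close> turns
  the signed count into the sum over \<open>a\<^sup>2 + 3 b\<^sup>2 = 4 N\<close>.

  The number of all solutions is the convolution of the divisor sums of \<open>\<chi>\<^sub>4\<close> and \<open>\<chi>\<^sub>3\<close>. Liouville's identity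
  for \<open>a x + b y = N\<close>, applied to functions \<open>(3/k) u(m)\<close>, gives linear equations that determine it when
  3 does not divide \<open>N\<close>. When \<open>N = 3 M\<close> one equation is missing. It is supplied by a rotation of the
  lattice that divides the form by 3, and the proof proceeds by induction on the exponent of 3.
\<close>

text \<open>Liouville's identity does not give \<open>convX\<close> alone. For N = 1 mod 4 let X be
  \<open>convX N\<close> and let Y be the same sum with \<open>chi3_sum\<close> taken at l / 2. The
  test function u = [m odd] yields X + 2 Y. The choice u = [m odd and 3 dvd m] yields X - 2 Y, but
  its summand factors only when 3 does not divide N. The choice u = [m even] yields X - Y together
  with a new unknown, \<open>convZ N\<close>. Eliminating Y leaves one relation between X and
  \<open>convZ N\<close>. The rotation supplies a second one, which however involves the form 3 (x^2
  + y^2) + 4 (p^2 + p q + q^2) at M = N / 3. Since M = 3 mod 4, that count needs its own evaluation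
  when 3 does not divide M, while for M = 3 L it is the original count at L. The induction thus
  removes two factors of 3 at a time. The total count turns out to be a pure combination of divisor
  sums; the sum over a^2 + 3 b^2 = 4 N enters only through the parity condition on q.\<close>

section \<open>The odd characters modulo 4 and 3 and their product\<close>

definition chi4 :: "int \<Rightarrow> int" where
  "chi4 k = (if k mod 4 = 1 then 1 else if k mod 4 = 3 then - 1 else 0)"

definition chi3 :: "int \<Rightarrow> int" where
  "chi3 k = (if k mod 3 = 1 then 1 else if k mod 3 = 2 then - 1 else 0)"

text \<open>This character is even, as Liouville's identity requires of its test function. It is
  zero at even arguments, where (3/d) need not vanish, so it stands for (3/d) only at odd
  \<open>d\<close>.\<close>

definition chi12 :: "int \<Rightarrow> int" where
  "chi12 k = chi4 k * chi3 k"

lemma int_mod3_cases: "(k::int) mod 3 = 0 \<or> k mod 3 = 1 \<or> k mod 3 = 2"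
  by presburger

lemma int_mod4_cases: "(k::int) mod 4 = 0 \<or> k mod 4 = 1 \<or> k mod 4 = 2 \<or> k mod 4 = 3"
  by presburger

lemma chi3_mult: "chi3 (a * b) = chi3 a * chi3 b"
proof -
  have "(a * b) mod 3 = (r * s) mod 3" if "a mod 3 = r" "b mod 3 = s" for r s
    using that by (metis mod_mult_eq)
  from this[OF refl refl] show ?thesis
    using int_mod3_cases[of a] int_mod3_cases[of b] unfolding chi3_def
    by (elim disjE) simp_all
qed

lemma chi4_mult: "chi4 (a * b) = chi4 a * chi4 b"
proof -
  have "(a * b) mod 4 = (r * s) mod 4" if "a mod 4 = r" "b mod 4 = s" for r s
    using that by (metis mod_mult_eq)
  from this[OF refl refl] show ?thesis
    using int_mod4_cases[of a] int_mod4_cases[of b] unfolding chi4_def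
    by (elim disjE) simp_all
qed

lemma chi12_mult: "chi12 (a * b) = chi12 a * chi12 b"
  by (simp add: chi12_def chi3_mult chi4_mult)

lemma chi3_cong: "a mod 3 = b mod 3 \<Longrightarrow> chi3 a = chi3 b"
  by (simp add: chi3_def)

lemma chi4_cong: "a mod 4 = b mod 4 \<Longrightarrow> chi4 a = chi4 b"
  by (simp add: chi4_def)

lemma chi3_minus [simp]: "chi3 (- a) = - chi3 a"
  using chi3_mult[of "-1" a] by (simp add: chi3_def)

lemma chi4_minus [simp]: "chi4 (- a) = - chi4 a"
  using chi4_mult[of "-1" a] by (simp add: chi4_def)

lemma chi12_minus [simp]: "chi12 (- a) = chi12 a"
  by (simp add: chi12_def)

lemma chi3_simps [simp]: "chi3 0 = 0" "chi3 1 = 1" "chi3 2 = - 1" "chi3 3 = 0"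
  by (simp_all add: chi3_def)

lemma chi4_simps [simp]: "chi4 0 = 0" "chi4 1 = 1" "chi4 2 = 0" "chi4 3 = - 1"
  by (simp_all add: chi4_def)

lemma chi12_0 [simp]: "chi12 0 = 0"
  by (simp add: chi12_def)

lemma chi4_even: "even a \<Longrightarrow> chi4 a = 0"
  unfolding chi4_def by presburger

lemma chi12_even: "even a \<Longrightarrow> chi12 a = 0"
  by (simp add: chi12_def chi4_even)

lemma chi3_square: "\<not> 3 dvd a \<Longrightarrow> chi3 a * chi3 a = 1"
  using int_mod3_cases[of a] by (auto simp: chi3_def dvd_eq_mod_eq_0)

lemma chi4_square: "odd a \<Longrightarrow> chi4 a * chi4 a = 1"
  using int_mod4_cases[of a] by (auto simp: chi4_def) presburger+

section \<open>Liouville's identity\<close>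

text \<open>Divisors are kept together with their cofactors, so that exchanging d and k / d is a
  swap of components and k <= 0 gives the empty set without a convention for division.\<close>

definition dpairs :: "int \<Rightarrow> (int \<times> int) set" where
  "dpairs k = {(a, x). 0 < a \<and> 0 < x \<and> a * x = k}"

definition bilin :: "int \<Rightarrow> (int \<times> int \<times> int \<times> int) set" where
  "bilin N = {(a, b, x, y). 0 < a \<and> 0 < b \<and> 0 < x \<and> 0 < y \<and> a * x + b * y = N}"

lemma pos_factor_le: "0 < (a::int) \<Longrightarrow> 0 < x \<Longrightarrow> a \<le> a * x \<and> x \<le> a * x"
  using mult_left_mono[of 1 x a] mult_right_mono[of 1 a x] by simp

lemma finite_dpairs [simp]: "finite (dpairs k)"
proof (rule finite_subset)
  show "dpairs k \<subseteq> {1..k} \<times> {1..k}"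
    using pos_factor_le by (fastforce simp: dpairs_def)
qed simp

lemma finite_bilin [simp]: "finite (bilin N)"
proof (rule finite_subset)
  show "bilin N \<subseteq> {1..N} \<times> {1..N} \<times> {1..N} \<times> {1..N}"
  proof
    fix s assume "s \<in> bilin N"
    then obtain a b x y where s: "s = (a, b, x, y)" "0 < a" "0 < b" "0 < x" "0 < y"
      "a * x + b * y = N" by (auto simp: bilin_def)
    with pos_factor_le[of a x] pos_factor_le[of b y]
    have "a \<le> N" "b \<le> N" "x \<le> N" "y \<le> N" by linarith+
    with s show "s \<in> {1..N} \<times> {1..N} \<times> {1..N} \<times> {1..N}" by auto
  qed
qed simp

lemma dpairs_nonpos: "k \<le> 0 \<Longrightarrow> dpairs k = {}"
  by (auto simp: dpairs_def) (meson mult_pos_pos not_le)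

lemma sum_dpairs_swap: "(\<Sum>(a, x)\<in>dpairs k. f a x) = (\<Sum>(a, x)\<in>dpairs k. f x a)"
  by (rule sum.reindex_bij_witness[where i = prod.swap and j = prod.swap])
     (auto simp: dpairs_def mult.commute)

lemma sum_bilin_trichotomy:
  fixes f :: "int \<Rightarrow> int \<Rightarrow> int \<Rightarrow> int \<Rightarrow> int"
  shows "(\<Sum>(a, b, x, y)\<in>bilin N. f a b x y) =
      (\<Sum>(a, b, x, y)\<in>{(a, b, x, y)\<in>bilin N. g a b x y < h a b x y}. f a b x y)
    + (\<Sum>(a, b, x, y)\<in>{(a, b, x, y)\<in>bilin N. g a b x y = (h a b x y :: int)}. f a b x y)
    + (\<Sum>(a, b, x, y)\<in>{(a, b, x, y)\<in>bilin N. h a b x y < g a b x y}. f a b x y)"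
    (is "_ = sum ?f ?A + sum ?f ?B + sum ?f ?C")
proof -
  have fin: "finite ?A" "finite ?B" "finite ?C"
    by (rule finite_subset[OF _ finite_bilin[of N]], blast)+
  have "bilin N = (?A \<union> ?B) \<union> ?C" by auto
  moreover have "sum ?f ((?A \<union> ?B) \<union> ?C) = sum ?f (?A \<union> ?B) + sum ?f ?C"
    by (rule sum.union_disjoint) (use fin in auto)
  moreover have "sum ?f (?A \<union> ?B) = sum ?f ?A + sum ?f ?B"
    by (rule sum.union_disjoint) (use fin in auto)
  ultimately show ?thesis by simp
qed

text \<open>Unimodular substitutions preserve \<open>a * x + b * y\<close>. One turns the part
  \<open>b < a\<close> of the first sum into the sum of \<open>\<Phi> a y\<close> over
  \<open>x < y\<close>, another turns the part \<open>y < x\<close> of the second sum into the sum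
  of \<open>\<Phi> a y\<close> over \<open>b < a\<close>. The remaining off-diagonal parts are
  mirror images. So only the difference between these two sums of \<open>\<Phi> a y\<close> has to
  be found, and it lives on the diagonals.\<close>

theorem liouville_identity:
  fixes \<Phi> :: "int \<Rightarrow> int \<Rightarrow> int"
  assumes ev1: "\<And>k m. \<Phi> (- k) m = \<Phi> k m" and ev2: "\<And>k m. \<Phi> k (- m) = \<Phi> k m"
  shows "(\<Sum>(a, b, x, y)\<in>bilin N. \<Phi> (a - b) (x + y) - \<Phi> (a + b) (x - y)) =
      (\<Sum>(a, b, x, y)\<in>{(a, b, x, y)\<in>bilin N. a = b}. \<Phi> 0 (x + y) + 2 * \<Phi> a y)
    - (\<Sum>(a, b, x, y)\<in>{(a, b, x, y)\<in>bilin N. x = y}. \<Phi> (a + b) 0 + 2 * \<Phi> a y)"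
proof -
  let ?ag = "{(a, b, x, y)\<in>bilin N. b < a}" and ?al = "{(a, b, x, y)\<in>bilin N. a < b}"
    and ?ae = "{(a, b, x, y)\<in>bilin N. a = b}"
  let ?xg = "{(a, b, x, y)\<in>bilin N. y < x}" and ?xl = "{(a, b, x, y)\<in>bilin N. x < y}"
    and ?xe = "{(a, b, x, y)\<in>bilin N. x = y}"
  have even_diff: "\<Phi> (b - a) m = \<Phi> (a - b) m" "\<Phi> k (b - a) = \<Phi> k (a - b)" for a b k m
    using ev1[of "a - b" m] ev2[of k "a - b"] by simp_all
  have 1: "(\<Sum>(a, b, x, y)\<in>?ag. \<Phi> (a - b) (x + y)) = (\<Sum>(a, b, x, y)\<in>?xl. \<Phi> a y)"
    by (rule sum.reindex_bij_witness[where i = "\<lambda>(a, b, x, y). (a + b, b, x, y - x)"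
          and j = "\<lambda>(a, b, x, y). (a - b, b, x, x + y)"])
       (auto simp: bilin_def algebra_simps)
  have 2: "(\<Sum>(a, b, x, y)\<in>?al. \<Phi> (a - b) (x + y)) = (\<Sum>(a, b, x, y)\<in>?ag. \<Phi> (a - b) (x + y))"
    by (rule sum.reindex_bij_witness[where i = "\<lambda>(a, b, x, y). (b, a, y, x)"
          and j = "\<lambda>(a, b, x, y). (b, a, y, x)"])
       (auto simp: bilin_def algebra_simps even_diff)
  have 3: "(\<Sum>(a, b, x, y)\<in>?xg. \<Phi> (a + b) (x - y)) = (\<Sum>(a, b, x, y)\<in>?ag. \<Phi> a y)"
    by (rule sum.reindex_bij_witness[where i = "\<lambda>(a, b, x, y). (b, a - b, x + y, x)"
          and j = "\<lambda>(a, b, x, y). (a + b, a, y, x - y)"])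
       (auto simp: bilin_def algebra_simps)
  have 4: "(\<Sum>(a, b, x, y)\<in>?xl. \<Phi> (a + b) (x - y)) = (\<Sum>(a, b, x, y)\<in>?xg. \<Phi> (a + b) (x - y))"
    by (rule sum.reindex_bij_witness[where i = "\<lambda>(a, b, x, y). (b, a, y, x)"
          and j = "\<lambda>(a, b, x, y). (b, a, y, x)"])
       (auto simp: bilin_def algebra_simps even_diff)
  \<comment> \<open>This substitution fixes both \<open>a\<close> and \<open>y\<close>. It matches
    \<open>y < x\<close> with \<open>a < b\<close>, so the complementary regions
    \<open>x < y\<close> and \<open>b < a\<close> have equal sums up to the diagonals.\<close>
  have 5: "(\<Sum>(a, b, x, y)\<in>?xg. \<Phi> a y) = (\<Sum>(a, b, x, y)\<in>?al. \<Phi> a y)"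
    by (rule sum.reindex_bij_witness[where i = "\<lambda>(a, b, x, y). (a, b - a, x + y, y)"
          and j = "\<lambda>(a, b, x, y). (a, a + b, x - y, y)"])
       (auto simp: bilin_def algebra_simps)
  have 6: "(\<Sum>(a, b, x, y)\<in>?ae. \<Phi> (a - b) (x + y)) = (\<Sum>(a, b, x, y)\<in>?ae. \<Phi> 0 (x + y))"
    by (rule sum.cong) auto
  have 7: "(\<Sum>(a, b, x, y)\<in>?xe. \<Phi> (a + b) (x - y)) = (\<Sum>(a, b, x, y)\<in>?xe. \<Phi> (a + b) 0)"
    by (rule sum.cong) auto
  have A: "(\<Sum>(a, b, x, y)\<in>bilin N. \<Phi> (a - b) (x + y)) =
      2 * (\<Sum>(a, b, x, y)\<in>?xl. \<Phi> a y) + (\<Sum>(a, b, x, y)\<in>?ae. \<Phi> 0 (x + y))"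
    using sum_bilin_trichotomy[where g = "\<lambda>a b x y. a" and h = "\<lambda>a b x y. b"
        and f = "\<lambda>a b x y. \<Phi> (a - b) (x + y)" and N = N] 1 2 6 by simp
  have B: "(\<Sum>(a, b, x, y)\<in>bilin N. \<Phi> (a + b) (x - y)) =
      2 * (\<Sum>(a, b, x, y)\<in>?ag. \<Phi> a y) + (\<Sum>(a, b, x, y)\<in>?xe. \<Phi> (a + b) 0)"
    using sum_bilin_trichotomy[where g = "\<lambda>a b x y. x" and h = "\<lambda>a b x y. y"
        and f = "\<lambda>a b x y. \<Phi> (a + b) (x - y)" and N = N] 3 4 7 by simp
  have C: "(\<Sum>(a, b, x, y)\<in>?xl. \<Phi> a y) = (\<Sum>(a, b, x, y)\<in>?ag. \<Phi> a y)
      + (\<Sum>(a, b, x, y)\<in>?ae. \<Phi> a y) - (\<Sum>(a, b, x, y)\<in>?xe. \<Phi> a y)"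
    using sum_bilin_trichotomy[where g = "\<lambda>a b x y. a" and h = "\<lambda>a b x y. b"
        and f = "\<lambda>a b x y. \<Phi> a y" and N = N]
      sum_bilin_trichotomy[where g = "\<lambda>a b x y. x" and h = "\<lambda>a b x y. y"
        and f = "\<lambda>a b x y. \<Phi> a y" and N = N] 5 by simp
  have split: "(\<Sum>(a, b, x, y)\<in>quat. f a b x y + 2 * f' a b x y) =
      (\<Sum>(a, b, x, y)\<in>quat. f a b x y) + 2 * (\<Sum>(a, b, x, y)\<in>quat. f' a b x y)"
    for quat and f f' :: "int \<Rightarrow> int \<Rightarrow> int \<Rightarrow> int \<Rightarrow> int"
    by (simp add: sum.distrib sum_distrib_left case_prod_unfold)
  have "(\<Sum>(a, b, x, y)\<in>bilin N. \<Phi> (a - b) (x + y) - \<Phi> (a + b) (x - y)) =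
    (\<Sum>(a, b, x, y)\<in>bilin N. \<Phi> (a - b) (x + y)) - (\<Sum>(a, b, x, y)\<in>bilin N. \<Phi> (a + b) (x - y))"
    by (simp add: sum_subtractf case_prod_unfold)
  then show ?thesis unfolding split using A B C by simp
qed

section \<open>Representations by the principal forms of discriminant \<open>-4\<close> and \<open>-3\<close>\<close>

text \<open>Norm of x + y theta, where theta^2 = c theta - 1: Gaussian integers for
  \<open>c = 0\<close>, Eisenstein integers for \<open>c = 1\<close>. Keeping \<open>c\<close> as a
  parameter lets one argument serve both rings.\<close>

definition nf :: "int \<Rightarrow> int \<Rightarrow> int \<Rightarrow> int" where
  "nf c x y = x * x + c * x * y + y * y"

definition reps :: "int \<Rightarrow> int \<Rightarrow> (int \<times> int) set" where
  "reps c n = {(x, y). nf c x y = n}"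

definition sub_div :: "(int \<Rightarrow> int) \<Rightarrow> int \<Rightarrow> int \<Rightarrow> int" where
  "sub_div f p k = (if p dvd k then f (k div p) else 0)"

lemma nf_mult: "nf c (x * u - y * v) (x * v + y * u + c * y * v) = nf c x y * nf c u v"
  by (simp add: nf_def algebra_simps)

text \<open>The second factor is the conjugate of u + v theta. Multiplying by it is how division by
  u + v theta is carried out below.\<close>

lemma nf_mult_conj: "nf c (x * u + c * x * v + y * v) (y * u - x * v) = nf c x y * nf c u v"
  by (simp add: nf_def algebra_simps)

lemma nf_scale: "nf c (k * x) (k * y) = k * k * nf c x y"
  by (simp add: nf_def algebra_simps)

lemma nf_lower_bound:
  assumes "c = 0 \<or> c = 1"
  shows "x * x \<le> 2 * nf c x y" "y * y \<le> 2 * nf c x y"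
proof -
  have "2 * nf c x y = x * x + y * y + (if c = 0 then x * x + y * y else (x + y) * (x + y))"
    using assms by (auto simp: nf_def algebra_simps)
  moreover have "0 \<le> x * x" "0 \<le> y * y" "0 \<le> (x + y) * (x + y)" by simp_all
  ultimately show "x * x \<le> 2 * nf c x y" "y * y \<le> 2 * nf c x y"
    by (auto split: if_splits)
qed

lemma nf_nonneg: "c = 0 \<or> c = 1 \<Longrightarrow> 0 \<le> nf c x y"
  using nf_lower_bound(1)[of c x y] zero_le_square[of x] by linarith

lemma nf_eq_0_iff:
  assumes "c = 0 \<or> c = 1"
  shows "nf c x y = 0 \<longleftrightarrow> x = 0 \<and> y = 0"
proof
  assume "nf c x y = 0"
  with nf_lower_bound[OF assms, where x = x and y = y] have "x * x \<le> 0" "y * y \<le> 0" by auto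
  then show "x = 0 \<and> y = 0" using mult_le_0_iff[of x x] mult_le_0_iff[of y y] by auto
qed (simp add: nf_def)

lemma abs_le_square: "\<bar>x\<bar> \<le> x * (x::int)"
proof -
  have "\<bar>x\<bar> \<le> \<bar>x\<bar> * \<bar>x\<bar>"
    by (cases "x = 0") (use mult_left_mono[of 1 "\<bar>x\<bar>" "\<bar>x\<bar>"] in auto)
  then show ?thesis by simp
qed

lemma finite_reps [simp]:
  assumes "c = 0 \<or> c = 1"
  shows "finite (reps c n)"
proof (rule finite_subset)
  show "reps c n \<subseteq> {- (2 * n)..2 * n} \<times> {- (2 * n)..2 * n}"
  proof
    fix z assume "z \<in> reps c n"
    then obtain x y where z: "z = (x, y)" "nf c x y = n" by (auto simp: reps_def)
    with nf_lower_bound[OF assms, where x = x and y = y] abs_le_square[of x] abs_le_square[of y]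
    have "\<bar>x\<bar> \<le> 2 * n" "\<bar>y\<bar> \<le> 2 * n" by linarith+
    with z show "z \<in> {- (2 * n)..2 * n} \<times> {- (2 * n)..2 * n}" by auto
  qed
qed simp

lemma reps_0: "c = 0 \<or> c = 1 \<Longrightarrow> reps c 0 = {(0, 0)}"
  by (auto simp: reps_def nf_eq_0_iff)

lemma reps_neg:
  assumes "c = 0 \<or> c = 1" "n < 0"
  shows "reps c n = {}"
proof -
  have "nf c x y \<noteq> n" for x y using nf_nonneg[OF assms(1), of x y] assms(2) by linarith
  then show ?thesis by (simp add: reps_def)
qed

section \<open>Counting elements of norm p n by divisibility\<close>

lemma card_reps_div:
  assumes c: "c = 0 \<or> c = 1" and p: "prime p"
  shows "int (card {(x, y)\<in>reps c (p * n). p dvd x \<and> p dvd y}) = sub_div (\<lambda>k. int (card (reps c k))) p n"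
proof (cases "p dvd n")
  case True
  then obtain m where m: "n = p * m" by auto
  have p0: "p \<noteq> 0" using p by auto
  have "bij_betw (\<lambda>(x, y). (p * x, p * y)) (reps c m) {(x, y)\<in>reps c (p * n). p dvd x \<and> p dvd y}"
    by (rule bij_betw_byWitness[where f' = "\<lambda>(x, y). (x div p, y div p)"])
       (use p0 in \<open>auto simp: reps_def nf_scale m elim!: dvdE\<close>)
  then have "card (reps c m) = card {(x, y)\<in>reps c (p * n). p dvd x \<and> p dvd y}"
    by (rule bij_betw_same_card)
  with m p0 show ?thesis by (simp add: sub_div_def)
next
  case False
  have "{(x, y)\<in>reps c (p * n). p dvd x \<and> p dvd y} = {}"
  proof (rule ccontr)
    assume "{(x, y)\<in>reps c (p * n). p dvd x \<and> p dvd y} \<noteq> {}"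
    then obtain x y where "nf c (p * x) (p * y) = p * n"
      by (auto simp: reps_def elim!: dvdE)
    then have "p * (p * nf c x y) = p * n" by (simp add: nf_scale mult.assoc)
    with p have "n = p * nf c x y" by auto
    with False show False by simp
  qed
  then have "card {(x, y)\<in>reps c (p * n). p dvd x \<and> p dvd y} = 0" by (simp only: card.empty)
  with False show ?thesis by (simp add: sub_div_def)
qed

text \<open>With pi = u + v theta of norm \<open>p\<close>, multiplication by pi is a bijection from
  norm \<open>n\<close> to the multiples of pi of norm \<open>p * n\<close>. Divisibility of z by pi
  is tested on one coordinate of z conj(pi) only: the norm of that product is divisible by
  \<open>p\<close>, which forces the other coordinate (\<open>first1\<close>).\<close>

lemma card_reps_multiples:
  assumes p: "prime p" and uv: "nf c u v = p"
  shows "card {(x, y)\<in>reps c (p * n). p dvd y * u - x * v} = card (reps c n)" (is "card ?A = _")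
proof -
  have p0: "p \<noteq> 0" using p by auto
  have pdef: "p = u * u + c * u * v + v * v" using uv by (simp add: nf_def)
  have first1: "p dvd x * u + c * x * v + y * v" if "(x, y) \<in> ?A" for x y
  proof -
    let ?X = "x * u + c * x * v + y * v" and ?Y = "y * u - x * v"
    have "nf c ?X ?Y = p * n * p" using nf_mult_conj[of c x u v y] uv that by (simp add: reps_def)
    then have "?X * ?X = p * n * p - ?Y * (c * ?X + ?Y)" by (simp add: nf_def algebra_simps)
    moreover have "p dvd ?Y" using that by simp
    ultimately have "p dvd ?X * ?X" by simp
    then show ?thesis using p by (auto simp: prime_dvd_mult_iff)
  qed
  have "bij_betw (\<lambda>(x, y). (x * u - y * v, x * v + y * u + c * y * v)) (reps c n) ?A"
  proof (rule bij_betw_byWitness[where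
        f' = "\<lambda>(x, y). ((x * u + c * x * v + y * v) div p, (y * u - x * v) div p)"])
    show "\<forall>z\<in>reps c n. (\<lambda>(x, y). ((x * u + c * x * v + y * v) div p, (y * u - x * v) div p))
        ((\<lambda>(x, y). (x * u - y * v, x * v + y * u + c * y * v)) z) = z"
    proof clarify
      fix x y assume "(x, y) \<in> reps c n"
      have "(x * u - y * v) * u + c * (x * u - y * v) * v + (x * v + y * u + c * y * v) * v = p * x"
        "(x * v + y * u + c * y * v) * u - (x * u - y * v) * v = p * y"
        by (simp_all add: pdef algebra_simps)
      with p0 show "((x * u - y * v) * u + c * (x * u - y * v) * v + (x * v + y * u + c * y * v) * v) div p = x \<and>
         ((x * v + y * u + c * y * v) * u - (x * u - y * v) * v) div p = y"
        by simp
    qed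
    show "\<forall>z\<in>?A. (\<lambda>(x, y). (x * u - y * v, x * v + y * u + c * y * v))
        ((\<lambda>(x, y). ((x * u + c * x * v + y * v) div p, (y * u - x * v) div p)) z) = z"
    proof clarify
      fix x y assume xy: "(x, y) \<in> reps c (p * n)" "p dvd y * u - x * v"
      then obtain i j where ij: "x * u + c * x * v + y * v = p * i" "y * u - x * v = p * j"
        using first1[of x y] by (auto elim!: dvdE)
      have "p * (i * u - j * v) = p * x" "p * (i * v + j * u + c * j * v) = p * y"
        unfolding right_diff_distrib distrib_left mult.assoc[symmetric]
          mult.commute[of p c] mult.assoc[of c p] ij[symmetric]
        by (simp_all add: pdef algebra_simps)
      with p0 ij show "(x * u + c * x * v + y * v) div p * u - (y * u - x * v) div p * v = x \<and>
         (x * u + c * x * v + y * v) div p * v + (y * u - x * v) div p * u +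
         c * ((y * u - x * v) div p) * v = y"
        by simp
    qed
    show "(\<lambda>(x, y). (x * u - y * v, x * v + y * u + c * y * v)) ` reps c n \<subseteq> ?A"
    proof clarify
      fix x y assume xy: "(x, y) \<in> reps c n"
      have "(x * v + y * u + c * y * v) * u - (x * u - y * v) * v = p * y"
        by (simp add: pdef algebra_simps)
      with xy nf_mult[of c x u y v] uv
      show "(x * u - y * v, x * v + y * u + c * y * v) \<in> reps c (p * n) \<and>
        p dvd (x * v + y * u + c * y * v) * u - (x * u - y * v) * v"
        by (simp add: reps_def mult.commute)
    qed
    show "(\<lambda>(x, y). ((x * u + c * x * v + y * v) div p, (y * u - x * v) div p)) ` ?A \<subseteq> reps c n"
    proof clarify
      fix x y assume xy: "(x, y) \<in> reps c (p * n)" "p dvd y * u - x * v"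
      then obtain i j where ij: "x * u + c * x * v + y * v = p * i" "y * u - x * v = p * j"
        using first1[of x y] by (auto elim!: dvdE)
      have "nf c (p * i) (p * j) = p * n * p"
        using nf_mult_conj[of c x u v y] xy uv by (simp add: reps_def ij)
      then have "p * p * nf c i j = p * p * n" by (simp add: nf_scale)
      with p0 ij show "((x * u + c * x * v + y * v) div p, (y * u - x * v) div p) \<in> reps c n"
        by (simp add: reps_def)
    qed
  qed
  then show ?thesis by (simp add: bij_betw_same_card)
qed

text \<open>Inclusion-exclusion. Every element of norm \<open>p * n\<close> is a multiple of pi = u
  + v theta or of its conjugate; it is a multiple of both only if \<open>p\<close> divides it,
  because \<open>p\<close> does not divide the discriminant.\<close>

lemma card_reps_split:
  assumes c: "c = 0 \<or> c = 1" and p: "prime p" and disc: "\<not> p dvd 4 - c * c"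
    and uv: "nf c u v = p"
  shows "int (card (reps c (p * n))) =
    2 * int (card (reps c n)) - sub_div (\<lambda>k. int (card (reps c k))) p n"
proof -
  let ?A = "{(x, y)\<in>reps c (p * n). p dvd y * u - x * v}"
  let ?B = "{(x, y)\<in>reps c (p * n). p dvd x * v + y * u + c * y * v}"
  have p0: "p \<noteq> 0" using p by auto
  have pdef: "p = u * u + c * u * v + v * v" using uv by (simp add: nf_def)
  have sq: "p dvd z" if "p dvd z * z" for z
    using that p by (auto simp: prime_dvd_mult_iff)
  have cA: "card ?A = card (reps c n)" by (rule card_reps_multiples[OF p uv])
  \<comment> \<open>The coordinates of the conjugate of u + v theta.\<close>
  have "nf c (u + c * v) (- v) = p" using uv by (simp add: nf_def algebra_simps)
  from card_reps_multiples[OF p this, of n] have cB: "card ?B = card (reps c n)"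
    by (simp add: algebra_simps)
  have "p dvd y * u - x * v \<or> p dvd x * v + y * u + c * y * v" if "(x, y) \<in> reps c (p * n)" for x y
  proof -
    have "(y * u - x * v) * (x * v + y * u + c * y * v) = y * y * nf c u v - v * v * nf c x y"
      by (simp add: nf_def algebra_simps)
    also have "\<dots> = p * (y * y - v * v * n)"
      using that uv by (simp add: reps_def algebra_simps)
    finally have "p dvd (y * u - x * v) * (x * v + y * u + c * y * v)" by simp
    with p show ?thesis by (simp add: prime_dvd_mult_iff)
  qed
  then have un: "reps c (p * n) = ?A \<union> ?B" by auto
  have v: "\<not> p dvd v"
  proof
    assume v: "p dvd v"
    then have "p dvd u * u"
      using pdef by (metis dvd_add_left_iff dvd_mult dvd_refl)
    then have "p dvd u" by (rule sq)
    with v obtain i j where "u = p * i" "v = p * j" by (auto elim!: dvdE)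
    with uv have "p * (p * nf c i j) = p * 1" by (simp add: nf_scale mult.assoc)
    with p0 have "p dvd 1" by (metis dvd_triv_left mult_cancel_left)
    with p show False by auto
  qed
  \<comment> \<open>\<open>2 * u + c * v\<close> is the trace of pi, and trace^2 - 4 norm is the
    discriminant \<open>c * c - 4\<close> times \<open>v * v\<close>.\<close>
  have disc2: "\<not> p dvd 2 * u + c * v"
  proof
    assume d: "p dvd 2 * u + c * v"
    have "(4 - c * c) * (v * v) = 4 * p - (2 * u + c * v) * (2 * u + c * v)"
      by (simp add: pdef algebra_simps)
    with d have "p dvd (4 - c * c) * (v * v)" by simp
    with p v disc show False by (simp add: prime_dvd_mult_iff)
  qed
  have cap: "?A \<inter> ?B = {(x, y)\<in>reps c (p * n). p dvd x \<and> p dvd y}"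
  proof -
    have "p dvd x \<and> p dvd y" if "p dvd y * u - x * v" "p dvd x * v + y * u + c * y * v" for x y
    proof -
      have "p dvd (y * u - x * v) + (x * v + y * u + c * y * v)"
        using that by (rule dvd_add)
      then have "p dvd y * (2 * u + c * v)" by (simp add: algebra_simps)
      with disc2 p have y: "p dvd y" by (simp add: prime_dvd_mult_iff)
      then have "p dvd y * u" by simp
      with that(1) have "p dvd x * v" by (metis dvd_diff_right_iff)
      with v p y show ?thesis by (simp add: prime_dvd_mult_iff)
    qed
    moreover have "p dvd y * u - x * v \<and> p dvd x * v + y * u + c * y * v" if "p dvd x" "p dvd y" for x y
      using that by simp
    ultimately show ?thesis by blast
  qed
  have "card (?A \<union> ?B) + card (?A \<inter> ?B) = card ?A + card ?B"
    by (rule card_Un_Int[symmetric])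
      (rule finite_subset[OF _ finite_reps[OF c, of "p * n"]], blast)+
  moreover note arg_cong[OF un, of card] arg_cong[OF cap, of card] cA cB card_reps_div[OF c p, of n]
  ultimately show ?thesis by linarith
qed

lemma card_reps_inert:
  assumes c: "c = 0 \<or> c = 1" and p: "prime p"
    and inert: "\<And>x y. p dvd nf c x y \<Longrightarrow> p dvd x \<and> p dvd y"
  shows "int (card (reps c (p * n))) = sub_div (\<lambda>k. int (card (reps c k))) p n"
proof -
  have "p dvd x \<and> p dvd y" if "(x, y) \<in> reps c (p * n)" for x y
    using inert[of x y] that by (simp add: reps_def)
  then have "reps c (p * n) = {(x, y)\<in>reps c (p * n). p dvd x \<and> p dvd y}" by blast
  from arg_cong[OF this, of card] card_reps_div[OF c p, of n] show ?thesis by linarith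
qed

text \<open>The prime 2 ramifies: this is multiplication by 1 + i with the two coordinates
  exchanged.\<close>

lemma card_reps_two: "card (reps 0 (2 * n)) = card (reps 0 n)"
proof -
  have "bij_betw (\<lambda>(x, y). (x + y, x - y)) (reps 0 n) (reps 0 (2 * n))"
  proof (rule bij_betw_byWitness[where f' = "\<lambda>(x, y). ((x + y) div 2, (x - y) div 2)"])
    have half: "even (x + y) \<and> even (x - y)" if "nf 0 x y = 2 * n" for x y
    proof -
      have "even (x * x + y * y)" using that by (simp add: nf_def)
      then show ?thesis by auto
    qed
    show "\<forall>z\<in>reps 0 (2 * n). (\<lambda>(x, y). (x + y, x - y)) ((\<lambda>(x, y). ((x + y) div 2, (x - y) div 2)) z) = z"
    proof clarify
      fix x y assume "(x, y) \<in> reps 0 (2 * n)"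
      then have "even (x + y)" "even (x - y)" using half by (auto simp: reps_def)
      then show "(x + y) div 2 + (x - y) div 2 = x \<and> (x + y) div 2 - (x - y) div 2 = y" by presburger
    qed
    show "(\<lambda>(x, y). ((x + y) div 2, (x - y) div 2)) ` reps 0 (2 * n) \<subseteq> reps 0 n"
    proof clarify
      fix x y assume xy: "(x, y) \<in> reps 0 (2 * n)"
      then have "even (x + y)" "even (x - y)" using half by (auto simp: reps_def)
      then obtain i j where ij: "x + y = 2 * i" "x - y = 2 * j" by (elim evenE)
      then have "x = i + j" "y = i - j" by auto
      with xy have "nf 0 i j = n" by (simp add: reps_def nf_def algebra_simps)
      with ij show "((x + y) div 2, (x - y) div 2) \<in> reps 0 n" by (simp add: reps_def)
    qed
  qed (auto simp: reps_def nf_def algebra_simps)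
  then show ?thesis by (simp add: bij_betw_same_card)
qed

text \<open>The prime 3 ramifies: this is multiplication by 1 + theta, an element of norm 3.\<close>

lemma card_reps_three: "card (reps 1 (3 * n)) = card (reps 1 n)"
proof -
  have "bij_betw (\<lambda>(x, y). (x - y, x + 2 * y)) (reps 1 n) (reps 1 (3 * n))"
  proof (rule bij_betw_byWitness[where f' = "\<lambda>(x, y). (x + (y - x) div 3, (y - x) div 3)"])
    have three: "3 dvd y - x" if "nf 1 x y = 3 * n" for x y
    proof -
      have "(y - x) * (y - x) = 3 * (n - x * y)" using that by (simp add: nf_def algebra_simps)
      then have "3 dvd (y - x) * (y - x)" by simp
      then show ?thesis by (simp add: prime_dvd_mult_iff)
    qed
    show "\<forall>z\<in>reps 1 (3 * n). (\<lambda>(x, y). (x - y, x + 2 * y)) ((\<lambda>(x, y). (x + (y - x) div 3, (y - x) div 3)) z) = z"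
    proof clarify
      fix x y assume "(x, y) \<in> reps 1 (3 * n)"
      then have "3 dvd y - x" using three by (auto simp: reps_def)
      then show "x + (y - x) div 3 - (y - x) div 3 = x \<and> x + (y - x) div 3 + 2 * ((y - x) div 3) = y"
        by (auto elim!: dvdE)
    qed
    show "(\<lambda>(x, y). (x + (y - x) div 3, (y - x) div 3)) ` reps 1 (3 * n) \<subseteq> reps 1 n"
    proof clarify
      fix x y assume xy: "(x, y) \<in> reps 1 (3 * n)"
      then obtain j where j: "y - x = 3 * j" using three by (auto simp: reps_def elim!: dvdE)
      then have "y = x + 3 * j" by auto
      with xy have "nf 1 (x + j) j = n" by (simp add: reps_def nf_def algebra_simps)
      with j show "(x + (y - x) div 3, (y - x) div 3) \<in> reps 1 n" by (simp add: reps_def)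
    qed
  qed (auto simp: reps_def nf_def algebra_simps)
  then show ?thesis by (simp add: bij_betw_same_card)
qed

section \<open>Representing primes: reduction and descent\<close>

lemma centered_residue:
  assumes "0 < (k::int)"
  obtains u' where "k dvd u - u'" "\<bar>2 * u'\<bar> \<le> k"
proof
  let ?u = "(u + k div 2) mod k - k div 2"
  have "u - ?u = (u + k div 2) div k * k"
    using div_mult_mod_eq[of "u + k div 2" k] by linarith
  then show "k dvd u - ?u" by simp
  have "0 \<le> (u + k div 2) mod k" "(u + k div 2) mod k < k" using assms by simp_all
  moreover have "2 * (k div 2) \<le> k" "k \<le> 2 * (k div 2) + 1" by presburger+
  moreover have "\<bar>2 * (m - h)\<bar> \<le> k" if "0 \<le> m" "m < k" "2 * h \<le> k" "k \<le> 2 * h + 1" for m h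
    using that by arith
  ultimately show "\<bar>2 * ?u\<bar> \<le> k" by blast
qed

text \<open>Fermat descent on the multiplier \<open>k\<close>.\<close>

lemma prime_rep_descent:
  assumes c: "c = 0 \<or> c = 1" and p: "prime p" and k: "0 < k" "k < p" and uv: "nf c u v = p * k"
  shows "\<exists>u v. nf c u v = p"
  using k uv
proof (induction "nat k" arbitrary: k u v rule: less_induct)
  case less
  show ?case
  proof (cases "k = 1")
    case True
    with less.prems show ?thesis by auto
  next
    case False
    with less.prems have k: "1 < k" by simp
    obtain u' where u': "k dvd u - u'" "\<bar>2 * u'\<bar> \<le> k" using centered_residue[of k u] k by auto
    obtain v' where v': "k dvd v - v'" "\<bar>2 * v'\<bar> \<le> k" using centered_residue[of k v] k by auto
    from u'(1) v'(1) obtain i j where ij: "u = u' + k * i" "v = v' + k * j"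
      by (metis dvdE diff_add_cancel add.commute)
    have "nf c u' v' = nf c u v - k * (i * (2 * u' + k * i) + c * (u' * j + v' * i + k * i * j) + j * (2 * v' + k * j))"
      by (simp add: nf_def ij algebra_simps)
    with less.prems have "k dvd nf c u' v'" by simp
    then obtain k' where k': "nf c u' v' = k * k'" by auto
    have sq: "4 * (a * b) \<le> k * k" if "\<bar>2 * a\<bar> \<le> k" "\<bar>2 * b\<bar> \<le> k" for a b
    proof -
      have "\<bar>2 * a\<bar> * \<bar>2 * b\<bar> \<le> k * k" using that k by (intro mult_mono) auto
      then show ?thesis by (simp add: abs_mult[symmetric])
    qed
    have kk: "0 < k * k" using k by simp
    \<comment> \<open>Each of the at most three products in the form is bounded by
      \<open>k * k / 4\<close>. The bound 3 < 4 is what makes the new multiplier smaller than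
      \<open>k\<close>.\<close>
    have "4 * nf c u' v' \<le> 3 * (k * k)"
      using c sq[OF u'(2) u'(2)] sq[OF v'(2) v'(2)] sq[OF u'(2) v'(2)] kk
      by (auto simp: nf_def)
    moreover note kk
    ultimately have "k * k' < k * k" using k' by linarith
    with k have k'k: "k' < k" by simp
    have "nf c u' v' \<noteq> 0"
    proof
      assume "nf c u' v' = 0"
      with nf_eq_0_iff[OF c] ij have "u = k * i" "v = k * j" by simp_all
      with less.prems have "nf c (k * i) (k * j) = k * p" by simp
      then have "k * (k * nf c i j) = k * p" by (simp only: nf_scale mult.assoc)
      with k have "k * nf c i j = p" by simp
      then have "k dvd p" by (metis dvd_triv_left)
      moreover have "\<forall>m. 0 \<le> m \<and> m dvd p \<longrightarrow> m = 1 \<or> m = p"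
        using p by (simp add: prime_int_iff)
      ultimately have "k = 1 \<or> k = p" using k by (metis less_imp_le order_less_trans zero_less_one)
      with k less.prems show False by simp
    qed
    with nf_nonneg[OF c, of u' v'] k' have "0 < k * k'" by linarith
    with k have k'0: "0 < k'" by (simp add: zero_less_mult_iff)
    \<comment> \<open>The coordinates of (u + v theta) conj(u' + v' theta). Both are multiples of
      \<open>k\<close>, since modulo \<open>k\<close> the product is the norm of u + v theta.
      Dividing by \<open>k\<close> leaves norm \<open>p * k'\<close>.\<close>
    let ?X = "u * u' + c * u * v' + v * v'" and ?Y = "v * u' - u * v'"
    have "?X = nf c u v - k * (u * i + c * u * j + v * j)" "?Y = k * (u' * j - v' * i)"
      by (simp_all add: nf_def ij algebra_simps)
    with less.prems have "k dvd ?X" "k dvd ?Y" by simp_all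
    then obtain X Y where XY: "?X = k * X" "?Y = k * Y" by (auto elim!: dvdE)
    have "nf c (k * X) (k * Y) = p * k * (k * k')"
      using nf_mult_conj[of c u u' v' v] less.prems k' XY by simp
    then have "k * k * nf c X Y = p * k * (k * k')" by (simp only: nf_scale)
    also have "\<dots> = k * k * (p * k')" by simp
    finally have "k * k * nf c X Y = k * k * (p * k')" .
    with k have "nf c X Y = p * k'" by simp
    with less.hyps[of k' X Y] k'0 k'k less.prems show ?thesis by simp
  qed
qed

text \<open>Starts the descent: a zero of s^2 + c s + 1 modulo \<open>p\<close>, moved to absolute
  value at most \<open>p / 2\<close>, has a value \<open>p * k\<close> with
  \<open>k < p\<close>.\<close>

lemma prime_rep_exists:
  assumes c: "c = 0 \<or> c = 1" and p: "prime p" and s: "p dvd nf c s 1"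
  shows "\<exists>u v. nf c u v = p"
proof -
  have p2: "2 \<le> p" using p by (simp add: prime_ge_2_int)
  obtain t where t: "p dvd s - t" "\<bar>2 * t\<bar> \<le> p" using centered_residue[of p s] p2 by auto
  from t(1) obtain i where i: "s = t + p * i" by (metis dvdE diff_add_cancel add.commute)
  have "nf c t 1 = nf c s 1 - p * (i * (2 * t + p * i) + c * i)"
    by (simp add: nf_def i algebra_simps)
  with s have "p dvd nf c t 1" by simp
  then obtain k where k: "nf c t 1 = p * k" by auto
  have "0 \<le> nf c t 1" "nf c t 1 \<noteq> 0" using nf_nonneg[OF c] nf_eq_0_iff[OF c] by auto
  with k have "0 < p * k" by linarith
  with p2 have k0: "0 < k" by (simp add: zero_less_mult_iff)
  have "\<bar>2 * t\<bar> * \<bar>2 * t\<bar> \<le> p * p" using t by (intro mult_mono) auto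
  then have "4 * (t * t) \<le> p * p" by (simp add: abs_mult[symmetric])
  moreover have "4 * (c * t) \<le> 2 * p" using c t by auto
  moreover have "2 * p \<le> p * p" using p2 by simp
  ultimately have "4 * nf c t 1 \<le> p * p + p * p + 4" by (simp add: nf_def)
  also have "\<dots> < 4 * (p * p)" using mult_mono[of 2 p 2 p] p2 by simp
  finally have "p * k < p * p" using k by simp
  with p2 have "k < p" by simp
  from prime_rep_descent[OF c p k0 this k] show ?thesis .
qed

section \<open>Divisor sums of a completely multiplicative function\<close>

lemma sum_dpairs_dvd:
  fixes f :: "int \<Rightarrow> int \<Rightarrow> int"
  assumes "0 < p"
  shows "(\<Sum>(a, x)\<in>{(a, x)\<in>dpairs k. p dvd a}. f a x) =
    (if p dvd k then (\<Sum>(a, x)\<in>dpairs (k div p). f (p * a) x) else 0)"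
proof (cases "p dvd k")
  case True
  then obtain m where m: "k = p * m" by auto
  have "(\<Sum>(a, x)\<in>{(a, x)\<in>dpairs k. p dvd a}. f a x) = (\<Sum>(a, x)\<in>dpairs m. f (p * a) x)"
    by (rule sum.reindex_bij_witness[where i = "\<lambda>(a, x). (p * a, x)" and j = "\<lambda>(a, x). (a div p, x)"])
       (use assms in \<open>auto simp: dpairs_def m mult.assoc zero_less_mult_iff elim!: dvdE\<close>)
  with m assms show ?thesis by simp
next
  case False
  then have "{(a, x)\<in>dpairs k. p dvd a} = {}" by (auto simp: dpairs_def)
  then have "(\<Sum>(a, x)\<in>{(a, x)\<in>dpairs k. p dvd a}. f a x) = 0" by (simp only: sum.empty)
  with False show ?thesis by simp
qed

lemma sum_dpairs_split:
  fixes f :: "int \<Rightarrow> int \<Rightarrow> int"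
  shows "(\<Sum>(a, x)\<in>dpairs k. f a x) = (\<Sum>(a, x)\<in>{(a, x)\<in>dpairs k. R a x}. f a x)
    + (\<Sum>(a, x)\<in>{(a, x)\<in>dpairs k. \<not> R a x}. f a x)"
proof -
  have "dpairs k = {(a, x)\<in>dpairs k. R a x} \<union> {(a, x)\<in>dpairs k. \<not> R a x}" by auto
  moreover have "sum (case_prod f) ({(a, x)\<in>dpairs k. R a x} \<union> {(a, x)\<in>dpairs k. \<not> R a x}) =
    sum (case_prod f) {(a, x)\<in>dpairs k. R a x} + sum (case_prod f) {(a, x)\<in>dpairs k. \<not> R a x}"
    by (rule sum.union_disjoint)
      ((rule finite_subset[OF _ finite_dpairs[of k]], blast)+, blast)
  ultimately show ?thesis by argo
qed

definition dsum :: "(int \<Rightarrow> int) \<Rightarrow> int \<Rightarrow> int" where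
  "dsum \<chi> k = (\<Sum>(a, x)\<in>dpairs k. \<chi> a)"

lemma dsum_swap: "dsum \<chi> k = (\<Sum>(a, x)\<in>dpairs k. \<chi> x)"
  unfolding dsum_def by (rule sum_dpairs_swap)

text \<open>The character is read off the cofactor \<open>x\<close>. Pairs with
  \<open>p dvd a\<close> come from pairs for \<open>n\<close> with the same \<open>x\<close>; in all
  others \<open>p\<close> divides \<open>x\<close> and a factor \<open>\<chi> p\<close> splits off.
  This covers all powers of \<open>p\<close> at once.\<close>

lemma dsum_prime_mult:
  assumes p: "prime p" and mult: "\<And>a b. \<chi> (a * b) = \<chi> a * \<chi> b"
  shows "dsum \<chi> (p * n) = (1 + \<chi> p) * dsum \<chi> n - \<chi> p * sub_div (dsum \<chi>) p n"
proof -
  have p0: "0 < p" using p by (simp add: prime_gt_0_int)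
  have div: "(\<Sum>(a, x)\<in>{(a, x)\<in>dpairs k. p dvd a}. \<chi> x) = sub_div (dsum \<chi>) p k" for k
    using sum_dpairs_dvd[OF p0, where k = k and f = "\<lambda>a x. \<chi> x"] by (simp add: sub_div_def dsum_swap)
  have "(\<Sum>(a, x)\<in>{(a, x)\<in>dpairs (p * n). \<not> p dvd a}. \<chi> x)
      = (\<Sum>(a, x)\<in>{(a, x)\<in>dpairs n. \<not> p dvd a}. \<chi> p * \<chi> x)"
  proof (rule sum.reindex_bij_witness[where i = "\<lambda>(a, x). (a, p * x)" and j = "\<lambda>(a, x). (a, x div p)"])
    fix z assume "z \<in> {(a, x)\<in>dpairs (p * n). \<not> p dvd a}"
    then obtain a x where z: "z = (a, x)" "0 < a" "0 < x" "a * x = p * n" "\<not> p dvd a"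
      by (auto simp: dpairs_def)
    then have "p dvd a * x" by simp
    with p z(5) have "p dvd x" using prime_dvd_mult_iff[of p a x] by blast
    then obtain y where y: "x = p * y" by auto
    with z p0 have "a * y = n" "0 < y" by (auto simp: zero_less_mult_iff)
    with z y p0 show "(case case z of (a, x) \<Rightarrow> (a, x div p) of (a, x) \<Rightarrow> (a, p * x)) = z"
      "(case z of (a, x) \<Rightarrow> (a, x div p)) \<in> {(a, x)\<in>dpairs n. \<not> p dvd a}"
      "(case case z of (a, x) \<Rightarrow> (a, x div p) of (a, x) \<Rightarrow> \<chi> p * \<chi> x) = (case z of (a, x) \<Rightarrow> \<chi> x)"
      by (auto simp: dpairs_def mult)
  qed (use p0 in \<open>auto simp: dpairs_def mult\<close>)
  also have "\<dots> = \<chi> p * (\<Sum>(a, x)\<in>{(a, x)\<in>dpairs n. \<not> p dvd a}. \<chi> x)"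
    by (simp add: sum_distrib_left case_prod_unfold)
  finally have nd: "(\<Sum>(a, x)\<in>{(a, x)\<in>dpairs (p * n). \<not> p dvd a}. \<chi> x) =
    \<chi> p * (\<Sum>(a, x)\<in>{(a, x)\<in>dpairs n. \<not> p dvd a}. \<chi> x)" .
  have tot: "dsum \<chi> k = sub_div (dsum \<chi>) p k + (\<Sum>(a, x)\<in>{(a, x)\<in>dpairs k. \<not> p dvd a}. \<chi> x)" for k
    using sum_dpairs_split[where k = k and f = "\<lambda>a x. \<chi> x" and R = "\<lambda>a x. p dvd a"] div[of k]
    by (simp add: dsum_swap)
  have "sub_div (dsum \<chi>) p (p * n) = dsum \<chi> n" using p0 by (simp add: sub_div_def)
  then have "dsum \<chi> (p * n) = dsum \<chi> n + \<chi> p * (dsum \<chi> n - sub_div (dsum \<chi>) p n)"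
    using tot[of "p * n"] tot[of n] nd by simp
  then show ?thesis by (simp add: algebra_simps)
qed

lemma dsum_1: "dsum \<chi> 1 = \<chi> 1"
proof -
  have "dpairs 1 = {(1, 1)}" by (auto simp: dpairs_def zmult_eq_1_iff)
  then show ?thesis by (simp add: dsum_def)
qed

text \<open>The representation numbers satisfy the same Hecke recursion as the divisor sums.\<close>

lemma card_reps_eq_dsum:
  assumes mult: "\<And>a b. \<chi> (a * b) = \<chi> a * \<chi> b" and one: "\<chi> 1 = 1"
    and hecke: "\<And>p n. prime p \<Longrightarrow> int (card (reps c (p * n))) =
      (1 + \<chi> p) * int (card (reps c n)) - \<chi> p * sub_div (\<lambda>k. int (card (reps c k))) p n"
    and n: "0 < n"
  shows "int (card (reps c n)) = int (card (reps c 1)) * dsum \<chi> n"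
  using n
proof (induction "nat n" arbitrary: n rule: less_induct)
  case less
  show ?case
  proof (cases "n = 1")
    case True
    then show ?thesis by (simp add: dsum_1 one)
  next
    case False
    with less.prems have "\<not> is_unit n" by auto
    then obtain p where p: "prime p" "p dvd n" using prime_divisor_exists[of n] less.prems by auto
    then obtain m where m: "n = p * m" by auto
    have p1: "1 < p" using p(1) by (simp add: prime_gt_1_int)
    with m less.prems have m0: "0 < m" by (simp add: zero_less_mult_iff)
    have lt: "m < n" using m p1 m0 by simp
    have IH1: "int (card (reps c m)) = int (card (reps c 1)) * dsum \<chi> m"
      using less.hyps[of m] m0 lt by simp
    have IH2: "sub_div (\<lambda>k. int (card (reps c k))) p m = int (card (reps c 1)) * sub_div (dsum \<chi>) p m"
    proof (cases "p dvd m")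
      case True
      then obtain l where l: "m = p * l" by auto
      with m0 p1 have "0 < l" by (simp add: zero_less_mult_iff)
      moreover have "l < n" using l p1 \<open>0 < l\<close> lt by (smt (verit) mult_less_cancel_right1)
      ultimately have "int (card (reps c l)) = int (card (reps c 1)) * dsum \<chi> l"
        using less.hyps[of l] by simp
      with l p1 show ?thesis by (simp add: sub_div_def)
    qed (simp add: sub_div_def)
    show ?thesis
      unfolding m hecke[OF p(1)] dsum_prime_mult[OF p(1) mult] IH1 IH2
      by (simp add: algebra_simps)
  qed
qed

section \<open>Split and inert primes\<close>

text \<open>Elements of order 4 and 3 modulo \<open>p\<close> are zeros of s^2 + 1 and s^2 + s + 1,
  the values \<open>nf c s 1\<close> from which the descent starts.\<close>

lemma ord_exists:
  assumes "prime (p::nat)" "d dvd p - 1"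
  shows "\<exists>x. ord p x = d"
proof -
  have "card {x \<in> totatives p. ord p x = d} = totient d"
    using prime_card_elements_with_ord_eq_totient[of p d] assms prime_gt_1_nat[of p] by simp
  moreover have "0 < d" using assms prime_gt_1_nat[of p] by (auto intro!: Nat.gr0I)
  ultimately have "card {x \<in> totatives p. ord p x = d} > 0" by simp
  then show ?thesis by (metis (mono_tags, lifting) Collect_empty_eq card.empty less_irrefl)
qed

lemma root_exists_4:
  assumes p: "prime (p::int)" and "p mod 4 = 1"
  shows "\<exists>s. p dvd nf 0 s 1"
proof -
  define q where "q = nat p"
  have pq: "p = int q" "prime q" using p prime_gt_0_int[of p] by (auto simp: q_def prime_nat_iff_prime)
  have "4 dvd q - 1" using assms(2) pq by presburger
  then obtain x where x: "ord q x = 4" using ord_exists[OF pq(2)] by auto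
  have "[x ^ 4 = 1] (mod q)" "\<not> [x ^ 2 = 1] (mod q)"
    using x ord_divides[of x 4 q] ord_divides[of x 2 q] by simp_all
  then have "[int x ^ 4 = 1] (mod p)" "\<not> [int x ^ 2 = 1] (mod p)"
    unfolding pq using cong_int_iff[of "x ^ 4" 1 q] cong_int_iff[of "x ^ 2" 1 q] by simp_all
  then have "p dvd int x ^ 4 - 1" "\<not> p dvd int x ^ 2 - 1" by (simp_all add: cong_iff_dvd_diff)
  moreover have "int x ^ 4 - 1 = (int x ^ 2 - 1) * nf 0 (int x) 1"
    by (simp add: nf_def power_numeral_reduce algebra_simps)
  ultimately show ?thesis using p by (auto simp: prime_dvd_mult_iff)
qed

lemma root_exists_3:
  assumes p: "prime (p::int)" and "p mod 3 = 1"
  shows "\<exists>s. p dvd nf 1 s 1"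
proof -
  define q where "q = nat p"
  have pq: "p = int q" "prime q" using p prime_gt_0_int[of p] by (auto simp: q_def prime_nat_iff_prime)
  have "3 dvd q - 1" using assms(2) pq by presburger
  then obtain x where x: "ord q x = 3" using ord_exists[OF pq(2)] by auto
  have "[x ^ 3 = 1] (mod q)" "\<not> [x ^ 1 = 1] (mod q)"
    using x ord_divides[of x 3 q] ord_divides[of x 1 q] by simp_all
  then have "[int x ^ 3 = 1] (mod p)" "\<not> [int x = 1] (mod p)"
    unfolding pq using cong_int_iff[of "x ^ 3" 1 q] cong_int_iff[of x 1 q] by simp_all
  then have "p dvd int x ^ 3 - 1" "\<not> p dvd int x - 1" by (simp_all add: cong_iff_dvd_diff)
  moreover have "int x ^ 3 - 1 = (int x - 1) * nf 1 (int x) 1"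
    by (simp add: nf_def power_numeral_reduce algebra_simps)
  ultimately show ?thesis using p by (auto simp: prime_dvd_mult_iff)
qed

lemma fermat_int:
  assumes "prime (p::int)" "\<not> p dvd a"
  shows "p dvd a ^ (nat p - 1) - 1"
proof -
  have p0: "0 < p" using assms by (simp add: prime_gt_0_int)
  define b where "b = nat (a mod p)"
  have b: "int b = a mod p" using p0 by (simp add: b_def)
  have "\<not> nat p dvd b" using assms(2) p0 b by (metis dvd_mod_iff dvd_refl int_dvd_int_iff int_nat_eq less_imp_le)
  then have "[b ^ (nat p - 1) = 1] (mod nat p)"
    using fermat_theorem[of "nat p" b] assms(1) by simp
  then have "[int b ^ (nat p - 1) = 1] (mod p)"
    using cong_int_iff[of "b ^ (nat p - 1)" 1 "nat p"] p0 by simp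
  moreover have "[int b ^ (nat p - 1) = a ^ (nat p - 1)] (mod p)"
    by (rule cong_pow) (simp add: b cong_def)
  ultimately have "[a ^ (nat p - 1) = 1] (mod p)" by (metis cong_sym cong_trans)
  then show ?thesis by (simp add: cong_iff_dvd_diff)
qed

text \<open>If \<open>p\<close> did not divide \<open>y\<close>, then x^2 = - y^2 modulo
  \<open>p\<close>, raised to the odd power (p - 1) / 2, would turn Fermat's theorem into 1 = -
  1.\<close>

lemma inert_4:
  assumes p: "prime (p::int)" and "p mod 4 = 3" and d: "p dvd nf 0 x y"
  shows "p dvd x \<and> p dvd y"
proof -
  have y: "p dvd y"
  proof (rule ccontr)
    assume y: "\<not> p dvd y"
    have x: "\<not> p dvd x"
    proof
      assume "p dvd x"
      then have "p dvd x * x" by simp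
      with d have "p dvd y * y" by (simp add: nf_def dvd_add_right_iff)
      with p y show False by (simp add: prime_dvd_mult_iff)
    qed
    define m where "m = (nat p - 1) div 2"
    have "int (nat p) mod 4 = 3" using assms(2) prime_gt_0_int[OF p] by simp
    moreover have "odd ((q - 1) div 2) \<and> q - 1 = 2 * ((q - 1) div 2)" if "int q mod 4 = 3" for q :: nat
      using that by presburger
    ultimately have "odd m" "nat p - 1 = 2 * m" unfolding m_def by blast+
    have "[x * x = - (y * y)] (mod p)" using d by (simp add: nf_def cong_iff_dvd_diff)
    then have "[(x * x) ^ m = (- (y * y)) ^ m] (mod p)" by (rule cong_pow)
    then have "[x ^ (nat p - 1) = - (y ^ (nat p - 1))] (mod p)"
      using \<open>odd m\<close> \<open>nat p - 1 = 2 * m\<close> by (simp add: power_mult power2_eq_square power_minus_odd)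
    then have "p dvd x ^ (nat p - 1) + y ^ (nat p - 1)" by (simp add: cong_iff_dvd_diff)
    from dvd_diff[OF this dvd_add[OF fermat_int[OF p x] fermat_int[OF p y]]]
    have "p dvd 2" by (simp add: algebra_simps)
    then have "p \<le> 2" by (simp add: zdvd_imp_le)
    with prime_ge_2_int[OF p] assms(2) show False by auto
  qed
  then have "p dvd y * y" by simp
  with d have "p dvd x * x" by (simp add: nf_def dvd_add_left_iff)
  with p y show ?thesis by (simp add: prime_dvd_mult_iff)
qed

text \<open>Cubing is injective on nonzero residues because p - 1 = 3 m + 1. Since x^3 = y^3 modulo
  \<open>p\<close>, it would follow that x = y, hence that \<open>p\<close> divides 3 y^2.\<close>

lemma inert_3:
  assumes p: "prime (p::int)" and "p mod 3 = 2" and d: "p dvd nf 1 x y"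
  shows "p dvd x \<and> p dvd y"
proof -
  have y: "p dvd y"
  proof (rule ccontr)
    assume y: "\<not> p dvd y"
    have x: "\<not> p dvd x"
    proof
      assume "p dvd x"
      then have "p dvd x * x + x * y" by simp
      with d have "p dvd y * y" by (simp add: nf_def dvd_add_right_iff)
      with p y show False by (simp add: prime_dvd_mult_iff)
    qed
    define m where "m = (nat p - 1) div 3"
    have "int (nat p) mod 3 = 2" using assms(2) prime_gt_0_int[OF p] by simp
    moreover have "q - 1 = 3 * ((q - 1) div 3) + 1" if "int q mod 3 = 2" for q :: nat
      using that by presburger
    ultimately have m: "nat p - 1 = 3 * m + 1" unfolding m_def by blast
    have "x ^ 3 - y ^ 3 = (x - y) * nf 1 x y" by (simp add: nf_def power_numeral_reduce algebra_simps)
    with d have "[x ^ 3 = y ^ 3] (mod p)" by (simp add: cong_iff_dvd_diff)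
    then have c3: "[(x ^ 3) ^ m = (y ^ 3) ^ m] (mod p)" by (rule cong_pow)
    have "[x ^ (nat p - 1) = 1] (mod p)" "[y ^ (nat p - 1) = 1] (mod p)"
      using fermat_int[OF p x] fermat_int[OF p y] by (simp_all add: cong_iff_dvd_diff)
    then have "[x ^ (nat p - 1) = y ^ (nat p - 1)] (mod p)" by (metis cong_sym cong_trans)
    then have "[(x ^ 3) ^ m * x = (y ^ 3) ^ m * y] (mod p)"
      by (simp only: m power_add power_mult power_one_right)
    moreover have "[(x ^ 3) ^ m * y = (y ^ 3) ^ m * y] (mod p)" using c3 by (rule cong_mult) simp
    ultimately have "[(x ^ 3) ^ m * x = (x ^ 3) ^ m * y] (mod p)" by (metis cong_sym cong_trans)
    then have "p dvd (x ^ 3) ^ m * (x - y)" by (simp add: cong_iff_dvd_diff algebra_simps)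
    moreover have "\<not> p dvd (x ^ 3) ^ m" using x p by (meson prime_dvd_power)
    ultimately have xy: "p dvd x - y" using p by (simp add: prime_dvd_mult_iff)
    have "nf 1 x y = (x - y) * (x + 2 * y) + 3 * (y * y)" by (simp add: nf_def algebra_simps)
    with d xy have "p dvd 3 * (y * y)" by (metis dvd_add_right_iff dvd_mult2)
    with p y have "p dvd 3" by (simp add: prime_dvd_mult_iff)
    then have "p \<le> 3" by (simp add: zdvd_imp_le)
    with prime_ge_2_int[OF p] assms(2) have "p = 2" by (cases "p = 3") auto
    with \<open>p dvd 3\<close> show False by simp
  qed
  then have "p dvd x * y + y * y" by simp
  with d have "p dvd x * x" by (simp add: nf_def dvd_add_left_iff add.assoc)
  with p y show ?thesis by (simp add: prime_dvd_mult_iff)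
qed

lemma prime_mod4_cases: "prime (p::int) \<Longrightarrow> p = 2 \<or> p mod 4 = 1 \<or> p mod 4 = 3"
proof -
  assume p: "prime p"
  have "prime (2::int)" by simp
  then have "p = 2 \<or> odd p" using primes_dvd_imp_eq[of 2 p] p by metis
  then show ?thesis by presburger
qed

lemma prime_mod3_cases: "prime (p::int) \<Longrightarrow> p = 3 \<or> p mod 3 = 1 \<or> p mod 3 = 2"
proof -
  assume p: "prime p"
  have "prime (3::int)" by simp
  then have "p = 3 \<or> \<not> 3 dvd p" using primes_dvd_imp_eq[of 3 p] p by metis
  then show ?thesis by presburger
qed

section \<open>The representation numbers of the two forms\<close>

lemma reps_1_subset:
  assumes "c = 0 \<or> c = 1"
  shows "reps c 1 \<subseteq> {-1, 0, 1} \<times> {-1, 0, 1}"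
proof clarify
  fix x y assume "(x, y) \<in> reps c 1"
  then have *: "nf c x y = 1" by (simp add: reps_def)
  have small: "x \<in> {-1, 0, 1}" if "x * x \<le> 2" for x :: int
  proof -
    have "\<not> 2 \<le> \<bar>x\<bar>" using that mult_mono[of 2 "\<bar>x\<bar>" 2 "\<bar>x\<bar>"] by auto
    then show ?thesis by auto
  qed
  show "x \<in> {-1, 0, 1} \<and> y \<in> {-1, 0, 1}"
    using nf_lower_bound[OF assms, where x = x and y = y] * small[of x] small[of y] by simp
qed

text \<open>The three cases are the ramified, split and inert primes. The factor 4 is the number of
  units, counted as the representations of 1.\<close>

theorem card_sum_two_squares:
  assumes "0 < n"
  shows "int (card (reps 0 n)) = 4 * dsum chi4 n"
proof -
  have "int (card (reps 0 n)) = int (card (reps 0 1)) * dsum chi4 n"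
  proof (rule card_reps_eq_dsum[OF chi4_mult _ _ assms])
    fix p n :: int assume p: "prime p"
    show "int (card (reps 0 (p * n))) = (1 + chi4 p) * int (card (reps 0 n))
      - chi4 p * sub_div (\<lambda>k. int (card (reps 0 k))) p n"
      using prime_mod4_cases[OF p]
    proof (elim disjE)
      assume "p = 2"
      then show ?thesis by (simp add: card_reps_two)
    next
      assume p1: "p mod 4 = 1"
      then obtain s where "p dvd nf 0 s 1" using root_exists_4[OF p] by auto
      then obtain u v where uv: "nf 0 u v = p" using prime_rep_exists[of 0 p s] p by auto
      have "\<not> p dvd 4 - 0 * 0"
      proof
        assume "p dvd 4 - 0 * 0"
        then have "p dvd 2 * 2" by simp
        with p have "p dvd 2" by (metis prime_dvd_mult_iff)
        then have "p \<le> 2" by (simp add: zdvd_imp_le)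
        with prime_ge_2_int[OF p] p1 show False by auto
      qed
      with card_reps_split[of 0 p u v n] uv p p1 show ?thesis by (simp add: chi4_def)
    next
      assume pm: "p mod 4 = 3"
      have "int (card (reps 0 (p * n))) = sub_div (\<lambda>k. int (card (reps 0 k))) p n"
        by (rule card_reps_inert[OF _ p inert_4[OF p pm]]) simp_all
      with pm show ?thesis by (simp add: chi4_def)
    qed
  qed simp
  moreover have "reps 0 1 = {(1, 0), (-1, 0), (0, 1), (0, -1)}"
  proof -
    have "reps 0 1 = {z \<in> {-1, 0, 1} \<times> {-1, 0, 1}. nf 0 (fst z) (snd z) = 1}"
      using reps_1_subset[of 0] by (auto simp: reps_def)
    also have "\<dots> = {(1, 0), (-1, 0), (0, 1), (0, -1)}" by (auto simp: nf_def)
    finally show ?thesis .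
  qed
  ultimately show ?thesis by simp
qed

theorem card_reps_eisenstein:
  assumes "0 < n"
  shows "int (card (reps 1 n)) = 6 * dsum chi3 n"
proof -
  have "int (card (reps 1 n)) = int (card (reps 1 1)) * dsum chi3 n"
  proof (rule card_reps_eq_dsum[OF chi3_mult _ _ assms])
    fix p n :: int assume p: "prime p"
    show "int (card (reps 1 (p * n))) = (1 + chi3 p) * int (card (reps 1 n))
      - chi3 p * sub_div (\<lambda>k. int (card (reps 1 k))) p n"
      using prime_mod3_cases[OF p]
    proof (elim disjE)
      assume "p = 3"
      then show ?thesis by (simp add: card_reps_three)
    next
      assume p1: "p mod 3 = 1"
      then obtain s where "p dvd nf 1 s 1" using root_exists_3[OF p] by auto
      then obtain u v where uv: "nf 1 u v = p" using prime_rep_exists[of 1 p s] p by auto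
      have "\<not> p dvd 4 - 1 * 1"
      proof
        assume "p dvd 4 - 1 * 1"
        then have "p \<le> 3" by (simp add: zdvd_imp_le)
        with prime_ge_2_int[OF p] p1 show False by (cases "p = 2"; cases "p = 3") auto
      qed
      with card_reps_split[of 1 p u v n] uv p p1 show ?thesis by (simp add: chi3_def)
    next
      assume pm: "p mod 3 = 2"
      have "int (card (reps 1 (p * n))) = sub_div (\<lambda>k. int (card (reps 1 k))) p n"
        by (rule card_reps_inert[OF _ p inert_3[OF p pm]]) simp_all
      with pm show ?thesis by (simp add: chi3_def)
    qed
  qed simp
  moreover have "reps 1 1 = {(1, 0), (-1, 0), (0, 1), (0, -1), (1, -1), (-1, 1)}"
  proof -
    have "reps 1 1 = {z \<in> {-1, 0, 1} \<times> {-1, 0, 1}. nf 1 (fst z) (snd z) = 1}"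
      using reps_1_subset[of 1] by (auto simp: reps_def)
    also have "\<dots> = {(1, 0), (-1, 0), (0, 1), (0, -1), (1, -1), (-1, 1)}" by (auto simp: nf_def)
    finally show ?thesis .
  qed
  ultimately show ?thesis by simp
qed

section \<open>Three specialisations of Liouville's identity\<close>

text \<open>\<open>E1\<close> and \<open>E2\<close> are the coefficients of the two Eisenstein
  series of weight 2 attached to \<open>chi12\<close>; they differ in whether the character is
  evaluated at the summed divisor or at its cofactor.\<close>

definition E1 :: "int \<Rightarrow> int" where
  "E1 k = (\<Sum>(a, x)\<in>dpairs k. chi12 a * a)"

definition E2 :: "int \<Rightarrow> int" where
  "E2 k = (\<Sum>(a, x)\<in>dpairs k. chi12 a * x)"

text \<open>The factor in \<open>a\<close> of \<open>chi12 (a - b) - chi12 (a + b)\<close> for even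
  \<open>b\<close>. The same function arises from partial sums of \<open>chi12\<close>, so it
  appears on both sides of the first specialisation.\<close>

definition wt :: "int \<Rightarrow> int" where
  "wt a = chi4 a * (if 3 dvd a then - 2 else 1)"

text \<open>For even \<open>b\<close> this is (-1)^(b/2), the factor by which a shift by
  \<open>b\<close> changes \<open>chi4\<close>.\<close>

definition sg :: "int \<Rightarrow> int" where
  "sg b = (if 4 dvd b then 1 else - 1)"

lemma chi4_shift:
  assumes "even b"
  shows "chi4 (a - b) = chi4 a * sg b" "chi4 (a + b) = chi4 a * sg b"
proof -
  have b: "b mod 4 = 0 \<or> b mod 4 = 2" using assms by presburger
  have r: "chi4 (a - b) = chi4 (a mod 4 - b mod 4)" "chi4 (a + b) = chi4 (a mod 4 + b mod 4)"
    by (rule chi4_cong, simp add: mod_simps)+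
  show "chi4 (a - b) = chi4 a * sg b" "chi4 (a + b) = chi4 a * sg b"
    unfolding r using b int_mod4_cases[of a]
    by (elim disjE; simp add: chi4_def sg_def dvd_eq_mod_eq_0)+
qed

lemma chi3_diff: "chi3 (a - b) - chi3 (a + b) = (if 3 dvd a then - 2 else 1) * chi3 b"
proof -
  have r: "chi3 (a - b) = chi3 (a mod 3 - b mod 3)" "chi3 (a + b) = chi3 (a mod 3 + b mod 3)"
    by (rule chi3_cong, simp add: mod_simps)+
  show ?thesis
    unfolding r using int_mod3_cases[of a] int_mod3_cases[of b]
    by (elim disjE) (simp_all add: chi3_def dvd_eq_mod_eq_0)
qed

lemma chi12_diff:
  assumes "even b"
  shows "chi12 (a - b) - chi12 (a + b) = wt a * (sg b * chi3 b)"
proof -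
  have "chi12 (a - b) - chi12 (a + b) = chi4 a * sg b * (chi3 (a - b) - chi3 (a + b))"
    by (simp add: chi12_def chi4_shift[OF assms] algebra_simps)
  then show ?thesis unfolding chi3_diff by (simp add: wt_def)
qed

text \<open>If 3 divides x + y, then N = a x + b y is (a - b) x modulo 3, so
  \<open>chi3 (a - b)\<close> is - \<open>chi3 N\<close> times \<open>chi3 y\<close>. If 3 divides x
  - y, then N is (a + b) y, and the outer minus sign gives the same value. As 3 does not divide N,
  exactly one case occurs when \<open>x\<close> and \<open>y\<close> are both prime to 3, and none
  otherwise. The point is that the right-hand side separates the variables.\<close>

lemma chi3_cross:
  assumes "\<not> 3 dvd a * x + b * y"
  shows "chi3 (a - b) * (if 3 dvd x + y then 1 else 0) - chi3 (a + b) * (if 3 dvd x - y then 1 else 0)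
    = - chi3 (a * x + b * y) * (chi3 y * (if 3 dvd x then 0 else 1))"
proof -
  have r: "chi3 (a - b) = chi3 (a mod 3 - b mod 3)" "chi3 (a + b) = chi3 (a mod 3 + b mod 3)"
    "chi3 y = chi3 (y mod 3)"
    by (rule chi3_cong, simp add: mod_simps)+
  have "[a * x + b * y = a mod 3 * (x mod 3) + b mod 3 * (y mod 3)] (mod 3)"
    by (intro cong_add cong_mult) (simp_all add: cong_def)
  then have m: "(a * x + b * y) mod 3 = (a mod 3 * (x mod 3) + b mod 3 * (y mod 3)) mod 3"
    by (simp only: cong_def)
  then have r': "chi3 (a * x + b * y) = chi3 (a mod 3 * (x mod 3) + b mod 3 * (y mod 3))"
    by (rule chi3_cong)
  have d: "3 dvd x + y \<longleftrightarrow> 3 dvd x mod 3 + y mod 3" "3 dvd x - y \<longleftrightarrow> 3 dvd x mod 3 - y mod 3"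
    "3 dvd a * x + b * y \<longleftrightarrow> 3 dvd a mod 3 * (x mod 3) + b mod 3 * (y mod 3)"
    "3 dvd x \<longleftrightarrow> 3 dvd x mod 3"
    unfolding dvd_eq_mod_eq_0 m by (simp_all add: mod_simps)
  have "\<not> 3 dvd a * x + b * y \<longrightarrow> ?thesis"
    unfolding r r' d
    using int_mod3_cases[of a] int_mod3_cases[of b] int_mod3_cases[of x] int_mod3_cases[of y]
    by (elim disjE) (simp_all add: chi3_def)
  with assms show ?thesis by blast
qed

text \<open>On this diagonal the equation reads a (x + y) = N, so x + y is the cofactor of the
  divisor \<open>a\<close> and \<open>y\<close> runs freely below it.\<close>

lemma sum_bilin_diag_ab:
  fixes f :: "int \<Rightarrow> int \<Rightarrow> int \<Rightarrow> int"
  shows "(\<Sum>(a, b, x, y)\<in>{(a, b, x, y)\<in>bilin N. a = b}. f a x y) =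
    (\<Sum>(a, X)\<in>dpairs N. \<Sum>y\<in>{1..<X}. f a (X - y) y)"
proof -
  have "(\<Sum>(a, X)\<in>dpairs N. \<Sum>y\<in>{1..<X}. f a (X - y) y) =
    (\<Sum>z\<in>dpairs N. \<Sum>y\<in>{1..<snd z}. f (fst z) (snd z - y) y)"
    by (simp add: case_prod_unfold)
  also have "\<dots> = (\<Sum>(z, y)\<in>Sigma (dpairs N) (\<lambda>z. {1..<snd z}). f (fst z) (snd z - y) y)"
    by (rule sum.Sigma) simp_all
  also have "\<dots> = (\<Sum>(a, b, x, y)\<in>{(a, b, x, y)\<in>bilin N. a = b}. f a x y)"
    by (rule sum.reindex_bij_witness[where i = "\<lambda>(a, b, x, y). ((a, x + y), y)"
          and j = "\<lambda>(z, y). (fst z, fst z, snd z - y, y)"])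
       (auto simp: dpairs_def bilin_def algebra_simps)
  finally show ?thesis by simp
qed

lemma sum_bilin_diag_xy:
  fixes f :: "int \<Rightarrow> int \<Rightarrow> int \<Rightarrow> int"
  shows "(\<Sum>(a, b, x, y)\<in>{(a, b, x, y)\<in>bilin N. x = y}. f a b y) =
    (\<Sum>(A, x)\<in>dpairs N. \<Sum>a\<in>{1..<A}. f a (A - a) x)"
proof -
  have "(\<Sum>(A, x)\<in>dpairs N. \<Sum>a\<in>{1..<A}. f a (A - a) x) =
    (\<Sum>z\<in>dpairs N. \<Sum>a\<in>{1..<fst z}. f a (fst z - a) (snd z))"
    by (simp add: case_prod_unfold)
  also have "\<dots> = (\<Sum>(z, a)\<in>Sigma (dpairs N) (\<lambda>z. {1..<fst z}). f a (fst z - a) (snd z))"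
    by (rule sum.Sigma) simp_all
  also have "\<dots> = (\<Sum>(a, b, x, y)\<in>{(a, b, x, y)\<in>bilin N. x = y}. f a b y)"
    by (rule sum.reindex_bij_witness[where i = "\<lambda>(a, b, x, y). ((a + b, x), a)"
          and j = "\<lambda>(z, a). (a, fst z - a, snd z, snd z)"])
       (auto simp: dpairs_def bilin_def algebra_simps)
  finally show ?thesis by simp
qed

text \<open>The test function is \<open>chi12 k * u m\<close>. As \<open>chi12\<close> vanishes at
  even arguments, only \<open>a\<close>, \<open>b\<close> of opposite parity contribute, and
  exchanging (a, x) with (b, y) identifies the two cases, whence the factor 2.\<close>

lemma liouville_chi12:
  fixes u :: "int \<Rightarrow> int"
  assumes ev: "\<And>m. u (- m) = u m"
  shows "2 * (\<Sum>(a, b, x, y)\<in>{(a, b, x, y)\<in>bilin N. odd a \<and> even b}.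
        chi12 (a - b) * u (x + y) - chi12 (a + b) * u (x - y)) =
      2 * (\<Sum>(a, x)\<in>dpairs N. chi12 a * (\<Sum>y\<in>{1..<x}. u y))
    - (\<Sum>(a, x)\<in>dpairs N. (a - 1) * chi12 a) * u 0
    - 2 * (\<Sum>(a, x)\<in>dpairs N. (\<Sum>k\<in>{1..<a}. chi12 k) * u x)"
proof -
  let ?f = "\<lambda>a b x y. chi12 (a - b) * u (x + y) - chi12 (a + b) * u (x - y)"
  let ?O = "{(a, b, x, y)\<in>bilin N. odd a \<and> even b}" and ?E = "{(a, b, x, y)\<in>bilin N. even a \<and> odd b}"
  have L: "(\<Sum>(a, b, x, y)\<in>bilin N. ?f a b x y) =
      (\<Sum>(a, b, x, y)\<in>{(a, b, x, y)\<in>bilin N. a = b}. chi12 0 * u (x + y) + 2 * (chi12 a * u y))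
    - (\<Sum>(a, b, x, y)\<in>{(a, b, x, y)\<in>bilin N. x = y}. chi12 (a + b) * u 0 + 2 * (chi12 a * u y))"
    by (rule liouville_identity) (simp_all add: ev)
  have 1: "(\<Sum>(a, b, x, y)\<in>{(a, b, x, y)\<in>bilin N. a = b}. chi12 0 * u (x + y) + 2 * (chi12 a * u y))
    = 2 * (\<Sum>(a, x)\<in>dpairs N. chi12 a * (\<Sum>y\<in>{1..<x}. u y))"
    unfolding sum_bilin_diag_ab by (simp add: sum_distrib_left case_prod_unfold)
  have 2: "(\<Sum>(a, b, x, y)\<in>{(a, b, x, y)\<in>bilin N. x = y}. chi12 (a + b) * u 0 + 2 * (chi12 a * u y))
    = (\<Sum>(a, x)\<in>dpairs N. (a - 1) * chi12 a) * u 0 + 2 * (\<Sum>(a, x)\<in>dpairs N. (\<Sum>k\<in>{1..<a}. chi12 k) * u x)"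
  proof -
    have "(\<Sum>(a, b, x, y)\<in>{(a, b, x, y)\<in>bilin N. x = y}. chi12 (a + b) * u 0 + 2 * (chi12 a * u y))
      = (\<Sum>(A, x)\<in>dpairs N. \<Sum>a\<in>{1..<A}. chi12 A * u 0 + 2 * (chi12 a * u x))"
      unfolding sum_bilin_diag_xy[where f = "\<lambda>a b y. chi12 (a + b) * u 0 + 2 * (chi12 a * u y)"] by simp
    also have "\<dots> = (\<Sum>(A, x)\<in>dpairs N. (A - 1) * chi12 A * u 0 + 2 * ((\<Sum>k\<in>{1..<A}. chi12 k) * u x))"
      by (rule sum.cong) (auto simp: dpairs_def sum.distrib sum_distrib_left sum_distrib_right)
    finally show ?thesis by (simp add: sum.distrib sum_distrib_left sum_distrib_right case_prod_unfold)
  qed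
  have swap: "(\<Sum>(a, b, x, y)\<in>?E. ?f a b x y) = (\<Sum>(a, b, x, y)\<in>?O. ?f a b x y)"
  proof (rule sum.reindex_bij_witness[where i = "\<lambda>(a, b, x, y). (b, a, y, x)"
          and j = "\<lambda>(a, b, x, y). (b, a, y, x)"])
    fix z assume "z \<in> ?E"
    obtain a b x y where z: "z = (a, b, x, y)" by (cases z)
    have "chi12 (b - a) = chi12 (a - b)" "u (y - x) = u (x - y)"
      using chi12_minus[of "a - b"] ev[of "x - y"] by simp_all
    with z show "(case case z of (a, b, x, y) \<Rightarrow> (b, a, y, x) of (a, b, x, y) \<Rightarrow> ?f a b x y) =
        (case z of (a, b, x, y) \<Rightarrow> ?f a b x y)"
      by (simp add: add.commute)
  qed (auto simp: bilin_def algebra_simps)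
  have fin: "finite ?O" "finite ?E"
    by (rule finite_subset[OF _ finite_bilin[of N]], blast)+
  have "(\<Sum>(a, b, x, y)\<in>bilin N. ?f a b x y) = (\<Sum>(a, b, x, y)\<in>?O \<union> ?E. ?f a b x y)"
  proof (rule sum.mono_neutral_right)
    show "\<forall>z\<in>bilin N - (?O \<union> ?E). (case z of (a, b, x, y) \<Rightarrow> ?f a b x y) = 0"
    proof
      fix z assume z: "z \<in> bilin N - (?O \<union> ?E)"
      obtain a b x y where abxy: "z = (a, b, x, y)" by (cases z)
      with z have "even (a - b)" "even (a + b)" by auto
      then show "(case z of (a, b, x, y) \<Rightarrow> ?f a b x y) = 0" by (simp add: abxy chi12_even)
    qed
  qed auto
  also have "\<dots> = (\<Sum>(a, b, x, y)\<in>?O. ?f a b x y) + (\<Sum>(a, b, x, y)\<in>?E. ?f a b x y)"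
    by (rule sum.union_disjoint) (use fin in auto)
  finally show ?thesis using L 1 2 swap by linarith
qed

lemma int_odd_induct [consumes 2, case_names base step]:
  fixes d :: int
  assumes "odd d" "0 < d" "Q 1" "\<And>d. odd d \<Longrightarrow> 0 < d \<Longrightarrow> Q d \<Longrightarrow> Q (d + 2)"
  shows "Q d"
proof -
  have "Q (2 * int j + 1)" for j
  proof (induction j)
    case (Suc j)
    have "2 * int (Suc j) + 1 = (2 * int j + 1) + 2" by simp
    with assms(4)[OF _ _ Suc] show ?case by simp
  qed (simp add: assms(3))
  from this[of "nat (d div 2)"] show ?thesis using assms(1,2) by (simp add: odd_two_times_div_two_succ)
qed

lemma sum_upto_add2:
  fixes f :: "int \<Rightarrow> int"
  assumes "0 < d"
  shows "sum f {1..<d + 2} = sum f {1..<d} + f d + f (d + 1)"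
proof -
  have "{1..<d + 2} = insert (d + 1) (insert d {1..<d})" using assms by auto
  then show ?thesis by simp
qed

lemma chi12_partial_sum:
  assumes "odd d" "0 < d"
  shows "chi12 d + 2 * (\<Sum>k\<in>{1..<d}. chi12 k) = wt d"
  using assms
proof (induction d rule: int_odd_induct)
  case base
  then show ?case by (simp add: chi12_def wt_def)
next
  case (step d)
  have "wt (d + 2) = wt d + chi12 d + chi12 (d + 2)"
  proof -
    have 1: "chi4 (d + 2) = - chi4 d" using chi4_shift(2)[of 2 d] by (simp add: sg_def)
    have 2: "chi3 (d + 2) = chi3 (d mod 3 + 2)" by (rule chi3_cong) (simp add: mod_simps)
    have 3: "3 dvd d + 2 \<longleftrightarrow> d mod 3 = 1" by presburger
    show ?thesis unfolding wt_def chi12_def 1 2 3 using int_mod3_cases[of d]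
      by (elim disjE) (simp_all add: chi3_def dvd_eq_mod_eq_0)
  qed
  with step show ?case by (simp add: sum_upto_add2 chi12_even)
qed

lemma count_odd_below:
  assumes "odd d" "0 < (d::int)"
  shows "2 * (\<Sum>k\<in>{1..<d}. if odd k then 1 else 0) = d - 1"
  using assms by (induction d rule: int_odd_induct) (simp_all add: sum_upto_add2)

lemma count_even_below:
  assumes "odd d" "0 < (d::int)"
  shows "2 * (\<Sum>k\<in>{1..<d}. if even k then 1 else 0) = d - 1"
  using assms by (induction d rule: int_odd_induct) (simp_all add: sum_upto_add2)

lemma count_odd3_below:
  assumes "odd d" "0 < (d::int)"
  shows "6 * (\<Sum>k\<in>{1..<d}. if odd k \<and> 3 dvd k then 1 else 0) = d - chi3 d - (if 3 dvd d then 3 else 0)"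
  using assms
proof (induction d rule: int_odd_induct)
  case (step d)
  have 2: "chi3 (d + 2) = chi3 (d mod 3 + 2)" by (rule chi3_cong) (simp add: mod_simps)
  have 3: "3 dvd d + 2 \<longleftrightarrow> d mod 3 = 1" by presburger
  have 4: "3 dvd d \<longleftrightarrow> d mod 3 = 0" by presburger
  show ?case unfolding 2 3 sum_upto_add2[OF step(2)] using int_mod3_cases[of d] step
    by (elim disjE) (simp_all add: chi3_def 4)
qed simp

lemma dpairs_odd: "odd N \<Longrightarrow> (a, x) \<in> dpairs N \<Longrightarrow> odd a \<and> odd x \<and> 0 < a \<and> 0 < x"
  by (auto simp: dpairs_def)

text \<open>Here \<open>u\<close> selects odd arguments. With \<open>a\<close> odd, \<open>b\<close>
  even and \<open>N\<close> odd, \<open>x\<close> is odd, so \<open>x + y\<close> and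
  \<open>x - y\<close> are odd exactly for even \<open>y\<close>; both terms survive together and
  \<open>chi12_diff\<close> applies.\<close>

lemma liouville_odd_odd:
  assumes N: "odd N"
  shows "2 * (\<Sum>(a, b, x, y)\<in>{(a, b, x, y)\<in>bilin N. odd a \<and> even b \<and> even y}. wt a * (sg b * chi3 b))
    = E2 N - dsum wt N"
proof -
  let ?u = "\<lambda>m::int. if odd m then 1 else 0 :: int"
  have "(\<Sum>(a, b, x, y)\<in>{(a, b, x, y)\<in>bilin N. odd a \<and> even b}.
      chi12 (a - b) * ?u (x + y) - chi12 (a + b) * ?u (x - y)) =
    (\<Sum>(a, b, x, y)\<in>{(a, b, x, y)\<in>bilin N. odd a \<and> even b \<and> even y}. wt a * (sg b * chi3 b))"
    by (rule sum.mono_neutral_cong_right, rule finite_subset[OF _ finite_bilin[of N]])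
       (use N in \<open>auto simp: bilin_def chi12_diff[symmetric] split: if_splits\<close>)
  moreover have "2 * (\<Sum>(a, x)\<in>A. f a x) - 2 * (\<Sum>(a, x)\<in>A. g a x) = (\<Sum>(a, x)\<in>A. 2 * f a x - 2 * g a x)"
    for f g :: "int \<Rightarrow> int \<Rightarrow> int" and A
    by (simp add: sum_subtractf sum_distrib_left case_prod_unfold)
  then have "2 * (\<Sum>(a, x)\<in>dpairs N. chi12 a * (\<Sum>y\<in>{1..<x}. ?u y))
    - 2 * (\<Sum>(a, x)\<in>dpairs N. (\<Sum>k\<in>{1..<a}. chi12 k) * ?u x) =
    (\<Sum>(a, x)\<in>dpairs N. 2 * (chi12 a * (\<Sum>y\<in>{1..<x}. ?u y)) - 2 * ((\<Sum>k\<in>{1..<a}. chi12 k) * ?u x))" .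
  moreover have "\<dots> = (\<Sum>(a, x)\<in>dpairs N. chi12 a * x - wt a)"
  proof (rule sum.cong[OF refl], clarify)
    fix a x assume "(a, x) \<in> dpairs N"
    note o = dpairs_odd[OF N this]
    then have 1: "2 * (\<Sum>y\<in>{1..<x}. ?u y) = x - 1" "2 * (\<Sum>k\<in>{1..<a}. chi12 k) = wt a - chi12 a"
      using count_odd_below[of x] chi12_partial_sum[of a] by linarith+
    have "2 * (chi12 a * (\<Sum>y\<in>{1..<x}. ?u y)) - 2 * ((\<Sum>k\<in>{1..<a}. chi12 k) * ?u x) =
      chi12 a * (2 * (\<Sum>y\<in>{1..<x}. ?u y)) - 2 * (\<Sum>k\<in>{1..<a}. chi12 k) * ?u x"
      by simp
    also have "\<dots> = chi12 a * x - wt a"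
      unfolding 1 using o by (simp add: algebra_simps)
    finally show "2 * (chi12 a * (\<Sum>y\<in>{1..<x}. ?u y)) - 2 * ((\<Sum>k\<in>{1..<a}. chi12 k) * ?u x) =
      chi12 a * x - wt a" .
  qed
  moreover have "\<dots> = E2 N - dsum wt N"
    by (simp add: E2_def dsum_def sum_subtractf case_prod_unfold)
  ultimately show ?thesis using liouville_chi12[where u = ?u and N = N] by simp
qed

text \<open>Here \<open>u\<close> selects even arguments, hence odd \<open>y\<close>. Now
  \<open>u 0 = 1\<close> brings in \<open>E1\<close>, while the partial sums of \<open>chi12\<close>
  drop out because \<open>u\<close> vanishes at the odd cofactors.\<close>

lemma liouville_odd_even:
  assumes N: "odd N"
  shows "2 * (\<Sum>(a, b, x, y)\<in>{(a, b, x, y)\<in>bilin N. odd a \<and> even b \<and> odd y}. wt a * (sg b * chi3 b))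
    = E2 N - E1 N"
proof -
  let ?u = "\<lambda>m::int. if even m then 1 else 0 :: int"
  have "(\<Sum>(a, b, x, y)\<in>{(a, b, x, y)\<in>bilin N. odd a \<and> even b}.
      chi12 (a - b) * ?u (x + y) - chi12 (a + b) * ?u (x - y)) =
    (\<Sum>(a, b, x, y)\<in>{(a, b, x, y)\<in>bilin N. odd a \<and> even b \<and> odd y}. wt a * (sg b * chi3 b))"
    by (rule sum.mono_neutral_cong_right, rule finite_subset[OF _ finite_bilin[of N]])
       (use N in \<open>auto simp: bilin_def chi12_diff[symmetric] split: if_splits\<close>)
  moreover have "(\<Sum>(a, x)\<in>dpairs N. (\<Sum>k\<in>{1..<a}. chi12 k) * ?u x) = 0"
    by (rule sum.neutral) (use dpairs_odd[OF N] in auto)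
  moreover have "2 * (\<Sum>(a, x)\<in>dpairs N. chi12 a * (\<Sum>y\<in>{1..<x}. ?u y)) - (\<Sum>(a, x)\<in>dpairs N. (a - 1) * chi12 a)
    = (\<Sum>(a, x)\<in>dpairs N. chi12 a * (2 * (\<Sum>y\<in>{1..<x}. ?u y)) - (a - 1) * chi12 a)"
    by (simp add: sum_subtractf sum_distrib_left case_prod_unfold mult_ac)
  moreover have "\<dots> = (\<Sum>(a, x)\<in>dpairs N. chi12 a * x - chi12 a * a)"
  proof (rule sum.cong[OF refl], clarify)
    fix a x assume "(a, x) \<in> dpairs N"
    from dpairs_odd[OF N this] have 1: "2 * (\<Sum>y\<in>{1..<x}. ?u y) = x - 1"
      using count_even_below[of x] by simp
    show "chi12 a * (2 * (\<Sum>y\<in>{1..<x}. ?u y)) - (a - 1) * chi12 a = chi12 a * x - chi12 a * a"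
      unfolding 1 by (simp add: algebra_simps)
  qed
  moreover have "\<dots> = E2 N - E1 N"
    by (simp add: E2_def E1_def sum_subtractf case_prod_unfold)
  ultimately show ?thesis using liouville_chi12[where u = ?u and N = N] by simp
qed

text \<open>Here \<open>u\<close> selects odd multiples of 3 and \<open>chi3_cross\<close> factors
  the summand. On the other side, counting odd multiples of 3 below \<open>x\<close> produces
  \<open>x - chi3 x\<close>, and the correction \<open>chi12 a * chi3 x\<close> equals
  \<open>chi3 N * chi4 a\<close>.\<close>

lemma liouville_odd_three:
  assumes N: "odd N" and N3: "\<not> 3 dvd N"
  shows "- 6 * chi3 N * (\<Sum>(a, b, x, y)\<in>{(a, b, x, y)\<in>bilin N. odd a \<and> even b \<and> even y}.
      (chi4 a * (if 3 dvd x then 0 else 1)) * (sg b * chi3 y)) = E2 N - chi3 N * dsum chi4 N"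
proof -
  let ?u = "\<lambda>m::int. if odd m \<and> 3 dvd m then 1 else 0 :: int"
  have ev: "?u (- m) = ?u m" for m by simp
  have "(\<Sum>(a, b, x, y)\<in>{(a, b, x, y)\<in>bilin N. odd a \<and> even b}.
      chi12 (a - b) * ?u (x + y) - chi12 (a + b) * ?u (x - y)) =
    (\<Sum>(a, b, x, y)\<in>{(a, b, x, y)\<in>bilin N. odd a \<and> even b \<and> even y}.
      - chi3 N * ((chi4 a * (if 3 dvd x then 0 else 1)) * (sg b * chi3 y)))"
  proof (rule sum.mono_neutral_cong_right, rule finite_subset[OF _ finite_bilin[of N]])
    fix z assume "z \<in> {(a, b, x, y)\<in>bilin N. odd a \<and> even b \<and> even y}"
    then obtain a b x y where z: "z = (a, b, x, y)" "(a, b, x, y) \<in> bilin N" "odd a" "even b" "even y"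
      by auto
    then have n: "a * x + b * y = N" by (simp add: bilin_def)
    with N z have x: "odd x" by auto
    have "chi12 (a - b) * ?u (x + y) - chi12 (a + b) * ?u (x - y) =
      chi4 a * sg b * (chi3 (a - b) * (if 3 dvd x + y then 1 else 0) - chi3 (a + b) * (if 3 dvd x - y then 1 else 0))"
      using x z by (simp add: chi12_def chi4_shift algebra_simps)
    also have "\<dots> = chi4 a * sg b * (- chi3 N * (chi3 y * (if 3 dvd x then 0 else 1)))"
      using chi3_cross[of a x b y] n N3 by simp
    finally show "(case z of (a, b, x, y) \<Rightarrow> chi12 (a - b) * ?u (x + y) - chi12 (a + b) * ?u (x - y)) =
      (case z of (a, b, x, y) \<Rightarrow> - chi3 N * ((chi4 a * (if 3 dvd x then 0 else 1)) * (sg b * chi3 y)))"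
      using z by simp
  qed (use N in \<open>auto simp: bilin_def split: if_splits\<close>)
  also have "\<dots> = - chi3 N * (\<Sum>(a, b, x, y)\<in>{(a, b, x, y)\<in>bilin N. odd a \<and> even b \<and> even y}.
      (chi4 a * (if 3 dvd x then 0 else 1)) * (sg b * chi3 y))"
    by (simp add: sum_distrib_left sum_negf case_prod_unfold)
  finally have lhs: "(\<Sum>(a, b, x, y)\<in>{(a, b, x, y)\<in>bilin N. odd a \<and> even b}.
      chi12 (a - b) * ?u (x + y) - chi12 (a + b) * ?u (x - y)) = \<dots>" .
  have nd: "\<not> 3 dvd x \<and> \<not> 3 dvd a" if "(a, x) \<in> dpairs N" for a x
    using that N3 by (auto simp: dpairs_def)
  have 1: "(\<Sum>(a, x)\<in>dpairs N. (\<Sum>k\<in>{1..<a}. chi12 k) * ?u x) = 0"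
    by (rule sum.neutral) (use nd in auto)
  have "6 * (\<Sum>(a, x)\<in>dpairs N. chi12 a * (\<Sum>y\<in>{1..<x}. ?u y)) = (\<Sum>(a, x)\<in>dpairs N. chi12 a * (6 * (\<Sum>y\<in>{1..<x}. ?u y)))"
    by (simp add: sum_distrib_left case_prod_unfold mult_ac)
  also have "\<dots> = (\<Sum>(a, x)\<in>dpairs N. chi12 a * x - chi3 N * chi4 a)"
  proof (rule sum.cong[OF refl], clarify)
    fix a x assume ax: "(a, x) \<in> dpairs N"
    then have "chi3 N = chi3 a * chi3 x" by (auto simp: dpairs_def chi3_mult)
    then have 3: "chi3 N * chi4 a = chi12 a * chi3 x" by (simp add: chi12_def)
    from dpairs_odd[OF N ax] nd[OF ax] have 1: "6 * (\<Sum>y\<in>{1..<x}. ?u y) = x - chi3 x"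
      using count_odd3_below[of x] by simp
    show "chi12 a * (6 * (\<Sum>y\<in>{1..<x}. ?u y)) = chi12 a * x - chi3 N * chi4 a"
      unfolding 1 3 by (simp add: algebra_simps)
  qed
  also have "\<dots> = E2 N - chi3 N * dsum chi4 N"
    by (simp add: E2_def dsum_def sum_subtractf sum_distrib_left case_prod_unfold)
  finally have 2: "6 * (\<Sum>(a, x)\<in>dpairs N. chi12 a * (\<Sum>y\<in>{1..<x}. ?u y)) = E2 N - chi3 N * dsum chi4 N" .
  have "?u 0 = 0" by simp
  with liouville_chi12[where u = ?u and N = N, OF ev] lhs 1 2 show ?thesis by simp
qed

section \<open>From bilinear sums to convolutions of divisor sums\<close>

text \<open>The shape of \<open>bilin\<close> after halving even variables: \<open>c = 4\<close>
  when both \<open>b\<close> and \<open>y\<close> are halved, \<open>c = 2\<close> when only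
  \<open>b\<close> is.\<close>

definition bilin_scaled :: "int \<Rightarrow> int \<Rightarrow> (int \<times> int \<times> int \<times> int) set" where
  "bilin_scaled c N = {(a, b, x, y). 0 < a \<and> 0 < b \<and> 0 < x \<and> 0 < y \<and> a * x + c * (b * y) = N}"

lemma sum_bilin_scaled_conv:
  fixes f g :: "int \<Rightarrow> int \<Rightarrow> int"
  assumes "0 < c"
  shows "(\<Sum>(a, b, x, y)\<in>bilin_scaled c N. f a x * g b y) =
    (\<Sum>l\<in>{1..N}. (\<Sum>(a, x)\<in>dpairs (N - c * l). f a x) * (\<Sum>(b, y)\<in>dpairs l. g b y))"
proof -
  have "(\<Sum>l\<in>{1..N}. (\<Sum>(a, x)\<in>dpairs (N - c * l). f a x) * (\<Sum>(b, y)\<in>dpairs l. g b y)) =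
    (\<Sum>l\<in>{1..N}. \<Sum>z\<in>dpairs (N - c * l) \<times> dpairs l. f (fst (fst z)) (snd (fst z)) * g (fst (snd z)) (snd (snd z)))"
    by (simp add: sum_product sum.cartesian_product case_prod_unfold)
  also have "\<dots> = (\<Sum>(l, z)\<in>Sigma {1..N} (\<lambda>l. dpairs (N - c * l) \<times> dpairs l).
      f (fst (fst z)) (snd (fst z)) * g (fst (snd z)) (snd (snd z)))"
    by (rule sum.Sigma) auto
  also have "\<dots> = (\<Sum>(a, b, x, y)\<in>bilin_scaled c N. f a x * g b y)"
  proof (rule sum.reindex_bij_witness[where i = "\<lambda>(a, b, x, y). (b * y, (a, x), (b, y))"
          and j = "\<lambda>(l, z). (fst (fst z), fst (snd z), snd (fst z), snd (snd z))"])
    fix z assume "z \<in> bilin_scaled c N"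
    then obtain a b x y where z: "z = (a, b, x, y)" "0 < a" "0 < b" "0 < x" "0 < y"
      "a * x + c * (b * y) = N" by (auto simp: bilin_scaled_def)
    have "0 < a * x" "0 < b * y" using z by simp_all
    moreover have "b * y \<le> c * (b * y)" using mult_right_mono[of 1 c "b * y"] \<open>0 < b * y\<close> assms by linarith
    ultimately have "1 \<le> b * y" "b * y \<le> N" using z by linarith+
    then have "b * y \<in> {1..N}" by simp
    with z show "(case z of (a, b, x, y) \<Rightarrow> (b * y, (a, x), (b, y))) \<in> Sigma {1..N} (\<lambda>l. dpairs (N - c * l) \<times> dpairs l)"
      by (auto simp: dpairs_def)
  qed (auto simp: dpairs_def bilin_scaled_def)
  finally show ?thesis by simp
qed

definition chi4_sum :: "int \<Rightarrow> int" where "chi4_sum = dsum chi4"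
definition chi3_sum :: "int \<Rightarrow> int" where "chi3_sum = dsum chi3"

lemma chi4_sum_nonpos: "k \<le> 0 \<Longrightarrow> chi4_sum k = 0"
  by (simp add: chi4_sum_def dsum_def dpairs_nonpos)

lemma chi4_dpairs:
  assumes "(a, x) \<in> dpairs k" "odd k"
  shows "k mod 4 = 1 \<Longrightarrow> chi4 a = chi4 x" "k mod 4 = 3 \<Longrightarrow> chi4 a = - chi4 x"
proof -
  have k: "chi4 k = chi4 a * chi4 x" using assms by (auto simp: dpairs_def chi4_mult)
  have x: "chi4 x * chi4 x = 1" using dpairs_odd[OF assms(2,1)] by (simp add: chi4_square)
  have "chi4 a = chi4 a * (chi4 x * chi4 x)" by (simp only: x mult_1_right)
  then have "chi4 a = chi4 k * chi4 x" by (simp add: k)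
  then show "k mod 4 = 1 \<Longrightarrow> chi4 a = chi4 x" "k mod 4 = 3 \<Longrightarrow> chi4 a = - chi4 x"
    by (simp_all add: chi4_def[of k])
qed

text \<open>A divisor and its cofactor have opposite values of \<open>chi4\<close>, so they
  cancel.\<close>

lemma chi4_sum_3mod4: assumes "k mod 4 = 3" shows "chi4_sum k = 0"
proof -
  have o: "odd k" using assms by presburger
  have "chi4_sum k = (\<Sum>(a, x)\<in>dpairs k. - chi4 x)"
    unfolding chi4_sum_def dsum_def by (rule sum.cong) (use chi4_dpairs(2)[OF _ o] assms in auto)
  also have "\<dots> = - chi4_sum k" unfolding chi4_sum_def dsum_swap by (simp add: sum_negf case_prod_unfold)
  finally show ?thesis by simp
qed

lemma sub_G3_1mod4: assumes "k mod 4 = 1" shows "sub_div chi4_sum 3 k = 0"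
proof (cases "3 dvd k")
  case True
  then obtain m where "k = 3 * m" by auto
  moreover from this assms have "m mod 4 = 3" by presburger
  ultimately show ?thesis by (simp add: sub_div_def chi4_sum_3mod4)
qed (simp add: sub_div_def)

lemma dsum_chi4_3: "(\<Sum>(a, x)\<in>{(a, x)\<in>dpairs k. 3 dvd a}. chi4 a) = - sub_div chi4_sum 3 k"
  using sum_dpairs_dvd[of 3 "\<lambda>a x. chi4 a" k]
  by (simp add: sub_div_def chi4_sum_def dsum_def chi4_mult sum_negf case_prod_unfold)

text \<open>At multiples of 3 the weight differs from \<open>chi4\<close> by -3 times
  \<open>chi4\<close>, and \<open>chi4 3 = - 1\<close> turns this into a positive contribution from
  k / 3. For k = 1 mod 4 only the first term survives, for k = 3 mod 4 only the second; this is why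
  \<open>convX3\<close> replaces \<open>convX\<close> in the latter class.\<close>

lemma dsum_wt: "dsum wt k = chi4_sum k + 3 * sub_div chi4_sum 3 k"
proof -
  let ?f = "\<lambda>a x. chi4 a"
  have 1: "chi4_sum k = - sub_div chi4_sum 3 k + (\<Sum>(a, x)\<in>{(a, x)\<in>dpairs k. \<not> 3 dvd a}. chi4 a)"
    using sum_dpairs_split[of ?f k "\<lambda>a x. 3 dvd a"] dsum_chi4_3[of k] by (simp add: chi4_sum_def dsum_def)
  have "dsum wt k = (\<Sum>(a, x)\<in>{(a, x)\<in>dpairs k. 3 dvd a}. wt a) + (\<Sum>(a, x)\<in>{(a, x)\<in>dpairs k. \<not> 3 dvd a}. wt a)"
    unfolding dsum_def by (rule sum_dpairs_split)
  also have "(\<Sum>(a, x)\<in>{(a, x)\<in>dpairs k. 3 dvd a}. wt a) = (\<Sum>(a, x)\<in>{(a, x)\<in>dpairs k. 3 dvd a}. - 2 * chi4 a)"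
    by (rule sum.cong) (auto simp: wt_def)
  also have "\<dots> = - 2 * - sub_div chi4_sum 3 k"
    unfolding dsum_chi4_3[symmetric] by (simp add: sum_distrib_left case_prod_unfold)
  also have "(\<Sum>(a, x)\<in>{(a, x)\<in>dpairs k. \<not> 3 dvd a}. wt a) = (\<Sum>(a, x)\<in>{(a, x)\<in>dpairs k. \<not> 3 dvd a}. chi4 a)"
    by (rule sum.cong) (auto simp: wt_def)
  finally show ?thesis using 1 by simp
qed

lemma dsum_wt_1: "k mod 4 = 1 \<Longrightarrow> dsum wt k = chi4_sum k"
  by (simp add: dsum_wt sub_G3_1mod4)

lemma dsum_wt_3: "k mod 4 = 3 \<Longrightarrow> dsum wt k = 3 * sub_div chi4_sum 3 k"
  by (simp add: dsum_wt chi4_sum_3mod4)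

lemma sum_chi4_not3:
  "(\<Sum>(a, x)\<in>dpairs k. chi4 a * (if 3 dvd a then 0 else 1)) = chi4_sum k + sub_div chi4_sum 3 k"
proof -
  have "(\<Sum>(a, x)\<in>dpairs k. chi4 a * (if 3 dvd a then 0 else 1)) =
    (\<Sum>(a, x)\<in>{(a, x)\<in>dpairs k. \<not> 3 dvd a}. chi4 a)"
    by (rule sum.mono_neutral_cong_right) auto
  moreover have "chi4_sum k = - sub_div chi4_sum 3 k + (\<Sum>(a, x)\<in>{(a, x)\<in>dpairs k. \<not> 3 dvd a}. chi4 a)"
    using sum_dpairs_split[of "\<lambda>a x. chi4 a" k "\<lambda>a x. 3 dvd a"] dsum_chi4_3[of k] by (simp add: chi4_sum_def dsum_def)
  ultimately show ?thesis by simp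
qed

text \<open>The condition sits on the cofactor here. Passing to the cofactor keeps or reverses
  \<open>chi4\<close> according to \<open>k\<close> modulo 4, and in each class one of the two terms
  of \<open>sum_chi4_not3\<close> vanishes.\<close>

lemma sum_chi4_not3':
  "k mod 4 = 1 \<Longrightarrow> (\<Sum>(a, x)\<in>dpairs k. chi4 a * (if 3 dvd x then 0 else 1)) = chi4_sum k"
  "k mod 4 = 3 \<Longrightarrow> (\<Sum>(a, x)\<in>dpairs k. chi4 a * (if 3 dvd x then 0 else 1)) = - sub_div chi4_sum 3 k"
proof -
  have sw: "(\<Sum>(a, x)\<in>dpairs k. chi4 x * (if 3 dvd x then 0 else 1)) = chi4_sum k + sub_div chi4_sum 3 k"
    using sum_chi4_not3[of k] by (simp add: sum_dpairs_swap[of "\<lambda>a x. chi4 x * (if 3 dvd x then 0 else 1)"])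
  {
    assume k: "k mod 4 = 1"
    then have o: "odd k" by presburger
    have "(\<Sum>(a, x)\<in>dpairs k. chi4 a * (if 3 dvd x then 0 else 1)) = (\<Sum>(a, x)\<in>dpairs k. chi4 x * (if 3 dvd x then 0 else 1))"
      by (rule sum.cong) (use chi4_dpairs(1)[OF _ o k] in auto)
    with sw k show "(\<Sum>(a, x)\<in>dpairs k. chi4 a * (if 3 dvd x then 0 else 1)) = chi4_sum k" by (simp add: sub_G3_1mod4)
  next
    assume k: "k mod 4 = 3"
    then have o: "odd k" by presburger
    have "(\<Sum>(a, x)\<in>dpairs k. chi4 a * (if 3 dvd x then 0 else 1)) = (\<Sum>(a, x)\<in>dpairs k. - (chi4 x * (if 3 dvd x then 0 else 1)))"
      by (rule sum.cong) (use chi4_dpairs(2)[OF _ o k] in auto)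
    with sw k show "(\<Sum>(a, x)\<in>dpairs k. chi4 a * (if 3 dvd x then 0 else 1)) = - sub_div chi4_sum 3 k"
      by (simp add: chi4_sum_3mod4 sum_negf case_prod_unfold)
  }
qed

lemma sg_double: "sg (2 * b) = (if even b then 1 else - 1)"
  unfolding sg_def by (simp add: mult_dvd_mono) presburger

text \<open>Since \<open>sg (2 * b)\<close> is the parity sign of \<open>b\<close>, the sum is the
  odd part minus the even part, and the even part is - \<open>chi3_sum\<close> at l / 2 because
  \<open>chi3 2 = - 1\<close>. With \<open>chi3\<close> at the cofactor, as in
  \<open>sum_ew'\<close>, the even part has the opposite sign. This makes the resulting linear
  equations independent.\<close>

lemma sum_ew: "(\<Sum>(b, y)\<in>dpairs l. sg (2 * b) * chi3 (2 * b)) = chi3_sum l + 2 * sub_div chi3_sum 2 l"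
proof -
  have "(\<Sum>(b, y)\<in>dpairs l. sg (2 * b) * chi3 (2 * b)) =
    (\<Sum>(b, y)\<in>{(b, y)\<in>dpairs l. even b}. - chi3 b) + (\<Sum>(b, y)\<in>{(b, y)\<in>dpairs l. odd b}. chi3 b)"
  proof -
    have "(\<Sum>(b, y)\<in>dpairs l. sg (2 * b) * chi3 (2 * b)) =
      (\<Sum>(b, y)\<in>{(b, y)\<in>dpairs l. even b}. sg (2 * b) * chi3 (2 * b)) + (\<Sum>(b, y)\<in>{(b, y)\<in>dpairs l. odd b}. sg (2 * b) * chi3 (2 * b))"
      by (rule sum_dpairs_split)
    moreover have "(\<Sum>(b, y)\<in>{(b, y)\<in>dpairs l. even b}. sg (2 * b) * chi3 (2 * b)) = (\<Sum>(b, y)\<in>{(b, y)\<in>dpairs l. even b}. - chi3 b)"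
      by (rule sum.cong) (auto simp: sg_double chi3_mult)
    moreover have "(\<Sum>(b, y)\<in>{(b, y)\<in>dpairs l. odd b}. sg (2 * b) * chi3 (2 * b)) = (\<Sum>(b, y)\<in>{(b, y)\<in>dpairs l. odd b}. chi3 b)"
      by (rule sum.cong) (auto simp: sg_double chi3_mult)
    ultimately show ?thesis by simp
  qed
  moreover have "chi3_sum l = (\<Sum>(b, y)\<in>{(b, y)\<in>dpairs l. even b}. chi3 b) + (\<Sum>(b, y)\<in>{(b, y)\<in>dpairs l. odd b}. chi3 b)"
    unfolding chi3_sum_def dsum_def by (rule sum_dpairs_split)
  moreover have "(\<Sum>(b, y)\<in>{(b, y)\<in>dpairs l. even b}. chi3 b) = - sub_div chi3_sum 2 l"
    using sum_dpairs_dvd[of 2 "\<lambda>b y. chi3 b" l]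
    by (simp add: sub_div_def chi3_sum_def dsum_def chi3_mult sum_negf case_prod_unfold)
  ultimately show ?thesis by (simp add: sum_negf case_prod_unfold)
qed

lemma sum_ew': "(\<Sum>(b, y)\<in>dpairs l. sg (2 * b) * chi3 (2 * y)) = chi3_sum l - 2 * sub_div chi3_sum 2 l"
proof -
  have "(\<Sum>(b, y)\<in>dpairs l. sg (2 * b) * chi3 (2 * y)) =
    (\<Sum>(b, y)\<in>{(b, y)\<in>dpairs l. even b}. - chi3 y) + (\<Sum>(b, y)\<in>{(b, y)\<in>dpairs l. odd b}. chi3 y)"
  proof -
    have "(\<Sum>(b, y)\<in>dpairs l. sg (2 * b) * chi3 (2 * y)) =
      (\<Sum>(b, y)\<in>{(b, y)\<in>dpairs l. even b}. sg (2 * b) * chi3 (2 * y)) + (\<Sum>(b, y)\<in>{(b, y)\<in>dpairs l. odd b}. sg (2 * b) * chi3 (2 * y))"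
      by (rule sum_dpairs_split)
    moreover have "(\<Sum>(b, y)\<in>{(b, y)\<in>dpairs l. even b}. sg (2 * b) * chi3 (2 * y)) = (\<Sum>(b, y)\<in>{(b, y)\<in>dpairs l. even b}. - chi3 y)"
      by (rule sum.cong) (auto simp: sg_double chi3_mult)
    moreover have "(\<Sum>(b, y)\<in>{(b, y)\<in>dpairs l. odd b}. sg (2 * b) * chi3 (2 * y)) = (\<Sum>(b, y)\<in>{(b, y)\<in>dpairs l. odd b}. chi3 y)"
      by (rule sum.cong) (auto simp: sg_double chi3_mult)
    ultimately show ?thesis by simp
  qed
  moreover have "chi3_sum l = (\<Sum>(b, y)\<in>{(b, y)\<in>dpairs l. even b}. chi3 y) + (\<Sum>(b, y)\<in>{(b, y)\<in>dpairs l. odd b}. chi3 y)"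
    unfolding chi3_sum_def dsum_swap by (rule sum_dpairs_split)
  moreover have "(\<Sum>(b, y)\<in>{(b, y)\<in>dpairs l. even b}. chi3 y) = sub_div chi3_sum 2 l"
    using sum_dpairs_dvd[of 2 "\<lambda>b y. chi3 y" l]
    by (simp add: sub_div_def chi3_sum_def dsum_swap)
  ultimately show ?thesis by (simp add: sum_negf case_prod_unfold)
qed

text \<open>An odd \<open>y\<close> leaves the whole 2-part of the argument in \<open>b\<close>. For
  \<open>2 * m\<close> the substitution of \<open>2 * b\<close> for \<open>b\<close> makes all signs
  positive and leaves the pairs for \<open>m\<close> with odd cofactor.\<close>

lemma sum_ew_odd:
  "odd l \<Longrightarrow> (\<Sum>(b, y)\<in>dpairs l. (sg (2 * b) * chi3 (2 * b)) * (if odd y then 1 else 0)) = chi3_sum l"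
  "(\<Sum>(b, y)\<in>dpairs (2 * m). (sg (2 * b) * chi3 (2 * b)) * (if odd y then 1 else 0)) = chi3_sum m - sub_div chi3_sum 2 m"
proof -
  show "(\<Sum>(b, y)\<in>dpairs l. (sg (2 * b) * chi3 (2 * b)) * (if odd y then 1 else 0)) = chi3_sum l" if "odd l"
    unfolding chi3_sum_def dsum_def
    by (rule sum.cong) (use dpairs_odd[OF that] in \<open>auto simp: sg_double chi3_mult\<close>)
  have ev: "even b" if "(b, y) \<in> dpairs (2 * m)" "odd y" for b y
  proof -
    have "even (b * y)" using that by (simp add: dpairs_def)
    with that show ?thesis by simp
  qed
  have "(\<Sum>(b, y)\<in>dpairs (2 * m). (sg (2 * b) * chi3 (2 * b)) * (if odd y then 1 else 0)) =
    (\<Sum>(b, y)\<in>{(b, y)\<in>dpairs (2 * m). even b}. (sg (2 * b) * chi3 (2 * b)) * (if odd y then 1 else 0))"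
    by (rule sum.mono_neutral_right) (auto split: if_splits intro: ev)
  also have "\<dots> = (\<Sum>(b, y)\<in>dpairs m. (sg (2 * (2 * b)) * chi3 (2 * (2 * b))) * (if odd y then 1 else 0))"
    using sum_dpairs_dvd[of 2 "\<lambda>b y. (sg (2 * b) * chi3 (2 * b)) * (if odd y then 1 else 0)" "2 * m"] by simp
  also have "\<dots> = (\<Sum>(b, y)\<in>dpairs m. chi3 b * (if odd y then 1 else 0))"
  proof -
    have "sg (2 * (2 * b)) * chi3 (2 * (2 * b)) = chi3 b" for b
      unfolding sg_double chi3_mult by simp
    then show ?thesis by (simp only:)
  qed
  also have "\<dots> = (\<Sum>(b, y)\<in>dpairs m. chi3 y * (if odd b then 1 else 0))"
    by (rule sum_dpairs_swap)
  also have "\<dots> = (\<Sum>(b, y)\<in>{(b, y)\<in>dpairs m. odd b}. chi3 y)"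
    by (rule sum.mono_neutral_cong_right) auto
  also have "\<dots> = chi3_sum m - sub_div chi3_sum 2 m"
  proof -
    have "chi3_sum m = (\<Sum>(b, y)\<in>{(b, y)\<in>dpairs m. even b}. chi3 y) + (\<Sum>(b, y)\<in>{(b, y)\<in>dpairs m. odd b}. chi3 y)"
      unfolding chi3_sum_def dsum_swap by (rule sum_dpairs_split)
    moreover have "(\<Sum>(b, y)\<in>{(b, y)\<in>dpairs m. even b}. chi3 y) = sub_div chi3_sum 2 m"
      using sum_dpairs_dvd[of 2 "\<lambda>b y. chi3 y" m] by (simp add: sub_div_def chi3_sum_def dsum_swap)
    ultimately show ?thesis by simp
  qed
  finally show "(\<Sum>(b, y)\<in>dpairs (2 * m). (sg (2 * b) * chi3 (2 * b)) * (if odd y then 1 else 0)) = chi3_sum m - sub_div chi3_sum 2 m" .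
qed

lemma conv_odd_odd:
  assumes N: "odd N"
  shows "2 * (\<Sum>l\<in>{1..N}. dsum wt (N - 4 * l) * (chi3_sum l + 2 * sub_div chi3_sum 2 l)) = E2 N - dsum wt N"
proof -
  have "(\<Sum>(a, b, x, y)\<in>{(a, b, x, y)\<in>bilin N. odd a \<and> even b \<and> even y}. wt a * (sg b * chi3 b)) =
    (\<Sum>(a, b, x, y)\<in>bilin_scaled 4 N. wt a * (sg (2 * b) * chi3 (2 * b)))"
    by (rule sum.reindex_bij_witness[where j = "\<lambda>(a, b, x, y). (a, b div 2, x, y div 2)"
          and i = "\<lambda>(a, b, x, y). (a, 2 * b, x, 2 * y)"])
       (use N in \<open>auto simp: bilin_def bilin_scaled_def elim!: evenE\<close>)
  also have "\<dots> = (\<Sum>l\<in>{1..N}. dsum wt (N - 4 * l) * (chi3_sum l + 2 * sub_div chi3_sum 2 l))"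
    using sum_bilin_scaled_conv[of 4 "\<lambda>a x. wt a" "\<lambda>b y. sg (2 * b) * chi3 (2 * b)" N] by (simp add: sum_ew dsum_def)
  finally show ?thesis using liouville_odd_odd[OF N] by simp
qed

lemma conv_odd_three:
  assumes N: "odd N" and N3: "\<not> 3 dvd N"
  shows "- 6 * chi3 N * (\<Sum>l\<in>{1..N}. (\<Sum>(a, x)\<in>dpairs (N - 4 * l). chi4 a * (if 3 dvd x then 0 else 1)) *
    (chi3_sum l - 2 * sub_div chi3_sum 2 l)) = E2 N - chi3 N * chi4_sum N"
proof -
  have "(\<Sum>(a, b, x, y)\<in>{(a, b, x, y)\<in>bilin N. odd a \<and> even b \<and> even y}.
      (chi4 a * (if 3 dvd x then 0 else 1)) * (sg b * chi3 y)) =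
    (\<Sum>(a, b, x, y)\<in>bilin_scaled 4 N. (chi4 a * (if 3 dvd x then 0 else 1)) * (sg (2 * b) * chi3 (2 * y)))"
    by (rule sum.reindex_bij_witness[where j = "\<lambda>(a, b, x, y). (a, b div 2, x, y div 2)"
          and i = "\<lambda>(a, b, x, y). (a, 2 * b, x, 2 * y)"])
       (use N in \<open>auto simp: bilin_def bilin_scaled_def elim!: evenE\<close>)
  also have "\<dots> = (\<Sum>l\<in>{1..N}. (\<Sum>(a, x)\<in>dpairs (N - 4 * l). chi4 a * (if 3 dvd x then 0 else 1)) *
      (chi3_sum l - 2 * sub_div chi3_sum 2 l))"
    unfolding sum_ew'[symmetric] by (rule sum_bilin_scaled_conv) simp
  finally show ?thesis using liouville_odd_three[OF N N3] by (simp add: chi4_sum_def)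
qed

lemma conv_odd_even:
  assumes N: "odd N"
  shows "2 * (\<Sum>l\<in>{1..N}. dsum wt (N - 2 * l) *
    (\<Sum>(b, y)\<in>dpairs l. (sg (2 * b) * chi3 (2 * b)) * (if odd y then 1 else 0))) = E2 N - E1 N"
proof -
  have "(\<Sum>(a, b, x, y)\<in>{(a, b, x, y)\<in>bilin N. odd a \<and> even b \<and> odd y}. wt a * (sg b * chi3 b)) =
    (\<Sum>(a, b, x, y)\<in>{(a, b, x, y)\<in>bilin_scaled 2 N. odd y}. wt a * (sg (2 * b) * chi3 (2 * b)))"
    by (rule sum.reindex_bij_witness[where j = "\<lambda>(a, b, x, y). (a, b div 2, x, y)"
          and i = "\<lambda>(a, b, x, y). (a, 2 * b, x, y)"])
       (use N in \<open>auto simp: bilin_def bilin_scaled_def elim!: evenE\<close>)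
  also have "\<dots> = (\<Sum>(a, b, x, y)\<in>bilin_scaled 2 N. wt a * ((sg (2 * b) * chi3 (2 * b)) * (if odd y then 1 else 0)))"
  proof (rule sum.mono_neutral_cong_left)
    show "finite (bilin_scaled 2 N)"
    proof (rule finite_subset)
      show "bilin_scaled 2 N \<subseteq> (\<lambda>(a, b, x, y). (a, b div 2, x, y)) ` bilin N"
      proof
        fix z assume "z \<in> bilin_scaled 2 N"
        then obtain a b x y where z: "z = (a, b, x, y)" "(a, 2 * b, x, y) \<in> bilin N"
          by (auto simp: bilin_scaled_def bilin_def)
        then show "z \<in> (\<lambda>(a, b, x, y). (a, b div 2, x, y)) ` bilin N" by force
      qed
    qed simp
  qed auto
  also have "\<dots> = (\<Sum>l\<in>{1..N}. dsum wt (N - 2 * l) *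
    (\<Sum>(b, y)\<in>dpairs l. (sg (2 * b) * chi3 (2 * b)) * (if odd y then 1 else 0)))"
    unfolding dsum_def by (rule sum_bilin_scaled_conv) simp
  finally show ?thesis using liouville_odd_even[OF N] by simp
qed

section \<open>Linear equations for the convolutions\<close>

text \<open>The terms with l > 0 of a convolution of theta coefficients: by
  \<open>card_quat_4\<close>, x^2 + y^2 + 4 (p^2 + p q + q^2) = N has
  \<open>4 * (chi4_sum N + 6 * convX N)\<close> solutions for odd positive N. In the same way
  \<open>convX3\<close> belongs to the form with 3 (x^2 + y^2).\<close>

definition convX :: "int \<Rightarrow> int" where
  "convX N = (\<Sum>l\<in>{1..N}. chi4_sum (N - 4 * l) * chi3_sum l)"

definition convX3 :: "int \<Rightarrow> int" where
  "convX3 N = (\<Sum>l\<in>{1..N}. sub_div chi4_sum 3 (N - 4 * l) * chi3_sum l)"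

text \<open>The extra unknown that the choice of even arguments introduces. At multiples of 3 it
  counts solutions of another form, see \<open>card_quat_2_odd\<close>.\<close>

definition convZ :: "int \<Rightarrow> int" where
  "convZ N = (\<Sum>l\<in>{l\<in>{1..N}. odd l}. sub_div chi4_sum 3 (N - 2 * l) * chi3_sum l)"

lemma sum_lin2:
  fixes f g h :: "int \<Rightarrow> int"
  shows "(\<Sum>l\<in>A. f l * (g l + c * h l)) = (\<Sum>l\<in>A. f l * g l) + c * (\<Sum>l\<in>A. f l * h l)"
    "(\<Sum>l\<in>A. f l * (g l - c * h l)) = (\<Sum>l\<in>A. f l * g l) - c * (\<Sum>l\<in>A. f l * h l)"
  by (simp_all add: sum.distrib sum_subtractf sum_distrib_left algebra_simps)

lemma conv_1mod4:
  assumes "N mod 4 = 1"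
  shows "2 * (convX N + 2 * (\<Sum>l\<in>{1..N}. chi4_sum (N - 4 * l) * sub_div chi3_sum 2 l)) = E2 N - chi4_sum N"
proof -
  have o: "odd N" using assms by presburger
  have m: "(N - 4 * l) mod 4 = 1" for l using assms by presburger
  show ?thesis
    using conv_odd_odd[OF o] unfolding dsum_wt_1[OF m] dsum_wt_1[OF assms] sum_lin2 convX_def .
qed

text \<open>The sum with \<open>chi3_sum\<close> at l / 2 enters \<open>conv_1mod4\<close> and
  \<open>conv_odd_three\<close> with opposite signs and is eliminated, once the second equation has
  been multiplied by \<open>chi3 N\<close>, whose square is 1.\<close>

lemma convX_coprime:
  assumes N: "N mod 4 = 1" and N3: "\<not> 3 dvd N"
  shows "2 * (chi4_sum N + 6 * convX N) = (3 - chi3 N) * E2 N"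
proof -
  let ?Y = "\<Sum>l\<in>{1..N}. chi4_sum (N - 4 * l) * sub_div chi3_sum 2 l"
  have o: "odd N" using N by presburger
  have m: "(N - 4 * l) mod 4 = 1" for l using N by presburger
  have "- 6 * chi3 N * (convX N - 2 * ?Y) = E2 N - chi3 N * chi4_sum N"
    using conv_odd_three[OF o N3] unfolding sum_chi4_not3'(1)[OF m] sum_lin2 convX_def .
  then have "chi3 N * (- 6 * chi3 N * (convX N - 2 * ?Y)) = chi3 N * (E2 N - chi3 N * chi4_sum N)" by simp
  then have "(chi3 N * chi3 N) * (- 6 * (convX N - 2 * ?Y)) = chi3 N * E2 N - (chi3 N * chi3 N) * chi4_sum N"
    by (simp add: algebra_simps)
  then have "- 6 * (convX N - 2 * ?Y) = chi3 N * E2 N - chi4_sum N" by (simp add: chi3_square[OF N3])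
  with conv_1mod4[OF N] show ?thesis by (simp add: algebra_simps)
qed

text \<open>The elimination of \<open>convX_coprime\<close> in the class 3 mod 4. There
  \<open>chi4_sum\<close> vanishes at every N - 4 l, so the same two equations speak about its
  values at (N - 4 l) / 3.\<close>

lemma convX3_coprime:
  assumes N: "N mod 4 = 3" and N3: "\<not> 3 dvd N"
  shows "12 * convX3 N = (1 + chi3 N) * E2 N"
proof -
  let ?Y = "\<Sum>l\<in>{1..N}. sub_div chi4_sum 3 (N - 4 * l) * sub_div chi3_sum 2 l"
  have o: "odd N" using N by presburger
  have m: "(N - 4 * l) mod 4 = 3" for l using N by presburger
  have "2 * (\<Sum>l\<in>{1..N}. 3 * sub_div chi4_sum 3 (N - 4 * l) * (chi3_sum l + 2 * sub_div chi3_sum 2 l)) = E2 N - 3 * sub_div chi4_sum 3 N"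
    using conv_odd_odd[OF o] unfolding dsum_wt_3[OF m] dsum_wt_3[OF N] .
  moreover have "(\<Sum>l\<in>{1..N}. 3 * sub_div chi4_sum 3 (N - 4 * l) * (chi3_sum l + 2 * sub_div chi3_sum 2 l)) = 3 * (convX3 N + 2 * ?Y)"
    unfolding convX3_def sum_lin2[symmetric] by (simp add: sum_distrib_left mult.assoc)
  ultimately have 1: "6 * (convX3 N + 2 * ?Y) = E2 N" using N3 by (simp add: sub_div_def)
  have a: "- 6 * chi3 N * (\<Sum>l\<in>{1..N}. - sub_div chi4_sum 3 (N - 4 * l) * (chi3_sum l - 2 * sub_div chi3_sum 2 l)) = E2 N - chi3 N * chi4_sum N"
    using conv_odd_three[OF o N3] unfolding sum_chi4_not3'(2)[OF m] .
  have b: "(\<Sum>l\<in>{1..N}. - sub_div chi4_sum 3 (N - 4 * l) * (chi3_sum l - 2 * sub_div chi3_sum 2 l)) = - (convX3 N - 2 * ?Y)"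
    unfolding convX3_def sum_lin2[symmetric] by (simp add: sum_negf)
  have "6 * chi3 N * (convX3 N - 2 * ?Y) = E2 N"
    using a unfolding b by (simp add: chi4_sum_3mod4[OF N] algebra_simps)
  then have "chi3 N * (6 * chi3 N * (convX3 N - 2 * ?Y)) = chi3 N * E2 N" by simp
  then have "(chi3 N * chi3 N) * (6 * (convX3 N - 2 * ?Y)) = chi3 N * E2 N" by (simp add: algebra_simps)
  then have "6 * (convX3 N - 2 * ?Y) = chi3 N * E2 N" by (simp add: chi3_square[OF N3])
  with 1 show ?thesis by (simp add: algebra_simps)
qed

text \<open>Odd l put N - 2 l into the class 3 mod 4 and give \<open>convZ\<close>; even l keep it
  in the class 1 mod 4 and give back the sums of \<open>conv_1mod4\<close>. The elimination also
  works when 3 divides \<open>N\<close>.\<close>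

lemma convX_convZ:
  assumes N: "N mod 4 = 1"
  shows "chi4_sum N + 6 * convX N = 3 * E2 N - 2 * E1 N - 12 * convZ N"
proof -
  let ?Y = "\<Sum>l\<in>{1..N}. chi4_sum (N - 4 * l) * sub_div chi3_sum 2 l"
  let ?h = "\<lambda>l. \<Sum>(b, y)\<in>dpairs l. (sg (2 * b) * chi3 (2 * b)) * (if odd y then 1 else 0)"
  have o: "odd N" using N by presburger
  have m: "(N - 4 * l) mod 4 = 1" for l using N by presburger
  have split: "(\<Sum>l\<in>{1..N}. dsum wt (N - 2 * l) * ?h l) =
    (\<Sum>l\<in>{l\<in>{1..N}. odd l}. dsum wt (N - 2 * l) * ?h l) + (\<Sum>l\<in>{l\<in>{1..N}. even l}. dsum wt (N - 2 * l) * ?h l)"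
  proof -
    have fin: "finite {l\<in>{1..N}. R l}" for R by (rule finite_subset[of _ "{1..N}"]) auto
    have "{1..N} = {l\<in>{1..N}. odd l} \<union> {l\<in>{1..N}. even l}" by blast
    moreover have "(\<Sum>l\<in>{l\<in>{1..N}. odd l} \<union> {l\<in>{1..N}. even l}. dsum wt (N - 2 * l) * ?h l) =
      (\<Sum>l\<in>{l\<in>{1..N}. odd l}. dsum wt (N - 2 * l) * ?h l) + (\<Sum>l\<in>{l\<in>{1..N}. even l}. dsum wt (N - 2 * l) * ?h l)"
      by (rule sum.union_disjoint[OF fin fin]) blast
    ultimately show ?thesis by argo
  qed
  have "(\<Sum>l\<in>{l\<in>{1..N}. odd l}. dsum wt (N - 2 * l) * ?h l) =
    (\<Sum>l\<in>{l\<in>{1..N}. odd l}. 3 * (sub_div chi4_sum 3 (N - 2 * l) * chi3_sum l))"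
  proof (rule sum.cong[OF refl])
    fix l assume "l \<in> {l\<in>{1..N}. odd l}"
    then have l: "odd l" by simp
    with N have m3: "(N - 2 * l) mod 4 = 3" by presburger
    show "dsum wt (N - 2 * l) * ?h l = 3 * (sub_div chi4_sum 3 (N - 2 * l) * chi3_sum l)"
      unfolding dsum_wt_3[OF m3] sum_ew_odd(1)[OF l] by (simp only: mult.assoc)
  qed
  then have odd: "(\<Sum>l\<in>{l\<in>{1..N}. odd l}. dsum wt (N - 2 * l) * ?h l) = 3 * convZ N"
    by (simp add: convZ_def sum_distrib_left)
  have "(\<Sum>l\<in>{l\<in>{1..N}. even l}. dsum wt (N - 2 * l) * ?h l) =
    (\<Sum>l\<in>{l\<in>{1..N}. 2 * l \<le> N}. dsum wt (N - 2 * (2 * l)) * ?h (2 * l))"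
    by (rule sum.reindex_bij_witness[where i = "\<lambda>l. 2 * l" and j = "\<lambda>l. l div 2"]) auto
  also have "\<dots> = (\<Sum>l\<in>{l\<in>{1..N}. 2 * l \<le> N}. chi4_sum (N - 4 * l) * (chi3_sum l - 1 * sub_div chi3_sum 2 l))"
  proof (rule sum.cong[OF refl])
    fix l
    have "N - 2 * (2 * l) = N - 4 * l" by simp
    then show "dsum wt (N - 2 * (2 * l)) * ?h (2 * l) = chi4_sum (N - 4 * l) * (chi3_sum l - 1 * sub_div chi3_sum 2 l)"
      by (simp only: sum_ew_odd(2) dsum_wt_1[OF m] mult_1)
  qed
  also have "\<dots> = (\<Sum>l\<in>{1..N}. chi4_sum (N - 4 * l) * (chi3_sum l - 1 * sub_div chi3_sum 2 l))"
  proof -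
    have "2 * l \<le> N" if "chi4_sum (N - 4 * l) \<noteq> 0" "1 \<le> l" for l
      using that chi4_sum_nonpos[of "N - 4 * l"] by linarith
    then show ?thesis by (intro sum.mono_neutral_left) auto
  qed
  finally have even: "(\<Sum>l\<in>{l\<in>{1..N}. even l}. dsum wt (N - 2 * l) * ?h l) = convX N - ?Y"
    unfolding sum_lin2 convX_def by simp
  have "2 * (3 * convZ N + (convX N - ?Y)) = E2 N - E1 N"
    using conv_odd_even[OF o] unfolding split odd even .
  with conv_1mod4[OF N] show ?thesis by simp
qed

section \<open>The convolution \<open>chi4_sum + 6 convX\<close> in closed form\<close>

definition quat :: "int \<Rightarrow> int \<Rightarrow> int \<Rightarrow> (int \<times> int \<times> int \<times> int) set" where
  "quat d c N = {(x, y, p, q). d * nf 0 x y + c * nf 1 p q = N}"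

lemma sum_quat_conv:
  fixes h :: "int \<Rightarrow> int \<Rightarrow> int"
  assumes "0 < d" "0 < c"
  shows "(\<Sum>(x, y, p, q)\<in>quat d c N. h p q) =
    (\<Sum>l\<in>{0..N}. sub_div (\<lambda>k. int (card (reps 0 k))) d (N - c * l) * (\<Sum>(p, q)\<in>reps 1 l. h p q))"
    and finite_quat: "finite (quat d c N)"
proof -
  let ?R = "\<lambda>k. {(x, y). d * nf 0 x y = k}"
  have R: "?R k = (if d dvd k then reps 0 (k div d) else {})" for k
    using assms by (auto simp: reps_def)
  then have card: "int (card (?R k)) = sub_div (\<lambda>k. int (card (reps 0 k))) d k" for k
    by (simp add: sub_div_def)
  have finR: "finite (?R k)" for k unfolding R by simp
  let ?Sig = "Sigma {0..N} (\<lambda>l. ?R (N - c * l) \<times> reps 1 l)"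
  let ?j = "\<lambda>(l, z). (fst (fst z), snd (fst z), fst (snd z), snd (snd z))"
  have inS: "(nf 1 p q, (x, y), (p, q)) \<in> ?Sig" if "(x, y, p, q) \<in> quat d c N" for x y p q
  proof -
    have "0 \<le> nf 0 x y" "0 \<le> nf 1 p q" by (simp_all add: nf_nonneg)
    moreover from this have "0 \<le> d * nf 0 x y" using assms by simp
    moreover have "nf 1 p q \<le> c * nf 1 p q"
      using mult_right_mono[of 1 c "nf 1 p q"] \<open>0 \<le> nf 1 p q\<close> assms by linarith
    moreover have e: "d * nf 0 x y + c * nf 1 p q = N" using that by (simp add: quat_def)
    ultimately have "nf 1 p q \<le> N" by linarith
    with \<open>0 \<le> nf 1 p q\<close> e show ?thesis by (auto simp: reps_def)
  qed
  have finSig: "finite ?Sig" using finR by auto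
  have "quat d c N \<subseteq> ?j ` ?Sig"
  proof
    fix z assume z: "z \<in> quat d c N"
    obtain x y p q where "z = (x, y, p, q)" by (cases z)
    with z inS[of x y p q] show "z \<in> ?j ` ?Sig" by force
  qed
  with finSig show "finite (quat d c N)" by (meson finite_imageI finite_subset)
  have "(\<Sum>l\<in>{0..N}. sub_div (\<lambda>k. int (card (reps 0 k))) d (N - c * l) * (\<Sum>(p, q)\<in>reps 1 l. h p q)) =
    (\<Sum>l\<in>{0..N}. (\<Sum>z\<in>?R (N - c * l). 1) * (\<Sum>(p, q)\<in>reps 1 l. h p q))"
    using card by simp
  also have "\<dots> = (\<Sum>l\<in>{0..N}. \<Sum>z\<in>?R (N - c * l) \<times> reps 1 l. h (fst (snd z)) (snd (snd z)))"
    unfolding sum_product sum.cartesian_product by (simp add: case_prod_unfold)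
  also have "\<dots> = (\<Sum>(l, z)\<in>?Sig. h (fst (snd z)) (snd (snd z)))"
    by (rule sum.Sigma) (use finR in auto)
  also have "\<dots> = (\<Sum>(x, y, p, q)\<in>quat d c N. h p q)"
  proof (rule sum.reindex_bij_witness[where i = "\<lambda>(x, y, p, q). (nf 1 p q, (x, y), (p, q))" and j = ?j])
    fix z assume z: "z \<in> quat d c N"
    obtain x y p q where "z = (x, y, p, q)" by (cases z)
    with z inS[of x y p q] show "(case z of (x, y, p, q) \<Rightarrow> (nf 1 p q, (x, y), (p, q))) \<in> ?Sig" by simp
  qed (auto simp: reps_def quat_def)
  finally show "(\<Sum>(x, y, p, q)\<in>quat d c N. h p q) =
    (\<Sum>l\<in>{0..N}. sub_div (\<lambda>k. int (card (reps 0 k))) d (N - c * l) * (\<Sum>(p, q)\<in>reps 1 l. h p q))"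
    by simp
qed

lemma card_reps0: "k \<noteq> 0 \<Longrightarrow> int (card (reps 0 k)) = 4 * chi4_sum k"
  by (cases "0 < k") (auto simp: card_sum_two_squares chi4_sum_def reps_neg dsum_def dpairs_nonpos)

lemma card_reps1: "0 < k \<Longrightarrow> int (card (reps 1 k)) = 6 * chi3_sum k"
  by (simp add: card_reps_eisenstein chi3_sum_def)

lemma sub_div_1 [simp]: "sub_div f 1 k = f k"
  by (simp add: sub_div_def)

lemma sub_div_card_reps0:
  assumes "k \<noteq> 0"
  shows "sub_div (\<lambda>k. int (card (reps 0 k))) d k = 4 * sub_div chi4_sum d k"
  using assms by (auto simp: sub_div_def card_reps0 elim!: dvdE)

lemma card_quat_4:
  assumes "odd N" "0 < N" "0 < d"
  shows "int (card (quat d 4 N)) = 4 * (sub_div chi4_sum d N + 6 * (\<Sum>l\<in>{1..N}. sub_div chi4_sum d (N - 4 * l) * chi3_sum l))"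
proof -
  have "int (card (quat d 4 N)) = (\<Sum>(x, y, p, q)\<in>quat d 4 N. 1)"
    by (simp add: case_prod_unfold)
  also have "\<dots> = (\<Sum>l\<in>{0..N}. sub_div (\<lambda>k. int (card (reps 0 k))) d (N - 4 * l) * int (card (reps 1 l)))"
    unfolding sum_quat_conv(1)[OF assms(3), of 4, simplified] by (simp add: case_prod_unfold)
  also have "\<dots> = (\<Sum>l\<in>{0..N}. 4 * sub_div chi4_sum d (N - 4 * l) * int (card (reps 1 l)))"
  proof (rule sum.cong[OF refl])
    fix l
    \<comment> \<open>Oddness of \<open>N\<close> excludes the argument 0, which has one
      representation although \<open>chi4_sum 0\<close> is 0.\<close>
    have "N - 4 * l \<noteq> 0" using assms by presburger
    then show "sub_div (\<lambda>k. int (card (reps 0 k))) d (N - 4 * l) * int (card (reps 1 l)) =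
      4 * sub_div chi4_sum d (N - 4 * l) * int (card (reps 1 l))"
      by (subst sub_div_card_reps0) simp_all
  qed
  also have "{0..N} = insert 0 {1..N}" using assms by auto
  also have "(\<Sum>l\<in>insert 0 {1..N}. 4 * sub_div chi4_sum d (N - 4 * l) * int (card (reps 1 l))) =
    4 * sub_div chi4_sum d N + (\<Sum>l\<in>{1..N}. 4 * sub_div chi4_sum d (N - 4 * l) * (6 * chi3_sum l))"
    by (simp add: reps_0 card_reps1)
  finally show ?thesis by (simp add: sum_distrib_left algebra_simps)
qed

lemma nf1_parity: "even (nf 1 p q) \<longleftrightarrow> even p \<and> even q"
  by (auto simp: nf_def)

text \<open>The automorphism (p, q) -> (q, - p - q) of order 3 permutes the three nonzero classes of
  (p, q) modulo 2 cyclically, and the zero class has even norm.\<close>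

lemma card_reps1_parity:
  assumes "odd l"
  shows "card (reps 1 l) = 3 * card {(p, q)\<in>reps 1 l. even q}"
    "card {(p, q)\<in>reps 1 l. odd q} = 2 * card {(p, q)\<in>reps 1 l. even q}"
proof -
  let ?E = "{(p, q)\<in>reps 1 l. even q}" and ?O = "{(p, q)\<in>reps 1 l. odd q}"
  let ?A = "{(p, q)\<in>reps 1 l. even p}" and ?B = "{(p, q)\<in>reps 1 l. odd p \<and> odd q}"
  have fin: "finite {(p, q)\<in>reps 1 l. R p q}" for R
    by (rule finite_subset[of _ "reps 1 l"]) auto
  have rot: "nf 1 q (- p - q) = nf 1 p q" "nf 1 (- p - q) p = nf 1 p q" for p q
    by (simp_all add: nf_def algebra_simps)
  have par: "odd p \<or> odd q" if "nf 1 p q = l" for p q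
    using that assms nf1_parity[of p q] by auto
  have "bij_betw (\<lambda>(p, q). (q, - p - q)) ?E ?A"
    by (rule bij_betw_byWitness[where f' = "\<lambda>(p, q). (- p - q, p)"])
       (auto simp: reps_def rot)
  then have 1: "card ?A = card ?E" by (simp add: bij_betw_same_card)
  have "bij_betw (\<lambda>(p, q). (- p - q, p)) ?E ?B"
    by (rule bij_betw_byWitness[where f' = "\<lambda>(p, q). (q, - p - q)"])
       (use par in \<open>auto simp: reps_def rot\<close>)
  then have 2: "card ?B = card ?E" by (simp add: bij_betw_same_card)
  have "?O = ?A \<union> ?B" using par by (auto simp: reps_def)
  moreover have "card (?A \<union> ?B) = card ?A + card ?B"
    by (rule card_Un_disjoint) (use fin in auto)
  ultimately show 3: "card ?O = 2 * card ?E" using 1 2 by simp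
  have "reps 1 l = ?E \<union> ?O" by auto
  moreover have "card (?E \<union> ?O) = card ?E + card ?O"
    by (rule card_Un_disjoint) (use fin in auto)
  ultimately have "card (reps 1 l) = card ?E + card ?O" by argo
  with 3 show "card (reps 1 l) = 3 * card ?E" by simp
qed

section \<open>The forms at multiples of 3\<close>

lemma chi3_sum_3: "chi3_sum (3 * l) = chi3_sum l"
  using dsum_prime_mult[of 3 chi3 l] by (simp add: chi3_sum_def chi3_mult)

text \<open>A term survives only if 3 divides 3 M - c l, that is, if 3 divides l; then every
  argument can be divided by 3, since \<open>chi3_sum\<close> ignores factors 3.\<close>

lemma conv_sub_3:
  assumes "\<not> 3 dvd c"
  shows "(\<Sum>l\<in>{l\<in>{1..3 * M}. R l}. sub_div chi4_sum 3 (3 * M - c * l) * chi3_sum l) =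
    (\<Sum>l\<in>{l\<in>{1..M}. R (3 * l)}. chi4_sum (M - c * l) * chi3_sum l)"
proof -
  have "(\<Sum>l\<in>{l\<in>{1..3 * M}. R l}. sub_div chi4_sum 3 (3 * M - c * l) * chi3_sum l) =
    (\<Sum>l\<in>{l\<in>{1..3 * M}. R l \<and> 3 dvd l}. sub_div chi4_sum 3 (3 * M - c * l) * chi3_sum l)"
  proof (rule sum.mono_neutral_right)
    show "finite {l\<in>{1..3 * M}. R l}" by (rule finite_subset[of _ "{1..3 * M}"]) auto
    show "\<forall>l\<in>{l\<in>{1..3 * M}. R l} - {l\<in>{1..3 * M}. R l \<and> 3 dvd l}. sub_div chi4_sum 3 (3 * M - c * l) * chi3_sum l = 0"
    proof
      fix l assume "l \<in> {l\<in>{1..3 * M}. R l} - {l\<in>{1..3 * M}. R l \<and> 3 dvd l}"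
      then have "\<not> 3 dvd l" by auto
      with assms have "\<not> 3 dvd c * l" by (simp add: prime_dvd_mult_iff)
      then have "\<not> 3 dvd 3 * M - c * l" by (metis dvd_diff_right_iff dvd_triv_left)
      then show "sub_div chi4_sum 3 (3 * M - c * l) * chi3_sum l = 0" by (simp add: sub_div_def)
    qed
  qed auto
  also have "\<dots> = (\<Sum>l\<in>{l\<in>{1..M}. R (3 * l)}. chi4_sum (M - c * l) * chi3_sum l)"
  proof (rule sum.reindex_bij_witness[where i = "\<lambda>l. 3 * l" and j = "\<lambda>l. l div 3"])
    fix l assume "l \<in> {l\<in>{1..3 * M}. R l \<and> 3 dvd l}"
    then obtain k where k: "l = 3 * k" "1 \<le> k" "k \<le> M" "R l" by (auto elim!: dvdE)
    have "3 * M - c * l = 3 * (M - c * k)" by (simp add: k algebra_simps)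
    then have "sub_div chi4_sum 3 (3 * M - c * l) = chi4_sum (M - c * k)" unfolding sub_div_def by (simp only:) simp
    with k show "chi4_sum (M - c * (l div 3)) * chi3_sum (l div 3) = sub_div chi4_sum 3 (3 * M - c * l) * chi3_sum l"
      by (simp add: chi3_sum_3)
  qed auto
  finally show ?thesis .
qed

lemma convX3_triple: "convX3 (3 * M) = convX M"
proof -
  have "\<not> 3 dvd (4::int)" by simp
  from conv_sub_3[OF this, of M "\<lambda>_. True"] show ?thesis
    unfolding convX3_def convX_def by (simp only: simp_thms Collect_mem_eq)
qed

lemma convZ_triple: "convZ (3 * N) = (\<Sum>l\<in>{l\<in>{1..N}. odd l}. chi4_sum (N - 2 * l) * chi3_sum l)"
  using conv_sub_3[of 2 N odd] by (simp add: convZ_def)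

text \<open>For even l the number N - 2 l is 3 mod 4 and is not a sum of two squares. For odd l two
  thirds of the \<open>6 * chi3_sum l\<close> pairs have an odd second entry, and 4 times 4 gives
  the factor 16.\<close>

lemma card_quat_2_odd:
  assumes N: "N mod 4 = 3"
  shows "int (card {(m, s, A, B)\<in>quat 1 2 N. odd B}) = 16 * convZ (3 * N)"
proof -
  have "int (card {(m, s, A, B)\<in>quat 1 2 N. odd B}) = (\<Sum>(m, s, A, B)\<in>{(m, s, A, B)\<in>quat 1 2 N. odd B}. 1)"
    by (simp add: case_prod_unfold)
  also have "\<dots> = (\<Sum>(m, s, A, B)\<in>quat 1 2 N. if odd B then 1 else 0)"
    by (rule sum.mono_neutral_cong_left) (auto simp: finite_quat)
  also have "\<dots> = (\<Sum>l\<in>{0..N}. int (card (reps 0 (N - 2 * l))) * (\<Sum>(p, q)\<in>reps 1 l. if odd q then 1 else 0))"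
    using sum_quat_conv(1)[where d = 1 and c = 2 and h = "\<lambda>p q. if odd q then 1 else 0" and N = N] by simp
  also have "\<dots> = (\<Sum>l\<in>{l\<in>{1..N}. odd l}. int (card (reps 0 (N - 2 * l))) * (\<Sum>(p, q)\<in>reps 1 l. if odd q then 1 else 0))"
  proof (rule sum.mono_neutral_right)
    show "\<forall>l\<in>{0..N} - {l\<in>{1..N}. odd l}.
      int (card (reps 0 (N - 2 * l))) * (\<Sum>(p, q)\<in>reps 1 l. if odd q then 1 else 0) = 0"
    proof
      fix l assume "l \<in> {0..N} - {l\<in>{1..N}. odd l}"
      then have "even l" by (cases "l = 0") auto
      with N have "(N - 2 * l) mod 4 = 3" by presburger
      moreover from this have "N - 2 * l \<noteq> 0" by auto
      ultimately have "int (card (reps 0 (N - 2 * l))) = 0" using card_reps0 chi4_sum_3mod4 by simp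
      then show "int (card (reps 0 (N - 2 * l))) * (\<Sum>(p, q)\<in>reps 1 l. if odd q then 1 else 0) = 0" by simp
    qed
  qed auto
  also have "\<dots> = (\<Sum>l\<in>{l\<in>{1..N}. odd l}. 16 * (chi4_sum (N - 2 * l) * chi3_sum l))"
  proof (rule sum.cong[OF refl])
    fix l assume l: "l \<in> {l\<in>{1..N}. odd l}"
    have "N - 2 * l \<noteq> 0" using N by presburger
    moreover have "(\<Sum>(p, q)\<in>reps 1 l. if odd q then 1 else 0) = (\<Sum>(p, q)\<in>{(p, q)\<in>reps 1 l. odd q}. 1 :: int)"
      by (rule sum.mono_neutral_cong_right) auto
    then have "(\<Sum>(p, q)\<in>reps 1 l. if odd q then 1 else 0) = int (card {(p, q)\<in>reps 1 l. odd q})"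
      by (simp add: case_prod_unfold)
    moreover have "3 * int (card {(p, q)\<in>reps 1 l. odd q}) = 2 * int (card (reps 1 l))"
      using l card_reps1_parity[of l] by simp
    then have "int (card {(p, q)\<in>reps 1 l. odd q}) = 4 * chi3_sum l"
      using l card_reps1[of l] by simp
    ultimately show "int (card (reps 0 (N - 2 * l))) * (\<Sum>(p, q)\<in>reps 1 l. if odd q then 1 else 0) = 16 * (chi4_sum (N - 2 * l) * chi3_sum l)"
      by (simp add: card_reps0)
  qed
  finally show ?thesis by (simp add: convZ_triple sum_distrib_left)
qed

text \<open>Modulo 3, a solution of \<open>x\<^sup>2 + y\<^sup>2 + 4 nf 1 p q = 3 N\<close> satisfies \<open>x\<^sup>2 + y\<^sup>2 + t\<^sup>2 = 0\<close> with
  \<open>t = p - q\<close>, so that the three terms vanish together. Up to signs \<open>x\<close>, \<open>y\<close>, \<open>t\<close> agree modulo 3,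
  and rotating the lattice about the axis \<open>x = y = t\<close> divides the form by 3.\<close>

lemma card_quat_mod3:
  assumes N: "odd N"
  shows "int (card (quat 1 4 (3 * N))) =
    4 * int (card {(x, y, p, q)\<in>quat 1 4 (3 * N). 3 dvd x - (p - q) \<and> 3 dvd y - (p - q)})
    - 3 * int (card {(x, y, p, q)\<in>quat 1 4 (3 * N). 3 dvd x \<and> 3 dvd y \<and> 3 dvd p - q})"
proof -
  let ?S = "quat 1 4 (3 * N)"
  let ?Z = "{(x, y, p, q)\<in>?S. 3 dvd x \<and> 3 dvd y \<and> 3 dvd p - q}"
  \<comment> \<open>The signs \<open>i\<close>, \<open>j\<close> select one of four disjoint
    classes, which reflections of \<open>x\<close> and \<open>y\<close> show to be equinumerous.
    \<open>?D\<close> consists of \<open>?Z\<close> and the class with both signs positive, hence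
    the total is four times \<open>?D\<close> minus three times \<open>?Z\<close>.\<close>
  let ?A = "\<lambda>i j. {(x, y, p, q)\<in>?S. \<not> 3 dvd p - q \<and> 3 dvd i * x - (p - q) \<and> 3 dvd j * y - (p - q)}"
  let ?D = "{(x, y, p, q)\<in>?S. 3 dvd x - (p - q) \<and> 3 dvd y - (p - q)}"
  have fin: "finite {(x, y, p, q)\<in>?S. R x y p q}" for R
    by (rule finite_subset[of _ ?S]) (auto simp: finite_quat)
  have key: "(3 dvd x \<and> 3 dvd y \<and> 3 dvd t) \<or>
      (\<not> 3 dvd t \<and> (3 dvd x - t \<or> 3 dvd - x - t) \<and> (3 dvd y - t \<or> 3 dvd - y - t))"
    if "(x, y, p, q) \<in> ?S" "t = p - q" for x y p q t
  proof -
    \<comment> \<open>This uses 4 (p^2 + p q + q^2) = (p - q)^2 + 3 (p + q)^2.\<close>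
    have "x * x + y * y + t * t = 3 * (N - (p + q) * (p + q))"
      using that(1) unfolding that(2) by (simp add: quat_def nf_def algebra_simps)
    then have "3 dvd x * x + y * y + t * t" by simp
    moreover have "[x * x + y * y + t * t = (x mod 3) * (x mod 3) + (y mod 3) * (y mod 3) + (t mod 3) * (t mod 3)] (mod 3)"
      by (intro cong_add cong_mult) (simp_all add: cong_def)
    ultimately have "3 dvd (x mod 3) * (x mod 3) + (y mod 3) * (y mod 3) + (t mod 3) * (t mod 3)"
      using cong_dvd_iff by blast
    moreover have "3 dvd x - t \<longleftrightarrow> x mod 3 = t mod 3" "3 dvd y - t \<longleftrightarrow> y mod 3 = t mod 3"
      by (simp_all add: mod_eq_dvd_iff)
    moreover have "3 dvd - x - t \<longleftrightarrow> (x mod 3 + t mod 3) mod 3 = 0" "3 dvd - y - t \<longleftrightarrow> (y mod 3 + t mod 3) mod 3 = 0"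
      by presburger+
    ultimately show ?thesis
      unfolding dvd_eq_mod_eq_0[of 3 x] dvd_eq_mod_eq_0[of 3 y] dvd_eq_mod_eq_0[of 3 t]
      using int_mod3_cases[of x] int_mod3_cases[of y] int_mod3_cases[of t]
      by (elim disjE) simp_all
  qed
  have card: "card (?A i j) = card (?A 1 1)" if "i = 1 \<or> i = - 1" "j = 1 \<or> j = - 1" for i j
  proof -
    have "bij_betw (\<lambda>(x, y, p, q). (i * x, j * y, p, q)) (?A i j) (?A 1 1)"
      by (rule bij_betw_byWitness[where f' = "\<lambda>(x, y, p, q). (i * x, j * y, p, q)"])
         (use that in \<open>auto simp: quat_def nf_def\<close>)
    then show ?thesis by (rule bij_betw_same_card)
  qed
  have ne: "\<not> (3 dvd z - t \<and> 3 dvd - z - t)" if "\<not> 3 dvd t" for z t :: int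
    using that by presburger
  have "?S = ?Z \<union> (?A 1 1 \<union> ?A 1 (- 1)) \<union> (?A (- 1) 1 \<union> ?A (- 1) (- 1))" (is "_ = ?R")
  proof
    show "?S \<subseteq> ?R"
    proof
      fix z assume z: "z \<in> ?S"
      obtain x y p q where zz: "z = (x, y, p, q)" by (cases z)
      with key[of x y p q "p - q"] z show "z \<in> ?R" by simp blast
    qed
  qed auto
  then have "card ?S = card ?R" by (rule arg_cong)
  also have "card ?R = card (?Z \<union> (?A 1 1 \<union> ?A 1 (- 1))) + card (?A (- 1) 1 \<union> ?A (- 1) (- 1))"
    by (rule card_Un_disjoint) (use fin ne in auto)
  also have "card (?Z \<union> (?A 1 1 \<union> ?A 1 (- 1))) = card ?Z + card (?A 1 1 \<union> ?A 1 (- 1))"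
    by (rule card_Un_disjoint) (use fin in auto)
  also have "card (?A 1 1 \<union> ?A 1 (- 1)) = card (?A 1 1) + card (?A 1 (- 1))"
    by (rule card_Un_disjoint) (use fin ne in auto)
  also have "card (?A (- 1) 1 \<union> ?A (- 1) (- 1)) = card (?A (- 1) 1) + card (?A (- 1) (- 1))"
    by (rule card_Un_disjoint) (use fin ne in auto)
  finally have tot: "card ?S = card ?Z + 4 * card (?A 1 1)"
    using card[of 1 "- 1"] card[of "- 1" 1] card[of "- 1" "- 1"] by linarith
  have "?D = ?Z \<union> ?A 1 1"
  proof -
    have "(3 dvd x - t \<and> 3 dvd y - t) \<longleftrightarrow> (3 dvd x \<and> 3 dvd y \<and> 3 dvd t) \<or>
      (\<not> 3 dvd t \<and> 3 dvd 1 * x - t \<and> 3 dvd 1 * y - t)" for x y t :: int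
      by presburger
    then show ?thesis by blast
  qed
  moreover have "card (?Z \<union> ?A 1 1) = card ?Z + card (?A 1 1)"
    by (rule card_Un_disjoint) (use fin in auto)
  ultimately have "card ?D = card ?Z + card (?A 1 1)" by argo
  with tot show ?thesis by linarith
qed

text \<open>Here \<open>x\<close> and \<open>y\<close> are divided by 3, and (p, q) by the element 1
  + theta of norm 3, as in \<open>card_reps_three\<close>.\<close>

lemma card_quat_triple_zero:
  "card {(x, y, p, q)\<in>quat 1 4 (3 * N). 3 dvd x \<and> 3 dvd y \<and> 3 dvd p - q} = card (quat 3 4 N)"
proof -
  have "bij_betw (\<lambda>(x, y, p, q). (3 * x, 3 * y, p - q, p + 2 * q)) (quat 3 4 N)
    {(x, y, p, q)\<in>quat 1 4 (3 * N). 3 dvd x \<and> 3 dvd y \<and> 3 dvd p - q}" (is "bij_betw _ _ ?Z")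
  proof (rule bij_betw_byWitness[where
        f' = "\<lambda>(x, y, p, q). (x div 3, y div 3, p + (q - p) div 3, (q - p) div 3)"])
    have d: "3 dvd q - p" if "3 dvd p - q" for p q :: int using that by presburger
    have ex: "\<exists>x' y' q'. x = 3 * x' \<and> y = 3 * y' \<and> q = p + 3 * q'" if "(x, y, p, q) \<in> ?Z" for x y p q
    proof -
      from that obtain x' y' q' where "x = 3 * x'" "y = 3 * y'" "q - p = 3 * q'"
        using d[of p q] by (auto elim!: dvdE)
      then show ?thesis by (metis add.commute diff_add_cancel)
    qed
    show "\<forall>z\<in>?Z. (\<lambda>(x, y, p, q). (3 * x, 3 * y, p - q, p + 2 * q))
      ((\<lambda>(x, y, p, q). (x div 3, y div 3, p + (q - p) div 3, (q - p) div 3)) z) = z"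
    proof
      fix z assume z: "z \<in> ?Z"
      obtain x y p q where zz: "z = (x, y, p, q)" by (cases z)
      from ex[of x y p q] z zz obtain x' y' q' where "x = 3 * x'" "y = 3 * y'" "q = p + 3 * q'" by auto
      with zz show "(\<lambda>(x, y, p, q). (3 * x, 3 * y, p - q, p + 2 * q))
      ((\<lambda>(x, y, p, q). (x div 3, y div 3, p + (q - p) div 3, (q - p) div 3)) z) = z" by simp
    qed
    show "(\<lambda>(x, y, p, q). (x div 3, y div 3, p + (q - p) div 3, (q - p) div 3)) ` ?Z \<subseteq> quat 3 4 N"
    proof
      fix w assume "w \<in> (\<lambda>(x, y, p, q). (x div 3, y div 3, p + (q - p) div 3, (q - p) div 3)) ` ?Z"
      then obtain x y p q where z: "(x, y, p, q) \<in> ?Z"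
        and w: "w = (x div 3, y div 3, p + (q - p) div 3, (q - p) div 3)" by auto
      from ex[OF z] obtain x' y' q' where e: "x = 3 * x'" "y = 3 * y'" "q = p + 3 * q'" by auto
      have "3 * (3 * nf 0 x' y' + 4 * nf 1 (p + q') q') = 3 * N"
        using z unfolding e by (simp add: quat_def nf_def algebra_simps)
      then show "w \<in> quat 3 4 N" unfolding w e by (simp add: quat_def)
    qed
  qed (auto simp: quat_def nf_def algebra_simps)
  then show ?thesis by (simp add: bij_betw_same_card)
qed

text \<open>Put t = p - q, s = p + q and let \<open>m\<close> be the mean of \<open>x\<close>,
  \<open>y\<close>, t. The deviations from the mean are \<open>A - B\<close>,
  \<open>A + 2 * B\<close>, \<open>- 2 * A - B\<close>; they sum to 0 and their squares to
  \<open>6 * nf 1 A B\<close>, so that x^2 + y^2 + t^2 + 3 s^2 = 3 (m^2 + s^2 + 2 nf 1 A B).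
  Integral \<open>p\<close>, \<open>q\<close> require s + t to be even. As m + s is odd, this means
  exactly that \<open>B\<close> is odd.\<close>

lemma card_quat_triple_diag:
  assumes N: "odd N"
  shows "card {(x, y, p, q)\<in>quat 1 4 (3 * N). 3 dvd x - (p - q) \<and> 3 dvd y - (p - q)} =
    card {(m, s, A, B)\<in>quat 1 2 N. odd B}" (is "card ?D = card ?B")
proof -
  let ?g = "\<lambda>(x :: int, y, p, q). ((x + y + (p - q)) div 3, p + q, (x - (p - q)) div 3, (y - x) div 3)"
  let ?f = "\<lambda>(m :: int, s, A, B). (m + A - B, m + A + 2 * B, (s + (m - 2 * A - B)) div 2, (s - (m - 2 * A - B)) div 2)"
  have par: "even (s + (m - 2 * A - B))" if "(m, s, A, B) \<in> ?B" for m s A B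
  proof -
    have "m * m + s * s + 2 * nf 1 A B = N" "odd B" using that by (auto simp: quat_def nf_def)
    with N have "odd (m * m + s * s + 2 * nf 1 A B)" by simp
    then have "odd (m * m + s * s)" by simp
    with \<open>odd B\<close> show ?thesis by simp
  qed
  have ex: "\<exists>m A B. x = m + A - B \<and> y = m + A + 2 * B \<and> p - q = m - 2 * A - B"
    if "(x, y, p, q) \<in> ?D" for x y p q
  proof -
    have "3 dvd x - (p - q)" "3 dvd y - (p - q)" using that by auto
    then have "3 dvd x - (p - q)" "3 dvd y - x" by presburger+
    then obtain A B where "x - (p - q) = 3 * A" "y - x = 3 * B" by (auto elim!: dvdE)
    then have "x = (x - A + B) + A - B \<and> y = (x - A + B) + A + 2 * B \<and> p - q = (x - A + B) - 2 * A - B"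
      by simp
    then show ?thesis by blast
  qed
  have val: "?g (x, y, p, q) = (m, p + q, A, B)"
    if "x = m + A - B" "y = m + A + 2 * B" "p - q = m - 2 * A - B" for x y p q m A B :: int
  proof -
    have "x + y + (p - q) = 3 * m" "x - (p - q) = 3 * A" "y - x = 3 * B" using that by simp_all
    then show ?thesis by simp
  qed
  have "bij_betw ?f ?B ?D"
  proof (rule bij_betw_byWitness[where f' = ?g])
    show "\<forall>z\<in>?B. ?g (?f z) = z"
    proof
      fix z assume z: "z \<in> ?B"
      obtain m s A B where zz: "z = (m, s, A, B)" by (cases z)
      from par[of m s A B] z zz have "even (s + (m - 2 * A - B))" by blast
      then obtain k where k: "s + (m - 2 * A - B) = 2 * k" by (elim evenE)
      then have k': "s - (m - 2 * A - B) = 2 * (s - k)" by simp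
      have f: "?f z = (m + A - B, m + A + 2 * B, k, s - k)" unfolding zz using k k' by simp
      have "?g (?f z) = ?g (m + A - B, m + A + 2 * B, k, s - k)" using f by (rule arg_cong)
      also have "\<dots> = (m, k + (s - k), A, B)" by (rule val) (use k in simp_all)
      finally show "?g (?f z) = z" by (simp only: zz) simp
    qed
    show "\<forall>z\<in>?D. ?f (?g z) = z"
    proof
      fix z assume z: "z \<in> ?D"
      obtain x y p q where zz: "z = (x, y, p, q)" by (cases z)
      with ex[of x y p q] z obtain m A B where e: "x = m + A - B" "y = m + A + 2 * B" "p - q = m - 2 * A - B"
        by auto
      have "(p + q + (m - 2 * A - B)) div 2 = p" "(p + q - (m - 2 * A - B)) div 2 = q"
        unfolding e(3)[symmetric] by simp_all
      then have "?f (m, p + q, A, B) = z" by (simp only: zz e(1,2) prod.case)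
      moreover have "?f (?g z) = ?f (m, p + q, A, B)" unfolding zz by (rule arg_cong[OF val[OF e]])
      ultimately show "?f (?g z) = z" by (rule trans[rotated])
    qed
    show "?f ` ?B \<subseteq> ?D"
    proof
      fix w assume "w \<in> ?f ` ?B"
      then obtain z where z: "z \<in> ?B" and w: "w = ?f z" by auto
      obtain m s A B where zz: "z = (m, s, A, B)" by (cases z)
      from par[of m s A B] z zz have "even (s + (m - 2 * A - B))" by blast
      then obtain k where k: "s + (m - 2 * A - B) = 2 * k" by (elim evenE)
      then have k': "s - (m - 2 * A - B) = 2 * (s - k)" and s: "s = 2 * k - (m - 2 * A - B)" by simp_all
      have f: "w = (m + A - B, m + A + 2 * B, k, s - k)" unfolding w zz using k k' by simp
      have "nf 0 m s + 2 * nf 1 A B = N" using z zz by (simp add: quat_def)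
      then have "nf 0 (m + A - B) (m + A + 2 * B) + 4 * nf 1 k (s - k) = 3 * N"
        unfolding s by (auto simp: nf_def algebra_simps)
      moreover have e: "m + A - B - (k - (s - k)) = 3 * A" "m + A + 2 * B - (k - (s - k)) = 3 * (A + B)"
        using k by simp_all
      have "3 dvd m + A - B - (k - (s - k))" "3 dvd m + A + 2 * B - (k - (s - k))"
        unfolding e by simp_all
      ultimately show "w \<in> ?D" unfolding f by (simp add: quat_def)
    qed
    show "?g ` ?D \<subseteq> ?B"
    proof
      fix w assume "w \<in> ?g ` ?D"
      then obtain z where z: "z \<in> ?D" and w: "w = ?g z" by auto
      obtain x y p q where zz: "z = (x, y, p, q)" by (cases z)
      with ex[of x y p q] z obtain m A B where e: "x = m + A - B" "y = m + A + 2 * B" "p - q = m - 2 * A - B"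
        by auto
      have p: "p = q + (m - 2 * A - B)" using e(3) by simp
      have "nf 0 x y + 4 * nf 1 p q = 3 * N" using z zz by (simp add: quat_def)
      then have "3 * (nf 0 m (p + q) + 2 * nf 1 A B) = 3 * N"
        unfolding e(1,2) p by (simp add: nf_def algebra_simps)
      then have eq: "nf 0 m (p + q) + 2 * nf 1 A B = N" by simp
      then have "odd (m * m + (p + q) * (p + q))" using N by (auto simp: nf_def)
      then have "odd (m + (p + q))" by simp
      then have "odd B" unfolding p by simp
      with eq show "w \<in> ?B" unfolding w zz val[OF e] by (simp add: quat_def)
    qed
  qed
  then show ?thesis by (simp add: bij_betw_same_card)
qed

lemma convX_triple:
  assumes N: "N mod 4 = 3" "0 < N"
  shows "chi4_sum (3 * N) + 6 * convX (3 * N) = 16 * convZ (3 * N) - 3 * (sub_div chi4_sum 3 N + 6 * convX3 N)"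
proof -
  have o: "odd N" using N by presburger
  have "int (card (quat 1 4 (3 * N))) = 4 * (16 * convZ (3 * N)) - 3 * int (card (quat 3 4 N))"
    using card_quat_mod3[OF o] card_quat_triple_zero[of N] card_quat_triple_diag[OF o] card_quat_2_odd[OF N(1)] by simp
  moreover have "int (card (quat 1 4 (3 * N))) = 4 * (chi4_sum (3 * N) + 6 * convX (3 * N))"
    using card_quat_4[of "3 * N" 1] o N(2) by (simp add: convX_def)
  moreover have "int (card (quat 3 4 N)) = 4 * (sub_div chi4_sum 3 N + 6 * convX3 N)"
    using card_quat_4[of N 3] o N(2) by (simp add: convX3_def)
  ultimately show ?thesis by simp
qed

section \<open>Divisor sums at multiples of 3 and the induction\<close>

text \<open>\<open>chi12\<close> vanishes at multiples of 3, so an additional factor 3 must lie in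
  the cofactor.\<close>

lemma sum_dpairs_coprime3:
  fixes f :: "int \<Rightarrow> int"
  shows "(\<Sum>(a, x)\<in>dpairs (3 * k). chi12 a * f a) = (\<Sum>(a, x)\<in>dpairs k. chi12 a * f a)"
    and "(\<Sum>(a, x)\<in>dpairs (3 * k). chi12 a * x) = 3 * (\<Sum>(a, x)\<in>dpairs k. chi12 a * x)"
proof -
  let ?g = "\<lambda>a x. chi12 a * f a" and ?h = "\<lambda>a x. chi12 a * x"
  have z: "chi12 (3 * a) = 0" for a by (simp add: chi12_def chi3_mult)
  have e: "(\<Sum>(a, x)\<in>dpairs (3 * k). g a x) = (\<Sum>(a, x)\<in>dpairs k. g a (3 * x))"
    if "\<And>a x. 3 dvd a \<Longrightarrow> g a x = 0" for g :: "int \<Rightarrow> int \<Rightarrow> int"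
  proof -
    have "(\<Sum>(a, x)\<in>dpairs (3 * k). g a x) = (\<Sum>(a, x)\<in>dpairs (3 * k). g x a)" by (rule sum_dpairs_swap)
    also have "\<dots> = (\<Sum>(a, x)\<in>{(a, x)\<in>dpairs (3 * k). 3 dvd a}. g x a)"
    proof (rule sum.mono_neutral_right)
      show "\<forall>z\<in>dpairs (3 * k) - {(a, x)\<in>dpairs (3 * k). 3 dvd a}. (case z of (a, x) \<Rightarrow> g x a) = 0"
      proof
        fix z assume z: "z \<in> dpairs (3 * k) - {(a, x)\<in>dpairs (3 * k). 3 dvd a}"
        obtain a x where zz: "z = (a, x)" by (cases z)
        with z have "a * x = 3 * k" "\<not> 3 dvd a" by (auto simp: dpairs_def)
        then have "3 dvd a * x" "\<not> 3 dvd a" by simp_all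
        then have "3 dvd x" using prime_dvd_mult_iff[of 3 a x] by simp
        with zz that[of x a] show "(case z of (a, x) \<Rightarrow> g x a) = 0" by simp
      qed
    qed auto
    also have "\<dots> = (\<Sum>(a, x)\<in>dpairs k. g x (3 * a))"
      using sum_dpairs_dvd[of 3 "\<lambda>a x. g x a" "3 * k"] by simp
    also have "\<dots> = (\<Sum>(a, x)\<in>dpairs k. g a (3 * x))" by (rule sum_dpairs_swap)
    finally show ?thesis .
  qed
  have z': "chi12 a = 0" if "3 dvd a" for a using that z by auto
  show "(\<Sum>(a, x)\<in>dpairs (3 * k). chi12 a * f a) = (\<Sum>(a, x)\<in>dpairs k. chi12 a * f a)"
    using e[of ?g] z' by simp
  show "(\<Sum>(a, x)\<in>dpairs (3 * k). chi12 a * x) = 3 * (\<Sum>(a, x)\<in>dpairs k. chi12 a * x)"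
    using e[of ?h] z' by (simp add: sum_distrib_left case_prod_unfold mult_ac)
qed

lemma E1_triple: "E1 (3 * k) = E1 k"
  using sum_dpairs_coprime3(1)[where f = "\<lambda>a. a"] by (simp add: E1_def)

lemma E2_triple: "E2 (3 * k) = 3 * E2 k"
  using sum_dpairs_coprime3(2) by (simp add: E2_def)

lemma E1_eq_E2:
  assumes "odd N" "\<not> 3 dvd N"
  shows "E1 N = chi12 N * E2 N"
proof -
  have "E1 N = (\<Sum>(a, x)\<in>dpairs N. chi12 x * x)" unfolding E1_def by (rule sum_dpairs_swap)
  also have "\<dots> = (\<Sum>(a, x)\<in>dpairs N. chi12 N * (chi12 a * x))"
  proof (rule sum.cong[OF refl], clarify)
    fix a x assume ax: "(a, x) \<in> dpairs N"
    then have N: "N = a * x" by (simp add: dpairs_def)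
    with assms have "odd a" "\<not> 3 dvd a" by auto
    then have "chi12 a * chi12 a = 1"
      using chi4_square[of a] chi3_square[of a] by (simp add: chi12_def mult_ac)
    then have "chi12 x = chi12 N * chi12 a" by (simp add: N chi12_mult mult_ac)
    then show "chi12 x * x = chi12 N * (chi12 a * x)" by simp
  qed
  finally show ?thesis by (simp add: E2_def sum_distrib_left case_prod_unfold)
qed

theorem convX_closed:
  assumes "N mod 4 = 1" "0 < N"
  shows "2 * (chi4_sum N + 6 * convX N) = 3 * E2 N - E1 N"
  using assms
proof (induction "nat N" arbitrary: N rule: less_induct)
  case less
  have o: "odd N" using less.prems by presburger
  show ?case
  proof (cases "3 dvd N")
    case False
    have "chi12 N = chi3 N" using less.prems by (simp add: chi12_def chi4_def)
    with E1_eq_E2[OF o False] convX_coprime[OF less.prems(1) False] show ?thesis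
      by (simp add: algebra_simps)
  next
    case True
    then obtain M where M: "N = 3 * M" by auto
    with less.prems have M4: "M mod 4 = 3" and M0: "0 < M" by presburger+
    have M_odd: "odd M" using M4 by presburger
    \<comment> \<open>For M = 3 L the left-hand side is the one at L in the induction hypothesis;
      the right-hand sides agree because passing from L to M triples \<open>E2\<close> and fixes
      \<open>E1\<close>.\<close>
    have W3: "2 * (sub_div chi4_sum 3 M + 6 * convX3 M) = E2 M - E1 M"
    proof (cases "3 dvd M")
      case False
      have "chi12 M = - chi3 M" using M4 by (simp add: chi12_def chi4_def)
      with E1_eq_E2[OF M_odd False] convX3_coprime[OF M4 False] False show ?thesis
        by (simp add: algebra_simps sub_div_def)
    next
      case True
      then obtain L where L: "M = 3 * L" by auto
      with M4 M0 have "L mod 4 = 1" "0 < L" by presburger+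
      moreover have "L < N" using M L \<open>0 < L\<close> by simp
      ultimately have "2 * (chi4_sum L + 6 * convX L) = 3 * E2 L - E1 L"
        using less.hyps[of L] less.prems by simp
      then show ?thesis by (simp add: L sub_div_def convX3_triple E1_triple E2_triple)
    qed
    have "chi4_sum N + 6 * convX N = 9 * E2 M - 2 * E1 M - 12 * convZ N"
      using convX_convZ[OF less.prems(1)] by (simp add: M E1_triple E2_triple)
    moreover have "chi4_sum N + 6 * convX N = 16 * convZ N - 3 * (sub_div chi4_sum 3 M + 6 * convX3 M)"
      using convX_triple[OF M4 M0] by (simp add: M)
    \<comment> \<open>Adding 4 times the first relation to 3 times the second cancels
      \<open>convZ N\<close>; what remains is divisible by 7.\<close>
    ultimately have "2 * (chi4_sum N + 6 * convX N) = 9 * E2 M - E1 M" using W3 by simp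
    then show ?thesis by (simp add: M E1_triple E2_triple)
  qed
qed

section \<open>Jacobi's identity for the cube of the eta function\<close>

definition par :: "int \<Rightarrow> int" where
  "par k = (if even k then 1 else - 1)"

lemma sum_sign_reversing:
  fixes f :: "'a \<Rightarrow> int"
  assumes "\<And>z. z \<in> A \<Longrightarrow> i z \<in> A" "\<And>z. z \<in> A \<Longrightarrow> i (i z) = z" "\<And>z. z \<in> A \<Longrightarrow> f (i z) = - f z"
  shows "sum f A = 0"
proof -
  have "sum f A = (\<Sum>z\<in>A. - f z)"
    by (rule sum.reindex_bij_witness[where i = i and j = i]) (use assms in auto)
  then show ?thesis by (simp add: sum_negf)
qed

lemma odd_square_mod8: "odd (x::int) \<Longrightarrow> x * x mod 8 = 1"
proof -
  assume "odd x"
  then obtain k where k: "x = 2 * k + 1" by (elim oddE)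
  have "even (k * (k + 1))" by simp
  then obtain m where "k * (k + 1) = 2 * m" by (elim evenE)
  then have "x * x = 8 * m + 1" by (simp add: k algebra_simps)
  then show ?thesis by simp
qed

text \<open>When the number of representations of k by p^2 + q^2 is written as 4 times the sum of
  \<open>chi4 d\<close> over d e = k, Jacobi's identity becomes the evaluation of the sum of
  \<open>par e * chi4 d\<close> over this set. As \<open>x\<close> and \<open>d\<close> are odd,
  exactly one of x, - x satisfies the condition \<open>4 dvd x + d\<close> imposed below.\<close>

definition Om :: "int \<Rightarrow> (int \<times> int \<times> int) set" where
  "Om M = {(x, d, e). 0 < d \<and> 0 < e \<and> odd d \<and> x * x + 8 * (d * e) = M}"

lemma finite_square_conv:
  assumes "0 < k"
  shows "finite {(x, d, e). 0 < d \<and> 0 < e \<and> x * x + k * (d * e) = (M::int)}"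
proof (rule finite_subset)
  show "{(x, d, e). 0 < d \<and> 0 < e \<and> x * x + k * (d * e) = M} \<subseteq> {- M..M} \<times> {0..M} \<times> {0..M}"
  proof
    fix t assume "t \<in> {(x, d, e). 0 < d \<and> 0 < e \<and> x * x + k * (d * e) = M}"
    then obtain x d e where t: "t = (x, d, e)" and *: "0 < d" "0 < e" "x * x + k * (d * e) = M" by auto
    have "d \<le> d * e" "e \<le> d * e" using pos_factor_le[OF *(1,2)] by auto
    moreover have "d * e \<le> k * (d * e)" using mult_right_mono[of 1 k "d * e"] assms * by simp
    moreover have "\<bar>x\<bar> \<le> x * x" by (rule abs_le_square)
    moreover have "0 \<le> x * x" by simp
    ultimately have "\<bar>x\<bar> \<le> M" "d \<le> M" "e \<le> M" using * by linarith+
    then show "t \<in> {- M..M} \<times> {0..M} \<times> {0..M}" using * t by auto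
  qed
qed simp

lemma finite_Om: "finite {(x, d, e)\<in>Om M. R x d e}"
  by (rule finite_subset[OF _ finite_square_conv[of 8 M]]) (auto simp: Om_def)

text \<open>Reflecting \<open>x\<close> in \<open>d\<close> preserves the equation if
  \<open>e\<close> is moved by (x - d) / 2, and the inequality says exactly that the new
  \<open>e\<close> is positive. The congruence makes (x - d) / 2 odd, so \<open>par e\<close>
  changes sign.\<close>

lemma sum_Om_positive:
  "(\<Sum>(x, d, e)\<in>{(x, d, e)\<in>Om M. 4 dvd x + d \<and> 0 < 2 * e + x - d}. par e * chi4 d) = 0"
proof (rule sum_sign_reversing[where i = "\<lambda>(x, d, e). (2 * d - x, d, e + (x - d) div 2)"])
  fix z assume z: "z \<in> {(x, d, e)\<in>Om M. 4 dvd x + d \<and> 0 < 2 * e + x - d}"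
  obtain x d e where zz: "z = (x, d, e)" by (cases z)
  have d: "odd d" "4 dvd x + d" "0 < d" "0 < e" "0 < 2 * e + x - d" "x * x + 8 * (d * e) = M"
    using z zz by (auto simp: Om_def)
  obtain k where k: "x = d + 2 * k" "odd k"
  proof -
    from d(2) obtain j where "x + d = 4 * j" by (elim dvdE)
    then have "x = d + 2 * (2 * j - d)" by simp
    with that[of "2 * j - d"] d(1) show ?thesis by simp
  qed
  have kd: "(x - d) div 2 = k" "(2 * d - x - d) div 2 = - k" using k by simp_all
  have "0 < e + k" using d(5) k by simp
  moreover have "(2 * d - x) * (2 * d - x) + 8 * (d * (e + k)) = M"
    using d(6) unfolding k by (simp add: algebra_simps)
  moreover have "4 dvd 2 * d - x + d" using d(1) k by (auto elim!: oddE)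
  moreover have "0 < 2 * (e + k) + (2 * d - x) - d" using d(4) k by simp
  ultimately show "(\<lambda>(x, d, e). (2 * d - x, d, e + (x - d) div 2)) z \<in>
      {(x, d, e)\<in>Om M. 4 dvd x + d \<and> 0 < 2 * e + x - d}"
    using d unfolding zz by (simp add: Om_def kd)
  show "(\<lambda>(x, d, e). (2 * d - x, d, e + (x - d) div 2)) ((\<lambda>(x, d, e). (2 * d - x, d, e + (x - d) div 2)) z) = z"
    unfolding zz by (simp add: kd k)
  have "par (e + k) = - par e" using k by (simp add: par_def)
  then show "(case (\<lambda>(x, d, e). (2 * d - x, d, e + (x - d) div 2)) z of (x, d, e) \<Rightarrow> par e * chi4 d) =
      - (case z of (x, d, e) \<Rightarrow> par e * chi4 d)"
    unfolding zz by (simp add: kd)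
qed

text \<open>With z = x + 4 e and d = x + 2 e + 2 f the equation becomes z^2 + 16 e f = M with e + f
  odd, and d > 0 becomes 2 e - 2 f < z. The map (z, e, f) -> (- z, f, e) preserves the weight and
  exchanges this half space with its complement; the sum over both halves vanishes under z -> -
  z.\<close>

lemma sum_Om_negative:
  assumes M: "odd M"
  shows "(\<Sum>(x, d, e)\<in>{(x, d, e)\<in>Om M. 4 dvd x + d \<and> 2 * e + x - d < 0}. par e * chi4 d) = 0"
proof -
  let ?L = "{(z, e, f). 0 < e \<and> 0 < f \<and> z * z + 16 * (e * f) = M \<and> odd (e + f)}"
  let ?Lp = "{(z, e, f)\<in>?L. 2 * e - 2 * f < z}" and ?Lm = "{(z, e, f)\<in>?L. z < 2 * e - 2 * f}"
  let ?w = "\<lambda>(z, e, f). par e * chi4 z"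
  have odd: "odd z" if "z * z + 16 * k = M" for z k
  proof -
    have "odd (z * z + 16 * k)" using M that by simp
    then show ?thesis by simp
  qed
  have "(\<Sum>(x, d, e)\<in>{(x, d, e)\<in>Om M. 4 dvd x + d \<and> 2 * e + x - d < 0}. par e * chi4 d) = (\<Sum>z\<in>?Lp. - ?w z)"
  proof (rule sum.reindex_bij_witness[where j = "\<lambda>(x, d, e). (4 * e + x, e, (d - x - 2 * e) div 2)"
        and i = "\<lambda>(z, e, f). (z - 4 * e, 2 * f + z - 2 * e, e)"])
    fix t assume t: "t \<in> {(x, d, e)\<in>Om M. 4 dvd x + d \<and> 2 * e + x - d < 0}"
    obtain x d e where tt: "t = (x, d, e)" by (cases t)
    have d: "odd d" "4 dvd x + d" "0 < d" "0 < e" "2 * e + x - d < 0" "x * x + 8 * (d * e) = M"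
      using t tt by (auto simp: Om_def)
    obtain f where f: "d = x + 2 * e + 2 * f"
    proof -
      from d(2) obtain j where "x + d = 4 * j" by (elim dvdE)
      then have "d = x + 2 * e + 2 * (d - 2 * j - e)" by simp
      with that show ?thesis .
    qed
    have fd: "(d - x - 2 * e) div 2 = f" using f by simp
    show "(\<lambda>(z, e, f). (z - 4 * e, 2 * f + z - 2 * e, e)) ((\<lambda>(x, d, e). (4 * e + x, e, (d - x - 2 * e) div 2)) t) = t"
      unfolding tt using f by simp
    have f0: "0 < f" using d(5) f by simp
    have ef: "odd (e + f)"
    proof -
      from d(2) f obtain j where "x + (x + 2 * e + 2 * f) = 4 * j" by (auto elim!: dvdE)
      then have "x + e + f = 2 * j" by simp
      then have "even (x + (e + f))" by (metis add.assoc even_mult_iff even_numeral)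
      moreover have "odd x" using d(1) f by simp
      ultimately show ?thesis by simp
    qed
    have "(4 * e + x) * (4 * e + x) + 16 * (e * f) = M"
      using d(6) unfolding f by (simp add: algebra_simps)
    with f0 ef d f show "(\<lambda>(x, d, e). (4 * e + x, e, (d - x - 2 * e) div 2)) t \<in> ?Lp"
      unfolding tt by (simp add: fd)
    have "chi4 d = - chi4 (4 * e + x)"
    proof -
      have "d = (4 * e + x) + 2 * (f - e)" using f by simp
      moreover have "\<not> 4 dvd 2 * (f - e)" using ef by presburger
      ultimately show ?thesis using chi4_shift(2)[of "2 * (f - e)" "4 * e + x"] by (simp add: sg_def)
    qed
    then show "- ?w ((\<lambda>(x, d, e). (4 * e + x, e, (d - x - 2 * e) div 2)) t) = (case t of (x, d, e) \<Rightarrow> par e * chi4 d)"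
      unfolding tt by simp
  next
    fix t assume t: "t \<in> ?Lp"
    obtain z e f where tt: "t = (z, e, f)" by (cases t)
    have d: "0 < e" "0 < f" "z * z + 16 * (e * f) = M" "odd (e + f)" "2 * e - 2 * f < z" using t tt by auto
    show "(\<lambda>(x, d, e). (4 * e + x, e, (d - x - 2 * e) div 2)) ((\<lambda>(z, e, f). (z - 4 * e, 2 * f + z - 2 * e, e)) t) = t"
      unfolding tt by simp
    have "(z - 4 * e) * (z - 4 * e) + 8 * ((2 * f + z - 2 * e) * e) = M"
      using d(3) by (simp add: algebra_simps)
    moreover have z: "odd z" using odd[of z "e * f"] d(3) by simp
    moreover have "4 dvd (z - 4 * e) + (2 * f + z - 2 * e)" using z d(4) by presburger
    ultimately show "(\<lambda>(z, e, f). (z - 4 * e, 2 * f + z - 2 * e, e)) t \<in> {(x, d, e)\<in>Om M. 4 dvd x + d \<and> 2 * e + x - d < 0}"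
      unfolding tt using d by (simp add: Om_def)
  qed
  also have "\<dots> = - sum ?w ?Lp" by (simp add: sum_negf)
  also have "sum ?w ?Lp = 0"
  proof -
    have "sum ?w ?Lm = sum ?w ?Lp"
      by (rule sum.reindex_bij_witness[where i = "\<lambda>(z, e, f). (- z, f, e)" and j = "\<lambda>(z, e, f). (- z, f, e)"])
         (auto simp: par_def algebra_simps)
    moreover have "sum ?w ?L = sum ?w ?Lp + sum ?w ?Lm"
    proof -
      have "finite ?L"
        by (rule finite_subset[OF _ finite_square_conv[of 16 M]]) auto
      then have fin: "finite ?Lp" "finite ?Lm" by (auto elim: rev_finite_subset)
      have "?L = ?Lp \<union> ?Lm"
      proof -
        have "z \<noteq> 2 * e - 2 * f" if "z * z + 16 * (e * f) = M" for z e f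
          using odd[OF that] by auto
        then show ?thesis by (auto simp: not_less order_less_le)
      qed
      moreover have "sum ?w (?Lp \<union> ?Lm) = sum ?w ?Lp + sum ?w ?Lm"
        by (rule sum.union_disjoint) (use fin in auto)
      ultimately show ?thesis by argo
    qed
    moreover have "sum ?w ?L = 0"
      by (rule sum_sign_reversing[where i = "\<lambda>(z, e, f). (- z, e, f)"]) auto
    ultimately show ?thesis by simp
  qed
  finally show ?thesis by simp
qed

lemma card_odd_below:
  assumes "odd c" "0 < c"
  shows "4 * int (card {e. odd e \<and> 0 < e \<and> 2 * e < c}) = c - chi4 c"
proof -
  have "{e. odd e \<and> 0 < e \<and> 2 * e < c} = (\<lambda>j. 2 * j + 1) ` {0..<(c + 1) div 4}"
  proof
    show "{e. odd e \<and> 0 < e \<and> 2 * e < c} \<subseteq> (\<lambda>j. 2 * j + 1) ` {0..<(c + 1) div 4}"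
    proof
      fix e assume "e \<in> {e. odd e \<and> 0 < e \<and> 2 * e < c}"
      then have e: "odd e" "0 < e" "2 * e < c" by auto
      then have "e div 2 \<in> {0..<(c + 1) div 4}" using assms by auto presburger
      moreover have "e = 2 * (e div 2) + 1" using e by presburger
      ultimately show "e \<in> (\<lambda>j. 2 * j + 1) ` {0..<(c + 1) div 4}" by blast
    qed
    show "(\<lambda>j. 2 * j + 1) ` {0..<(c + 1) div 4} \<subseteq> {e. odd e \<and> 0 < e \<and> 2 * e < c}"
    proof clarify
      fix j :: int assume "j \<in> {0..<(c + 1) div 4}"
      then have "0 \<le> j" "j < (c + 1) div 4" by auto
      then show "odd (2 * j + 1) \<and> 0 < 2 * j + 1 \<and> 2 * (2 * j + 1) < c"
        using assms by simp
    qed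
  qed
  then have "card {e. odd e \<and> 0 < e \<and> 2 * e < c} = nat ((c + 1) div 4)"
    by (simp add: card_image inj_on_def)
  moreover have "0 \<le> (c + 1) div 4" using assms by simp
  moreover have "4 * ((c + 1) div 4) = c - chi4 c"
  proof -
    have "c mod 4 = 1 \<or> c mod 4 = 3" using assms by presburger
    then show ?thesis by (elim disjE) (simp add: chi4_def, presburger)+
  qed
  ultimately show ?thesis by simp
qed

text \<open>On the boundary x = d - 2 e, so M = (d + 2 e)^2. Hence d = c - 2 e with \<open>e\<close>
  odd, each such \<open>e\<close> contributes \<open>chi4 c\<close>, and it remains to count the odd
  e < c / 2.\<close>

lemma sum_Om_zero:
  assumes M: "odd M" and c: "c * c = M" "0 < c"
  shows "4 * (\<Sum>(x, d, e)\<in>{(x, d, e)\<in>Om M. 4 dvd x + d \<and> 2 * e + x - d = 0}. par e * chi4 d) = chi4 c * c - 1"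
proof -
  have oc: "odd c" using M c(1) by auto
  have "(\<Sum>(x, d, e)\<in>{(x, d, e)\<in>Om M. 4 dvd x + d \<and> 2 * e + x - d = 0}. par e * chi4 d) =
    (\<Sum>e\<in>{e. odd e \<and> 0 < e \<and> 2 * e < c}. chi4 c)"
  proof (rule sum.reindex_bij_witness[where j = "\<lambda>(x, d, e). e" and i = "\<lambda>e. (c - 4 * e, c - 2 * e, e)"])
    fix t assume t: "t \<in> {(x, d, e)\<in>Om M. 4 dvd x + d \<and> 2 * e + x - d = 0}"
    obtain x d e where tt: "t = (x, d, e)" by (cases t)
    have d: "odd d" "4 dvd x + d" "0 < d" "0 < e" "x = d - 2 * e" "x * x + 8 * (d * e) = M"
      using t tt by (auto simp: Om_def)
    have "(d + 2 * e) * (d + 2 * e) = c * c" using d(6) c(1) unfolding d(5) by (simp add: algebra_simps)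
    then have "d + 2 * e = c" using d c(2) by (simp add: square_eq_iff)
    then have dc: "d = c - 2 * e" by simp
    have oe: "odd e" using d(1,2) unfolding d(5) by presburger
    show "(case t of (x, d, e) \<Rightarrow> e) \<in> {e. odd e \<and> 0 < e \<and> 2 * e < c}" using tt oe d dc by simp
    show "(\<lambda>e. (c - 4 * e, c - 2 * e, e)) (case t of (x, d, e) \<Rightarrow> e) = t" using tt d dc by simp
    have "\<not> 4 dvd 2 * e" using oe by presburger
    then have "chi4 d = - chi4 c" using chi4_shift(1)[of "2 * e" c] dc by (simp add: sg_def)
    then show "chi4 c = (case t of (x, d, e) \<Rightarrow> par e * chi4 d)" using tt oe by (simp add: par_def)
  next
    fix e assume "e \<in> {e. odd e \<and> 0 < e \<and> 2 * e < c}"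
    then have e: "odd e" "0 < e" "2 * e < c" by auto
    show "(case (c - 4 * e, c - 2 * e, e) of (x, d, e) \<Rightarrow> e) = e" by simp
    have "(c - 4 * e) * (c - 4 * e) + 8 * ((c - 2 * e) * e) = M" using c(1) by (simp add: algebra_simps)
    moreover have "4 dvd (c - 4 * e) + (c - 2 * e)" using e(1) oc by presburger
    ultimately show "(c - 4 * e, c - 2 * e, e) \<in> {(x, d, e)\<in>Om M. 4 dvd x + d \<and> 2 * e + x - d = 0}"
      using e oc by (simp add: Om_def)
  qed
  then have "4 * (\<Sum>(x, d, e)\<in>{(x, d, e)\<in>Om M. 4 dvd x + d \<and> 2 * e + x - d = 0}. par e * chi4 d) =
    chi4 c * (4 * int (card {e. odd e \<and> 0 < e \<and> 2 * e < c}))" by simp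
  also have "\<dots> = chi4 c * c - 1"
    unfolding card_odd_below[OF oc c(2)] using chi4_square[OF oc] by (simp add: algebra_simps)
  finally show ?thesis .
qed

lemma sum_Om:
  assumes M: "odd M"
  shows "(\<Sum>(x, d, e)\<in>Om M. par e * chi4 d) =
    2 * (\<Sum>(x, d, e)\<in>{(x, d, e)\<in>Om M. 4 dvd x + d \<and> 2 * e + x - d = 0}. par e * chi4 d)"
proof -
  let ?f = "\<lambda>(x, d, e). par e * chi4 d :: int"
  let ?m = "{(x, d, e)\<in>Om M. 4 dvd x + d}" and ?p = "{(x, d, e)\<in>Om M. 4 dvd - x + d}"
  let ?A = "{(x, d, e)\<in>Om M. 4 dvd x + d \<and> 0 < 2 * e + x - d}"
    and ?B = "{(x, d, e)\<in>Om M. 4 dvd x + d \<and> 2 * e + x - d < 0}"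
    and ?C = "{(x, d, e)\<in>Om M. 4 dvd x + d \<and> 2 * e + x - d = 0}"
  have ox: "odd x \<and> odd d" if "(x, d, e) \<in> Om M" for x d e
  proof -
    have "odd (x * x + 8 * (d * e))" "odd d" using M that by (auto simp: Om_def)
    then show ?thesis by simp
  qed
  have "Om M = ?m \<union> ?p"
  proof -
    have "4 dvd x + d \<or> 4 dvd - x + d" if "odd x \<and> odd d" for x d :: int using that by presburger
    with ox show ?thesis by blast
  qed
  moreover have "sum ?f (?m \<union> ?p) = sum ?f ?m + sum ?f ?p"
  proof (rule sum.union_disjoint[OF finite_Om finite_Om])
    have "\<not> (4 dvd x + d \<and> 4 dvd - x + d)" if "odd x \<and> odd d" for x d :: int using that by presburger
    with ox show "?m \<inter> ?p = {}" by blast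
  qed
  moreover have "sum ?f ?p = sum ?f ?m"
    by (rule sum.reindex_bij_witness[where i = "\<lambda>(x, d, e). (- x, d, e)" and j = "\<lambda>(x, d, e). (- x, d, e)"])
       (auto simp: Om_def ac_simps)
  moreover have "sum ?f ?m = sum ?f ?A + sum ?f ?B + sum ?f ?C"
  proof -
    have "?m = (?A \<union> ?B) \<union> ?C" by auto
    moreover have "sum ?f ((?A \<union> ?B) \<union> ?C) = sum ?f (?A \<union> ?B) + sum ?f ?C"
      by (rule sum.union_disjoint) (use finite_Om in auto)
    moreover have "sum ?f (?A \<union> ?B) = sum ?f ?A + sum ?f ?B"
      by (rule sum.union_disjoint[OF finite_Om finite_Om]) auto
    ultimately show ?thesis by argo
  qed
  ultimately show ?thesis using sum_Om_positive[of M] sum_Om_negative[OF M] by simp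
qed

lemma par_nf0: "par (nf 0 p q) = par (p + q)"
  by (simp add: par_def nf_def)

definition JS :: "int \<Rightarrow> (int \<times> int \<times> int) set" where
  "JS M = {(x, p, q). x * x + 8 * nf 0 p q = M}"

lemma odd_of_square_add: "odd (M::int) \<Longrightarrow> x * x + 8 * k = M \<Longrightarrow> odd x"
  by auto

text \<open>Coefficient form of Jacobi's series for eta^3 in the variable q^8, where the cube is
  expressed by theta series as psi(q) phi(-q)^2. Both signs of x and of c are included, which
  doubles the two sides.\<close>

theorem jacobi_eta_cube:
  assumes M: "M mod 8 = 1"
  shows "(\<Sum>(x, p, q)\<in>JS M. par (p + q)) = (\<Sum>c\<in>{c. c * c = M}. chi4 c * c)"
    and finite_JS: "finite (JS M)"
proof -
  let ?X = "{x\<in>{- M..M}. odd x}"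
  let ?l = "\<lambda>x. (M - x * x) div 8"
  have oM: "odd M" using M by presburger
  have l: "x * x + 8 * ?l x = M" if "odd x" for x
  proof -
    have "x * x mod 8 = 1" using that by (rule odd_square_mod8)
    with M have "8 dvd M - x * x" by (simp add: mod_eq_dvd_iff[symmetric])
    then show ?thesis by (auto elim!: dvdE)
  qed
  have bound: "x \<in> ?X" if "x * x + 8 * k = M" "0 \<le> k" for x k
    using abs_le_square[of x] that odd_of_square_add[OF oM that(1)] by auto
  have finX: "finite ?X" by (rule finite_subset[of _ "{- M..M}"]) auto
  have JS': "JS M = Sigma ?X (\<lambda>x. reps 0 (?l x))"
  proof -
    have "(x, p, q) \<in> JS M \<longleftrightarrow> x \<in> ?X \<and> (p, q) \<in> reps 0 (?l x)" for x p q
    proof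
      assume *: "(x, p, q) \<in> JS M"
      then have e: "x * x + 8 * nf 0 p q = M" by (simp add: JS_def)
      have "x \<in> ?X" by (rule bound[OF e]) (simp add: nf_nonneg)
      moreover have "?l x = nf 0 p q" using e by auto
      ultimately show "x \<in> ?X \<and> (p, q) \<in> reps 0 (?l x)" by (simp add: reps_def)
    next
      assume "x \<in> ?X \<and> (p, q) \<in> reps 0 (?l x)"
      then show "(x, p, q) \<in> JS M" using l[of x] by (simp add: JS_def reps_def)
    qed
    then show ?thesis by auto
  qed
  show "finite (JS M)" unfolding JS' by (rule finite_SigmaI[OF finX]) simp
  have "(\<Sum>(x, p, q)\<in>JS M. par (p + q)) = (\<Sum>x\<in>?X. \<Sum>(p, q)\<in>reps 0 (?l x). par (p + q))"
    unfolding JS' by (subst sum.Sigma) (use finX in \<open>auto simp: case_prod_unfold\<close>)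
  also have "\<dots> = (\<Sum>x\<in>?X. (if ?l x = 0 then 1 else 0) + 4 * (\<Sum>(d, e)\<in>dpairs (?l x). par (d * e) * chi4 d))"
  proof (rule sum.cong[OF refl])
    fix x
    let ?k = "?l x"
    have "(\<Sum>(p, q)\<in>reps 0 ?k. par (p + q)) = (\<Sum>(p, q)\<in>reps 0 ?k. par ?k)"
      by (rule sum.cong) (auto simp: reps_def par_nf0[symmetric])
    also have "\<dots> = par ?k * int (card (reps 0 ?k))" by (simp add: case_prod_unfold)
    \<comment> \<open>At 0 there is one representation while \<open>chi4_sum 0\<close> is 0. This
      accounts for the separate term, which later counts the square roots of
      \<open>M\<close>.\<close>
    also have "\<dots> = (if ?k = 0 then 1 else 0) + 4 * (par ?k * chi4_sum ?k)"
      by (cases "?k = 0") (simp_all add: reps_0 card_reps0 par_def chi4_sum_nonpos)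
    also have "par ?k * chi4_sum ?k = (\<Sum>(d, e)\<in>dpairs ?k. par (d * e) * chi4 d)"
      unfolding chi4_sum_def dsum_def sum_distrib_left by (rule sum.cong) (auto simp: dpairs_def)
    finally show "(\<Sum>(p, q)\<in>reps 0 ?k. par (p + q)) =
      (if ?k = 0 then 1 else 0) + 4 * (\<Sum>(d, e)\<in>dpairs ?k. par (d * e) * chi4 d)" .
  qed
  also have "\<dots> = (\<Sum>x\<in>?X. if ?l x = 0 then 1 else 0) + 4 * (\<Sum>x\<in>?X. \<Sum>(d, e)\<in>dpairs (?l x). par (d * e) * chi4 d)"
    by (simp add: sum.distrib sum_distrib_left)
  also have "(\<Sum>x\<in>?X. if ?l x = 0 then 1 else 0) = int (card {c. c * c = M})"
  proof -
    have "(\<Sum>x\<in>?X. if ?l x = 0 then 1 else 0) = (\<Sum>x\<in>{x\<in>?X. ?l x = 0}. 1 :: int)"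
      by (rule sum.mono_neutral_cong_right) (use finX in auto)
    moreover have "{x\<in>?X. ?l x = 0} = {c. c * c = M}"
    proof -
      have "x \<in> ?X \<and> ?l x = 0" if "x * x = M" for x
        using bound[of x 0] that by simp
      moreover have "x * x = M" if "x \<in> ?X" "?l x = 0" for x
        using l[of x] that by simp
      ultimately show ?thesis by blast
    qed
    ultimately show ?thesis by simp
  qed
  also have "(\<Sum>x\<in>?X. \<Sum>(d, e)\<in>dpairs (?l x). par (d * e) * chi4 d) = (\<Sum>(x, d, e)\<in>Om M. par e * chi4 d)"
  proof -
    let ?Sig = "Sigma ?X (\<lambda>x. dpairs (?l x))"
    have "(\<Sum>x\<in>?X. \<Sum>(d, e)\<in>dpairs (?l x). par (d * e) * chi4 d) = (\<Sum>(x, d, e)\<in>?Sig. par (d * e) * chi4 d)"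
      by (subst sum.Sigma) (use finX in \<open>auto simp: case_prod_unfold\<close>)
    also have "\<dots> = (\<Sum>(x, d, e)\<in>Om M. par e * chi4 d)"
    proof (rule sum.mono_neutral_cong_right)
      show "finite ?Sig" using finX by auto
      show "Om M \<subseteq> ?Sig"
      proof
        fix t assume t: "t \<in> Om M"
        obtain x d e where tt: "t = (x, d, e)" by (cases t)
        have d: "0 < d" "0 < e" "x * x + 8 * (d * e) = M" using t tt by (auto simp: Om_def)
        have "x \<in> ?X" using bound[OF d(3)] d by simp
        moreover have "?l x = d * e" using d(3) by auto
        ultimately show "t \<in> ?Sig" using tt d by (simp add: dpairs_def)
      qed
      show "\<forall>t\<in>?Sig - Om M. (case t of (x, d, e) \<Rightarrow> par (d * e) * chi4 d) = 0"
      proof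
        fix t assume t: "t \<in> ?Sig - Om M"
        obtain x d e where tt: "t = (x, d, e)" by (cases t)
        have d: "0 < d" "0 < e" "d * e = ?l x" "odd x" using t tt by (auto simp: dpairs_def)
        then have "x * x + 8 * (d * e) = M" using l[of x] by simp
        with t tt d have "even d" by (auto simp: Om_def)
        then show "(case t of (x, d, e) \<Rightarrow> par (d * e) * chi4 d) = 0" using tt by (simp add: chi4_even)
      qed
    qed (auto simp: Om_def par_def)
    finally show ?thesis .
  qed
  finally have main: "(\<Sum>(x, p, q)\<in>JS M. par (p + q)) =
    int (card {c. c * c = M}) + 4 * (\<Sum>(x, d, e)\<in>Om M. par e * chi4 d)" .
  show "(\<Sum>(x, p, q)\<in>JS M. par (p + q)) = (\<Sum>c\<in>{c. c * c = M}. chi4 c * c)"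
  proof (cases "\<exists>c. c * c = M")
    case True
    then obtain c0 where c0: "c0 * c0 = M" by auto
    define c where "c = \<bar>c0\<bar>"
    have c: "c * c = M" "0 < c" using c0 oM by (auto simp: c_def)
    have sq: "{c. c * c = M} = {c, - c}" using c by (auto simp: square_eq_iff)
    have "int (card {c. c * c = M}) = 2" "(\<Sum>c\<in>{c. c * c = M}. chi4 c * c) = 2 * (chi4 c * c)"
      unfolding sq using c(2) by simp_all
    \<comment> \<open>The two square roots contribute 2 and the weighted sum contributes
      \<open>2 * (chi4 c * c - 1)\<close>.\<close>
    with main sum_Om[OF oM] sum_Om_zero[OF oM c] show ?thesis by linarith
  next
    case False
    have "{(x, d, e)\<in>Om M. 4 dvd x + d \<and> 2 * e + x - d = 0} = {}"
    proof (rule ccontr)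
      assume "{(x, d, e)\<in>Om M. 4 dvd x + d \<and> 2 * e + x - d = 0} \<noteq> {}"
      then obtain x d e where *: "(x, d, e) \<in> Om M" "2 * e + x - d = 0" by blast
      then have "x = d - 2 * e" "x * x + 8 * (d * e) = M" by (simp_all add: Om_def)
      then have "(d + 2 * e) * (d + 2 * e) = M" by (auto simp: algebra_simps)
      with False show False by blast
    qed
    then have "(\<Sum>(x, d, e)\<in>{(x, d, e)\<in>Om M. 4 dvd x + d \<and> 2 * e + x - d = 0}. par e * chi4 d) = 0"
      by (simp only: sum.empty)
    moreover have "{c. c * c = M} = {}" using False by auto
    ultimately show ?thesis using main sum_Om[OF oM] by simp
  qed
qed

section \<open>The signed count\<close>

lemma finite_square_set: "finite {c::int. c * c = M}"
proof (rule finite_subset)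
  show "{c. c * c = M} \<subseteq> {- M..M}"
  proof
    fix c assume "c \<in> {c. c * c = M}"
    then show "c \<in> {- M..M}" using abs_le_square[of c] by auto
  qed
qed simp

text \<open>By symmetry \<open>x\<close> is odd. Halving \<open>y\<close> and writing q = 2 v, u = p
  + v gives x^2 + 4 y^2 + 4 u^2 + 12 v^2 = N; modulo 8 this makes y + u + v even and the sign equal
  to \<open>par y\<close>. For odd \<open>v\<close> the exchange of \<open>y\<close> and
  \<open>u\<close> cancels everything. For v = 2 g, taking half the sum and half the difference of
  \<open>y\<close> and \<open>u\<close> leads to x^2 + 8 (p^2 + q^2) = N - 48 g^2, to which Jacobi's
  identity applies.\<close>

lemma sum_quat_signed:
  assumes N: "N mod 8 = 1"
  shows "(\<Sum>(x, y, p, q)\<in>{(x, y, p, q)\<in>quat 1 4 N. even q}. par (nf 1 p q)) =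
    2 * (\<Sum>(c, g)\<in>{(c, g). c * c + 48 * (g * g) = N}. chi4 c * c)"
proof -
  let ?f = "\<lambda>(x, y, p, q). par (nf 1 p q)" and ?h = "\<lambda>(x::int, y, u::int, v::int). par y"
  let ?A = "{(x, y, p, q)\<in>quat 1 4 N. even q}"
  let ?Ao = "{(x, y, p, q)\<in>quat 1 4 N. even q \<and> odd x}" and ?Ae = "{(x, y, p, q)\<in>quat 1 4 N. even q \<and> odd y}"
  let ?D = "{(x, y, u, v). x * x + 4 * (y * y) + 4 * (u * u) + 12 * (v * v) = N}"
  let ?Dp = "{(x, y, u, v)\<in>?D. even v}" and ?Dm = "{(x, y, u, v)\<in>?D. odd v}"
  have oN: "odd N" using N by presburger
  have opp: "odd x \<longleftrightarrow> even y" if "(x, y, p, q) \<in> quat 1 4 N" for x y p q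
  proof -
    have "odd (x * x + y * y + 4 * nf 1 p q)" using that oN by (auto simp: quat_def nf_def)
    then show ?thesis by auto
  qed
  have fin: "finite {(x, y, p, q)\<in>quat 1 4 N. R x y p q}" for R
    by (rule finite_subset[of _ "quat 1 4 N"]) (auto simp: finite_quat)
  have parity: "odd x \<and> even (y + u + v)" if "(x, y, u, v) \<in> ?D" for x y u v
  proof -
    have e: "x * x + 4 * (y * y + u * u + 3 * (v * v)) = N" using that by simp
    with oN have "odd (x * x + 4 * (y * y + u * u + 3 * (v * v)))" by simp
    then have x: "odd x" by auto
    have "x * x mod 8 = 1" using x by (rule odd_square_mod8)
    moreover have "even k" if "s mod 8 = 1" "s + 4 * k = N" for s k using that N by presburger
    ultimately have "even (y * y + u * u + 3 * (v * v))" using e by blast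
    then have "even (y + u + v)" by auto
    with x show ?thesis by simp
  qed
  have "sum ?f ?A = sum ?f ?Ao + sum ?f ?Ae"
  proof -
    have "?A = ?Ao \<union> ?Ae" using opp by blast
    moreover have "sum ?f (?Ao \<union> ?Ae) = sum ?f ?Ao + sum ?f ?Ae"
      by (rule sum.union_disjoint[OF fin fin]) (use opp in blast)
    ultimately show ?thesis by argo
  qed
  moreover have "sum ?f ?Ae = sum ?f ?Ao"
    by (rule sum.reindex_bij_witness[where i = "\<lambda>(x, y, p, q). (y, x, p, q)" and j = "\<lambda>(x, y, p, q). (y, x, p, q)"])
       (auto simp: quat_def nf_def)
  moreover have "sum ?f ?Ao = sum ?h ?D"
  proof (rule sum.reindex_bij_witness[where i = "\<lambda>(x, y, u, v). (x, 2 * y, u - v, 2 * v)"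
        and j = "\<lambda>(x, y, p, q). (x, y div 2, p + q div 2, q div 2)"])
    fix t assume t: "t \<in> ?Ao"
    obtain x y p q where tt: "t = (x, y, p, q)" by (cases t)
    have *: "(x, y, p, q) \<in> quat 1 4 N" "even q" "odd x" using t tt by auto
    then have "even y" using opp by blast
    then obtain y' where y: "y = 2 * y'" by (elim evenE)
    from *(2) obtain v where q: "q = 2 * v" by (elim evenE)
    show "(case case t of (x, y, p, q) \<Rightarrow> (x, y div 2, p + q div 2, q div 2) of (x, y, u, v) \<Rightarrow> (x, 2 * y, u - v, 2 * v)) = t"
      by (simp add: tt y q)
    have D: "(x, y', p + v, v) \<in> ?D" using *(1) unfolding y q by (simp add: quat_def nf_def algebra_simps)
    then show "(case t of (x, y, p, q) \<Rightarrow> (x, y div 2, p + q div 2, q div 2)) \<in> ?D"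
      by (simp add: tt y q)
    have "nf 1 p q = (p + v) * (p + v) + 3 * (v * v)" unfolding q by (simp add: nf_def algebra_simps)
    then have "par (nf 1 p q) = par (p + v + v)" by (simp add: par_def)
    also have "\<dots> = par y'" using parity[OF D] by (auto simp: par_def)
    finally show "?h (case t of (x, y, p, q) \<Rightarrow> (x, y div 2, p + q div 2, q div 2)) = ?f t"
      by (simp add: tt y q)
  next
    fix t assume t: "t \<in> ?D"
    obtain x y u v where tt: "t = (x, y, u, v)" by (cases t)
    have "odd x" using parity[of x y u v] t tt by simp
    moreover have "nf 0 x (2 * y) + 4 * nf 1 (u - v) (2 * v) = N"
      using t tt by (simp add: nf_def algebra_simps)
    ultimately show "(case t of (x, y, u, v) \<Rightarrow> (x, 2 * y, u - v, 2 * v)) \<in> ?Ao"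
      by (simp add: tt quat_def)
  qed auto
  moreover have "sum ?h ?D = sum ?h ?Dp + sum ?h ?Dm"
  proof -
    have "finite ?D"
    proof (rule finite_subset)
      show "?D \<subseteq> {- N..N} \<times> {- N..N} \<times> {- N..N} \<times> {- N..N}"
      proof
        fix t assume t: "t \<in> ?D"
        obtain x y u v where tt: "t = (x, y, u, v)" by (cases t)
        have "\<bar>x\<bar> \<le> N" "\<bar>y\<bar> \<le> N" "\<bar>u\<bar> \<le> N" "\<bar>v\<bar> \<le> N"
          using abs_le_square[of x] abs_le_square[of y] abs_le_square[of u] abs_le_square[of v] t tt by auto
        then show "t \<in> {- N..N} \<times> {- N..N} \<times> {- N..N} \<times> {- N..N}" using tt by auto
      qed
    qed simp
    then have "finite ?Dp" "finite ?Dm" by (auto elim: rev_finite_subset)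
    moreover have "?D = ?Dp \<union> ?Dm" by auto
    moreover have "?Dp \<inter> ?Dm = {}" by auto
    ultimately show ?thesis by (metis (no_types, lifting) sum.union_disjoint)
  qed
  moreover have "sum ?h ?Dm = 0"
  proof (rule sum_sign_reversing[where i = "\<lambda>(x, y, u, v). (x, u, y, v)"])
    fix t assume t: "t \<in> ?Dm"
    obtain x y u v where tt: "t = (x, y, u, v)" by (cases t)
    have "even (y + u + v)" "odd v" using parity[of x y u v] t tt by auto
    then show "?h ((\<lambda>(x, y, u, v). (x, u, y, v)) t) = - ?h t" by (auto simp: tt par_def)
  qed auto
  moreover have "sum ?h ?Dp = (\<Sum>(c, g)\<in>{(c, g). c * c + 48 * (g * g) = N}. chi4 c * c)"
  proof -
    have m: "(N - 48 * (g * g)) mod 8 = 1" for g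
    proof -
      have "(N - 48 * k) mod 8 = 1" for k using N by presburger
      then show ?thesis .
    qed
    have g: "g \<in> {- N..N}" if "s + 48 * (g * g) = N" "0 \<le> s" for g s
      using abs_le_square[of g] that by auto
    have JS_in: "g \<in> {- N..N}" if "(x, p, q) \<in> JS (N - 48 * (g * g))" for g x p q
    proof (rule g)
      show "x * x + 8 * nf 0 p q + 48 * (g * g) = N" using that by (simp add: JS_def)
      show "0 \<le> x * x + 8 * nf 0 p q" using nf_nonneg[of 0 p q] by simp
    qed
    have "sum ?h ?Dp = (\<Sum>(g, x, p, q)\<in>Sigma {- N..N} (\<lambda>g. JS (N - 48 * (g * g))). par (p + q))"
    proof (rule sum.reindex_bij_witness[where j = "\<lambda>(x, y, u, v). (v div 2, x, (y + u) div 2, (y - u) div 2)"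
          and i = "\<lambda>(g, x, p, q). (x, p + q, p - q, 2 * g)"])
      fix t assume t: "t \<in> ?Dp"
      obtain x y u v where tt: "t = (x, y, u, v)" by (cases t)
      have *: "x * x + 4 * (y * y) + 4 * (u * u) + 12 * (v * v) = N" "even v" "even (y + u)"
        using t tt parity[of x y u v] by auto
      then obtain g' where v: "v = 2 * g'" by (elim evenE)
      from *(3) obtain p where p: "y + u = 2 * p" by (elim evenE)
      define q where "q = y - p"
      have yu: "y = p + q" "u = p - q" using p by (simp_all add: q_def)
      have j: "(v div 2, x, (y + u) div 2, (y - u) div 2) = (g', x, p, q)" by (simp add: v yu)
      show "(case case t of (x, y, u, v) \<Rightarrow> (v div 2, x, (y + u) div 2, (y - u) div 2) of
          (g, x, p, q) \<Rightarrow> (x, p + q, p - q, 2 * g)) = t"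
        by (simp add: tt v yu)
      have JS: "(x, p, q) \<in> JS (N - 48 * (g' * g'))"
        using *(1) unfolding v yu by (simp add: JS_def nf_def algebra_simps)
      with JS_in[OF JS] show "(case t of (x, y, u, v) \<Rightarrow> (v div 2, x, (y + u) div 2, (y - u) div 2)) \<in>
          Sigma {- N..N} (\<lambda>g. JS (N - 48 * (g * g)))"
        by (simp add: tt v yu)
      show "(case case t of (x, y, u, v) \<Rightarrow> (v div 2, x, (y + u) div 2, (y - u) div 2) of
          (g, x, p, q) \<Rightarrow> par (p + q)) = ?h t"
        by (simp add: tt v yu)
    qed (auto simp: JS_def nf_def algebra_simps)
    also have "\<dots> = (\<Sum>g\<in>{- N..N}. \<Sum>(x, p, q)\<in>JS (N - 48 * (g * g)). par (p + q))"
      by (subst sum.Sigma) (use finite_JS[OF m] in \<open>auto simp: case_prod_unfold\<close>)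
    also have "\<dots> = (\<Sum>g\<in>{- N..N}. \<Sum>c\<in>{c. c * c = N - 48 * (g * g)}. chi4 c * c)"
      by (simp only: jacobi_eta_cube(1)[OF m])
    also have "\<dots> = (\<Sum>(g, c)\<in>Sigma {- N..N} (\<lambda>g. {c. c * c = N - 48 * (g * g)}). chi4 c * c)"
      by (subst sum.Sigma) (auto simp: finite_square_set)
    also have "\<dots> = (\<Sum>(c, g)\<in>{(c, g). c * c + 48 * (g * g) = N}. chi4 c * c)"
    proof (rule sum.reindex_bij_witness[where i = "\<lambda>(c, g). (g, c)" and j = "\<lambda>(g, c). (c, g)"])
      fix t assume t: "t \<in> {(c, g). c * c + 48 * (g * g) = N}"
      obtain c h where tt: "t = (c, h)" by (cases t)
      with t g[of "c * c" h] show "(\<lambda>(c, g). (g, c)) t \<in> Sigma {- N..N} (\<lambda>g. {c. c * c = N - 48 * (g * g)})"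
        by auto
    qed auto
    finally show ?thesis .
  qed
  ultimately show ?thesis by simp
qed

text \<open>Modulo 8 an odd \<open>e\<close> would give 3 or 7, and twice an odd number would give
  5.\<close>

lemma eight_square_mod:
  assumes "N mod 8 = 1" "c * c + 3 * (e * e) = N"
  shows "odd c \<and> 4 dvd (e::int)"
proof -
  have sq: "k mod 8 = 1" if "k = z * z" "odd z" for k z :: int using odd_square_mod8[of z] that by simp
  have N: "N mod 8 = 1" by fact
  have ee: "even e"
  proof (rule ccontr)
    assume e: "odd e"
    have "odd N" using N by presburger
    then have "odd (c * c + 3 * (e * e))" using assms(2) by simp
    with e have "even c" by simp
    then obtain k where k: "c = 2 * k" by (elim evenE)
    have "4 * (k * k) + 3 * (e * e) = N" using assms(2) by (simp add: k)
    moreover have "\<not> (4 * a + 3 * b = N)" if "b mod 8 = 1" for a b using that N by presburger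
    ultimately show False using sq[OF refl e] by blast
  qed
  then obtain f where f: "e = 2 * f" by (elim evenE)
  have "odd N" using N by presburger
  then have "odd (c * c + 3 * (e * e))" using assms(2) by simp
  with ee have c: "odd c" by simp
  have "even f"
  proof (rule ccontr)
    assume o: "odd f"
    have "c * c + 12 * (f * f) = N" using assms(2) by (simp add: f)
    moreover have "\<not> (a + 12 * b = N)" if "a mod 8 = 1" "b mod 8 = 1" for a b using that N by presburger
    ultimately show False using sq[OF refl o] sq[OF refl c] by blast
  qed
  with c f show ?thesis by auto
qed

text \<open>\<open>chi4 a * a\<close> is even in \<open>a\<close>, so the signs of \<open>a\<close>
  and \<open>b\<close> give the factor 4. Of b, - b exactly one is congruent to \<open>a\<close>
  modulo 4, and then a = c + 3 e, b = c - e with c^2 + 3 e^2 = N. Here e = 4 g, hence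
  \<open>chi4 a = chi4 c\<close>, and the part of the summand linear in \<open>e\<close> cancels
  under e -> - e.\<close>

lemma sum_cusp:
  assumes N: "N mod 8 = 1"
  shows "4 * (\<Sum>(a, b)\<in>{(a, b). 0 < a \<and> 0 < b \<and> odd a \<and> a * a + 3 * (b * b) = 4 * N}. chi4 a * a) =
    2 * (\<Sum>(c, g)\<in>{(c, g). c * c + 48 * (g * g) = N}. chi4 c * c)"
proof -
  let ?f = "\<lambda>(a::int, b::int). chi4 a * a"
  let ?U = "{(a, b). odd a \<and> a * a + 3 * (b * b) = 4 * N}"
  have finU: "finite {(a, b)\<in>?U. R a b}" for R
  proof (rule finite_subset)
    show "{(a, b)\<in>?U. R a b} \<subseteq> {- (4 * N)..4 * N} \<times> {- (4 * N)..4 * N}"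
    proof
      fix t assume t: "t \<in> {(a, b)\<in>?U. R a b}"
      obtain a b where tt: "t = (a, b)" by (cases t)
      have "\<bar>a\<bar> \<le> 4 * N" "\<bar>b\<bar> \<le> 4 * N" using abs_le_square[of a] abs_le_square[of b] t tt by auto
      then show "t \<in> {- (4 * N)..4 * N} \<times> {- (4 * N)..4 * N}" using tt by auto
    qed
  qed simp
  have odd: "odd a \<and> odd b" if "(a, b) \<in> ?U" for a b
  proof -
    have e: "a * a + 3 * (b * b) = 4 * N" "odd a" using that by auto
    have "even (a * a + 3 * (b * b))" unfolding e(1) by simp
    with e(2) show ?thesis by simp
  qed
  have split: "sum ?f {(a, b)\<in>?U. Q a b} = sum ?f {(a, b)\<in>?U. Q a b \<and> R a b} + sum ?f {(a, b)\<in>?U. Q a b \<and> \<not> R a b}"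
    for Q R
  proof -
    have "{(a, b)\<in>?U. Q a b} = {(a, b)\<in>?U. Q a b \<and> R a b} \<union> {(a, b)\<in>?U. Q a b \<and> \<not> R a b}" by blast
    moreover have "sum ?f ({(a, b)\<in>?U. Q a b \<and> R a b} \<union> {(a, b)\<in>?U. Q a b \<and> \<not> R a b}) =
      sum ?f {(a, b)\<in>?U. Q a b \<and> R a b} + sum ?f {(a, b)\<in>?U. Q a b \<and> \<not> R a b}"
      by (rule sum.union_disjoint[OF finU finU]) blast
    ultimately show ?thesis by argo
  qed
  \<comment> \<open>The conjunct \<open>True\<close> makes the sets match the instances of
    \<open>split\<close>.\<close>
  have pos_b: "sum ?f {(a, b)\<in>?U. True \<and> \<not> 0 < b} = sum ?f {(a, b)\<in>?U. True \<and> 0 < b}"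
  proof (rule sum.reindex_bij_witness[where i = "\<lambda>(a, b). (a, - b)" and j = "\<lambda>(a, b). (a, - b)"])
    fix t assume t: "t \<in> {(a, b)\<in>?U. True \<and> \<not> 0 < b}"
    obtain a b where tt: "t = (a, b)" by (cases t)
    with odd[of a b] t have "b \<noteq> 0" by auto
    with t tt show "(\<lambda>(a, b). (a, - b)) t \<in> {(a, b)\<in>?U. True \<and> 0 < b}" by auto
  qed auto
  have pos_a: "sum ?f {(a, b)\<in>?U. (True \<and> 0 < b) \<and> \<not> 0 < a} = sum ?f {(a, b)\<in>?U. (True \<and> 0 < b) \<and> 0 < a}"
  proof (rule sum.reindex_bij_witness[where i = "\<lambda>(a, b). (- a, b)" and j = "\<lambda>(a, b). (- a, b)"])
    fix t assume t: "t \<in> {(a, b)\<in>?U. (True \<and> 0 < b) \<and> \<not> 0 < a}"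
    obtain a b where tt: "t = (a, b)" by (cases t)
    with odd[of a b] t have "a \<noteq> 0" by auto
    with t tt show "(\<lambda>(a, b). (- a, b)) t \<in> {(a, b)\<in>?U. (True \<and> 0 < b) \<and> 0 < a}" by auto
  qed auto
  have "{(a, b). 0 < a \<and> 0 < b \<and> odd a \<and> a * a + 3 * (b * b) = 4 * N} = {(a, b)\<in>?U. (True \<and> 0 < b) \<and> 0 < a}"
    by auto
  then have quarter: "4 * (\<Sum>(a, b)\<in>{(a, b). 0 < a \<and> 0 < b \<and> odd a \<and> a * a + 3 * (b * b) = 4 * N}. chi4 a * a) =
      sum ?f {(a, b)\<in>?U. True}"
    using split[of "\<lambda>_ _. True" "\<lambda>a b. 0 < b"] split[of "\<lambda>a b. True \<and> 0 < b" "\<lambda>a b. 0 < a"] pos_b pos_a by simp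
  have "sum ?f {(a, b)\<in>?U. True \<and> \<not> 4 dvd a - b} = sum ?f {(a, b)\<in>?U. True \<and> 4 dvd a - b}"
  proof (rule sum.reindex_bij_witness[where i = "\<lambda>(a, b). (a, - b)" and j = "\<lambda>(a, b). (a, - b)"])
    have four: "4 dvd a - - b \<longleftrightarrow> \<not> 4 dvd a - b" if "odd a \<and> odd b" for a b :: int using that by presburger
    show "(\<lambda>(a, b). (a, - b)) t \<in> {(a, b)\<in>?U. True \<and> 4 dvd a - b}"
      if "t \<in> {(a, b)\<in>?U. True \<and> \<not> 4 dvd a - b}" for t
    proof -
      obtain a b where tt: "t = (a, b)" by (cases t)
      with that have *: "(a, b) \<in> ?U" "\<not> 4 dvd a - b" by auto
      have "4 dvd a - - b" using four[OF odd[OF *(1)]] *(2) by blast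
      with * show ?thesis by (simp add: tt)
    qed
    show "(\<lambda>(a, b). (a, - b)) t \<in> {(a, b)\<in>?U. True \<and> \<not> 4 dvd a - b}"
      if "t \<in> {(a, b)\<in>?U. True \<and> 4 dvd a - b}" for t
    proof -
      obtain a b where tt: "t = (a, b)" by (cases t)
      with that have *: "(a, b) \<in> ?U" "4 dvd a - b" by auto
      have "\<not> 4 dvd a - - b" using four[OF odd[OF *(1)]] *(2) by blast
      with * show ?thesis by (simp add: tt)
    qed
  qed auto
  then have half: "sum ?f {(a, b)\<in>?U. True} = 2 * sum ?f {(a, b)\<in>?U. True \<and> 4 dvd a - b}"
    using split[of "\<lambda>_ _. True" "\<lambda>a b. 4 dvd a - b"] by simp
  let ?E = "{(c, e). c * c + 3 * (e * e) = N}"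
  have "sum ?f {(a, b)\<in>?U. True \<and> 4 dvd a - b} = (\<Sum>(c, e)\<in>?E. chi4 (c + 3 * e) * (c + 3 * e))"
  proof (rule sum.reindex_bij_witness[where i = "\<lambda>(c, e). (c + 3 * e, c - e)"
        and j = "\<lambda>(a, b). (b + (a - b) div 4, (a - b) div 4)"])
    fix t assume t: "t \<in> {(a, b)\<in>?U. True \<and> 4 dvd a - b}"
    obtain a b where tt: "t = (a, b)" by (cases t)
    with t have "4 dvd a - b" "a * a + 3 * (b * b) = 4 * N" by auto
    then obtain e where "a - b = 4 * e" and eq: "a * a + 3 * (b * b) = 4 * N" by (elim dvdE)
    then have a: "a = b + 4 * e" by simp
    have "4 * ((b + e) * (b + e) + 3 * (e * e)) = 4 * N" using eq unfolding a by (simp add: algebra_simps)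
    then have "(b + e) * (b + e) + 3 * (e * e) = N" by simp
    then show "(\<lambda>(a, b). (b + (a - b) div 4, (a - b) div 4)) t \<in> ?E" by (simp add: tt a)
    show "(\<lambda>(c, e). (c + 3 * e, c - e)) ((\<lambda>(a, b). (b + (a - b) div 4, (a - b) div 4)) t) = t"
      by (simp add: tt a)
    show "(case (\<lambda>(a, b). (b + (a - b) div 4, (a - b) div 4)) t of (c, e) \<Rightarrow> chi4 (c + 3 * e) * (c + 3 * e)) = ?f t"
      by (simp add: tt a add.commute)
  next
    fix t assume t: "t \<in> ?E"
    obtain c e where tt: "t = (c, e)" by (cases t)
    have eq: "c * c + 3 * (e * e) = N" using t tt by simp
    have "odd c" "4 dvd e" using eight_square_mod[OF N eq] by auto
    then have "odd (c + 3 * e)" by auto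
    moreover have "(c + 3 * e) * (c + 3 * e) + 3 * ((c - e) * (c - e)) = 4 * N"
      using eq by (simp add: algebra_simps)
    moreover have "4 dvd (c + 3 * e) - (c - e)" by simp
    ultimately show "(\<lambda>(c, e). (c + 3 * e, c - e)) t \<in> {(a, b)\<in>?U. True \<and> 4 dvd a - b}"
      by (simp add: tt)
    show "(\<lambda>(a, b). (b + (a - b) div 4, (a - b) div 4)) ((\<lambda>(c, e). (c + 3 * e, c - e)) t) = t"
      by (simp add: tt)
  qed
  also have "\<dots> = (\<Sum>(c, e)\<in>?E. chi4 c * c + chi4 c * (3 * e))"
  proof (rule sum.cong[OF refl])
    fix t assume t: "t \<in> ?E"
    obtain c e where tt: "t = (c, e)" by (cases t)
    with t have "4 dvd e" using eight_square_mod[OF N] by blast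
    then have "chi4 (c + 3 * e) = chi4 c" using chi4_shift(2)[of "3 * e" c] by (auto simp: sg_def)
    then show "(case t of (c, e) \<Rightarrow> chi4 (c + 3 * e) * (c + 3 * e)) = (case t of (c, e) \<Rightarrow> chi4 c * c + chi4 c * (3 * e))"
      by (simp add: tt algebra_simps)
  qed
  also have "\<dots> = (\<Sum>(c, e)\<in>?E. chi4 c * c) + (\<Sum>(c, e)\<in>?E. chi4 c * (3 * e))"
    by (simp add: sum.distrib case_prod_unfold)
  also have "(\<Sum>(c, e)\<in>?E. chi4 c * (3 * e)) = 0"
    by (rule sum_sign_reversing[where i = "\<lambda>(c, e). (c, - e)"]) auto
  also have "(\<Sum>(c, e)\<in>?E. chi4 c * c) = (\<Sum>(c, g)\<in>{(c, g). c * c + 48 * (g * g) = N}. chi4 c * c)"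
  proof (rule sum.reindex_bij_witness[where i = "\<lambda>(c, g). (c, 4 * g)" and j = "\<lambda>(c, e). (c, e div 4)"])
    fix t assume t: "t \<in> ?E"
    obtain c e where tt: "t = (c, e)" by (cases t)
    have eq: "c * c + 3 * (e * e) = N" using t tt by simp
    then have "4 dvd e" using eight_square_mod[OF N] by blast
    then obtain g where "e = 4 * g" by (elim dvdE)
    with eq tt show "(\<lambda>(c, e). (c, e div 4)) t \<in> {(c, g). c * c + 48 * (g * g) = N}"
      "(\<lambda>(c, g). (c, 4 * g)) ((\<lambda>(c, e). (c, e div 4)) t) = t"
      by simp_all
  qed auto
  finally show ?thesis using quarter half by simp
qed

section \<open>Triangular representations and the Kronecker symbol\<close>

text \<open>The relation holds for each value l of the second form separately. For even l both
  entries are even and the sign is 1. For odd l, with E pairs having even \<open>q\<close>, the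
  total is 3 E, the signed count is - E and there are 2 E pairs with odd \<open>q\<close>.\<close>

lemma card_quat_odd:
  assumes N: "N mod 8 = 1" "0 < N"
  shows "2 * int (card {(x, y, p, q)\<in>quat 1 4 N. odd q}) = 4 * (chi4_sum N + 6 * convX N)
    - (\<Sum>(x, y, p, q)\<in>{(x, y, p, q)\<in>quat 1 4 N. even q}. par (nf 1 p q))"
proof -
  let ?e = "\<lambda>p q. if even q then par (nf 1 p q) else 0" and ?o = "\<lambda>p q. if odd q then 1 else 0 :: int"
  have fin: "finite (quat 1 4 N)" by (simp add: finite_quat)
  have "(\<Sum>(p, q)\<in>reps 1 l. 1 - ?e p q - 2 * ?o p q) = 0" for l
  proof (cases "even l")
    case True
    show ?thesis
      by (rule sum.neutral) (use True nf1_parity in \<open>auto simp: reps_def par_def\<close>)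
  next
    case False
    have "(\<Sum>(p, q)\<in>reps 1 l. 1 - ?e p q - 2 * ?o p q) = (\<Sum>(p, q)\<in>reps 1 l. 1 + (if even q then 1 else 0) - 2 * ?o p q)"
      by (rule sum.cong) (use False in \<open>auto simp: reps_def par_def\<close>)
    also have "\<dots> = int (card (reps 1 l)) + (\<Sum>(p, q)\<in>reps 1 l. if even q then 1 else 0) - 2 * (\<Sum>(p, q)\<in>reps 1 l. ?o p q)"
      by (simp add: sum.distrib sum_subtractf sum_distrib_left case_prod_unfold)
    also have "(\<Sum>(p, q)\<in>reps 1 l. if even q then 1 else 0) = (\<Sum>(p, q)\<in>{(p, q)\<in>reps 1 l. even q}. 1 :: int)"
      by (rule sum.mono_neutral_cong_right) (auto split: if_splits)
    also have "\<dots> = int (card {(p, q)\<in>reps 1 l. even q})" by (simp add: case_prod_unfold)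
    also have "(\<Sum>(p, q)\<in>reps 1 l. ?o p q) = (\<Sum>(p, q)\<in>{(p, q)\<in>reps 1 l. odd q}. 1)"
      by (rule sum.mono_neutral_cong_right) (auto split: if_splits)
    also have "\<dots> = int (card {(p, q)\<in>reps 1 l. odd q})" by (simp add: case_prod_unfold)
    finally show ?thesis using card_reps1_parity[of l] False by linarith
  qed
  then have "(\<Sum>(x, y, p, q)\<in>quat 1 4 N. 1 - ?e p q - 2 * ?o p q) = 0"
    by (subst sum_quat_conv(1)) simp_all
  moreover have "(\<Sum>(x, y, p, q)\<in>quat 1 4 N. 1 - ?e p q - 2 * ?o p q) =
      int (card (quat 1 4 N)) - (\<Sum>(x, y, p, q)\<in>quat 1 4 N. ?e p q) - 2 * (\<Sum>(x, y, p, q)\<in>quat 1 4 N. ?o p q)"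
    by (simp add: sum_subtractf sum_distrib_left case_prod_unfold)
  moreover have "(\<Sum>(x, y, p, q)\<in>quat 1 4 N. ?e p q) =
      (\<Sum>(x, y, p, q)\<in>{(x, y, p, q)\<in>quat 1 4 N. even q}. par (nf 1 p q))"
    by (rule sum.mono_neutral_cong_right) (use fin in \<open>auto split: if_splits\<close>)
  moreover have "(\<Sum>(x, y, p, q)\<in>quat 1 4 N. ?o p q) = (\<Sum>(x, y, p, q)\<in>{(x, y, p, q)\<in>quat 1 4 N. odd q}. 1)"
    by (rule sum.mono_neutral_cong_right) (use fin in \<open>auto split: if_splits\<close>)
  moreover have "\<dots> = int (card {(x, y, p, q)\<in>quat 1 4 N. odd q})" by (simp add: case_prod_unfold)
  moreover have "odd N" using N by presburger
  then have "int (card (quat 1 4 N)) = 4 * (chi4_sum N + 6 * convX N)"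
    using card_quat_4[of N 1] N by (simp add: convX_def)
  ultimately show ?thesis by linarith
qed

lemma double_card_quat_odd:
  assumes N: "odd N"
  shows "card {(x, y, p, q)\<in>quat 1 4 N. odd q} = 2 * card {(x, y, p, q)\<in>quat 1 4 N. odd x \<and> odd q}"
proof -
  let ?A = "{(x, y, p, q)\<in>quat 1 4 N. odd x \<and> odd q}" and ?B = "{(x, y, p, q)\<in>quat 1 4 N. odd y \<and> odd q}"
  have opp: "odd x \<longleftrightarrow> even y" if "(x, y, p, q) \<in> quat 1 4 N" for x y p q
  proof -
    have "odd (x * x + y * y + 4 * nf 1 p q)" using that N by (auto simp: quat_def nf_def)
    then show ?thesis by auto
  qed
  have fin: "finite {(x, y, p, q)\<in>quat 1 4 N. R x y p q}" for R
    by (rule finite_subset[of _ "quat 1 4 N"]) (auto simp: finite_quat)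
  have "bij_betw (\<lambda>(x, y, p, q). (y, x, p, q)) ?A ?B"
    by (rule bij_betw_byWitness[where f' = "\<lambda>(x, y, p, q). (y, x, p, q)"]) (auto simp: quat_def nf_def)
  then have "card ?A = card ?B" by (rule bij_betw_same_card)
  moreover have "{(x, y, p, q)\<in>quat 1 4 N. odd q} = ?A \<union> ?B" using opp by blast
  moreover have "card (?A \<union> ?B) = card ?A + card ?B"
    by (rule card_Un_disjoint[OF fin fin]) (use opp in blast)
  ultimately show ?thesis by simp
qed

text \<open>Completing squares: \<open>8 n + 9\<close> is a sum of the odd squares \<open>(2 x - 1)\<^sup>2\<close> etc. with weights
  \<open>1, 1, 3, 4\<close>, and \<open>X\<^sup>2 + 3 Z\<^sup>2 = 4 nf 1 ((X - Z) / 2) Z\<close>.\<close>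

lemma tri_reps_eq_card_quat:
  "tri_reps 1 1 3 4 n = card {(x, y, p, q)\<in>quat 1 4 (8 * int n + 9). odd x \<and> odd q}"
proof -
  let ?N = "8 * int n + 9"
  let ?A = "{(x::int, y::int, z::int, w::int).
     int n = int 1 * (x * (x - 1) div 2) + int 1 * (y * (y - 1) div 2)
           + int 3 * (z * (z - 1) div 2) + int 4 * (w * (w - 1) div 2)}"
  let ?B = "{(x, y, p, q)\<in>quat 1 4 ?N. odd x \<and> odd q}"
  \<comment> \<open>The variables \<open>y\<close> and \<open>w\<close> supply the odd and the even
    square, while \<open>x\<close> and \<open>z\<close> merge into the second form.\<close>
  let ?f = "\<lambda>(x, y, z, w). (2 * y - 1, 4 * w - 2, x - z, 2 * z - 1)"
  let ?g = "\<lambda>(a, v, p, q). (p + (q + 1) div 2, (a + 1) div 2, (q + 1) div 2, (v + 2) div 4) :: int \<times> int \<times> int \<times> int"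
  have tri: "8 * (x * (x - 1) div 2) = (2 * x - 1) * (2 * x - 1) - 1" for x :: int
  proof -
    have "even (x * (x - 1))" by simp
    then have "2 * (x * (x - 1) div 2) = x * (x - 1)" by simp
    then have "8 * (x * (x - 1) div 2) = 4 * (x * (x - 1))" by linarith
    then show ?thesis by (simp add: algebra_simps)
  qed
  have mem: "(x, y, z, w) \<in> ?A \<longleftrightarrow> (2 * y - 1, 4 * w - 2, x - z, 2 * z - 1) \<in> quat 1 4 ?N" for x y z w
  proof -
    let ?t = "\<lambda>x::int. x * (x - 1) div 2"
    have "(x, y, z, w) \<in> ?A \<longleftrightarrow> int n = ?t x + ?t y + 3 * ?t z + 4 * ?t w" by simp
    also have "\<dots> \<longleftrightarrow> 8 * int n = 8 * ?t x + 8 * ?t y + 3 * (8 * ?t z) + 4 * (8 * ?t w)" by linarith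
    also have "\<dots> \<longleftrightarrow> nf 0 (2 * y - 1) (4 * w - 2) + 4 * nf 1 (x - z) (2 * z - 1) = ?N"
      unfolding tri by (auto simp: nf_def algebra_simps)
    finally show ?thesis by (simp add: quat_def)
  qed
  have "bij_betw ?f ?A ?B"
  proof (rule bij_betw_byWitness[where f' = ?g])
    show "\<forall>t\<in>?A. ?g (?f t) = t"
    proof
      fix t assume "t \<in> ?A"
      obtain x y z w where tt: "t = (x, y, z, w)" by (cases t)
      show "?g (?f t) = t" by (simp add: tt)
    qed
    have ex: "\<exists>x y z w. t = ?f (x, y, z, w) \<and> ?g t = (x, y, z, w)" if t: "t \<in> ?B" for t
    proof -
      obtain a v p q where tt: "t = (a, v, p, q)" by (cases t)
      with t have *: "(a, v, p, q) \<in> quat 1 4 ?N" "odd a" "odd q" by auto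
      then have e: "a * a + v * v + 4 * nf 1 p q = ?N" by (simp add: quat_def nf_def)
      \<comment> \<open>Modulo 8 the odd square and 4 times the odd norm leave v^2 = 4, hence v = 2
        mod 4, which is the shape \<open>4 * w - 2\<close>.\<close>
      have "odd (nf 1 p q)" using *(3) nf1_parity by blast
      moreover have "a * a mod 8 = 1" using *(2) by (rule odd_square_mod8)
      moreover have "s mod 8 = 4" if "r mod 8 = 1" "odd k" "r + s + 4 * k = ?N" for r s k using that by presburger
      ultimately have v8: "v * v mod 8 = 4" using e by blast
      have "even v"
      proof (rule ccontr)
        assume "odd v"
        with odd_square_mod8[of v] v8 show False by simp
      qed
      then obtain u where u: "v = 2 * u" by (elim evenE)
      have "odd u"
      proof
        assume "even u"
        then obtain k where "u = 2 * k" by (elim evenE)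
        with u have "v * v = 8 * (2 * (k * k))" by simp
        with v8 show False by simp
      qed
      with u obtain w where w: "v = 4 * w - 2"
      proof -
        from \<open>odd u\<close> obtain j where "u = 2 * j + 1" by (elim oddE)
        with u have "v = 4 * (j + 1) - 2" by simp
        with that show ?thesis .
      qed
      from *(2) obtain y where y: "a = 2 * y - 1"
      proof -
        from *(2) obtain j where "a = 2 * j + 1" by (elim oddE)
        then have "a = 2 * (j + 1) - 1" by simp
        with that show ?thesis .
      qed
      from *(3) obtain z where z: "q = 2 * z - 1"
      proof -
        from *(3) obtain j where "q = 2 * j + 1" by (elim oddE)
        then have "q = 2 * (j + 1) - 1" by simp
        with that show ?thesis .
      qed
      have "t = ?f (p + z, y, z, w)" "?g t = (p + z, y, z, w)" by (simp_all add: tt w y z)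
      then show ?thesis by blast
    qed
    show "\<forall>t\<in>?B. ?f (?g t) = t"
    proof
      fix t assume "t \<in> ?B"
      from ex[OF this] show "?f (?g t) = t" by auto
    qed
    show "?f ` ?A \<subseteq> ?B"
    proof
      fix s assume "s \<in> ?f ` ?A"
      then obtain x y z w where "(x, y, z, w) \<in> ?A" and s: "s = (2 * y - 1, 4 * w - 2, x - z, 2 * z - 1)" by auto
      then have "s \<in> quat 1 4 ?N" using mem[of x y z w] by blast
      then show "s \<in> ?B" using s by simp
    qed
    show "?g ` ?B \<subseteq> ?A"
    proof
      fix s assume "s \<in> ?g ` ?B"
      then obtain t where t: "t \<in> ?B" and s: "s = ?g t" by blast
      from ex[OF t] obtain x y z w where f: "t = ?f (x, y, z, w)" and g: "?g t = (x, y, z, w)" by blast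
      have "(2 * y - 1, 4 * w - 2, x - z, 2 * z - 1) \<in> quat 1 4 ?N" using t f by simp
      then have "(x, y, z, w) \<in> ?A" using mem[of x y z w] by blast
      then show "s \<in> ?A" using s g by argo
    qed
  qed
  then have "card ?A = card ?B" by (rule bij_betw_same_card)
  then show ?thesis unfolding tri_reps_def .
qed

section \<open>The Kronecker symbol (3/d) as a character\<close>

lemma Legendre_3:
  assumes p: "prime (p::int)" "p \<noteq> 2" "p \<noteq> 3"
  shows "Legendre 3 p = chi12 p"
proof -
  have p2: "2 < p" using prime_ge_2_int[OF p(1)] p(2) by simp
  have n3: "\<not> 3 dvd p"
  proof
    assume "3 dvd p"
    then have "3 = p" using primes_dvd_imp_eq[of 3 p] p(1) by simp
    with p(3) show False by simp
  qed
  have o: "odd p" using prime_mod4_cases[OF p(1)] p(2) by presburger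
  have "Legendre 3 p * Legendre p 3 = (- 1) ^ (nat ((3 - 1) div 2 * ((p - 1) div 2)))"
    by (rule Quadratic_Reciprocity_int) (use p p2 in auto)
  moreover have "Legendre p 3 = chi3 p"
  proof -
    have c0: "\<not> [p = 0] (mod 3)" using n3 by (simp add: cong_0_iff)
    have "QuadRes 3 p \<longleftrightarrow> p mod 3 = 1"
    proof
      assume "QuadRes 3 p"
      then obtain y where "[y\<^sup>2 = p] (mod 3)" by (auto simp: QuadRes_def)
      then have "p mod 3 = (y * y) mod 3" by (simp add: cong_def power2_eq_square)
      also have "\<dots> = ((y mod 3) * (y mod 3)) mod 3" by (simp add: mod_mult_eq)
      finally have "p mod 3 = ((y mod 3) * (y mod 3)) mod 3" .
      moreover have "p mod 3 \<noteq> 0" using n3 by (simp add: dvd_eq_mod_eq_0)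
      ultimately show "p mod 3 = 1" using int_mod3_cases[of y] by (elim disjE) simp_all
    next
      assume "p mod 3 = 1"
      then have "[1\<^sup>2 = p] (mod 3)" by (simp add: cong_def)
      then show "QuadRes 3 p" unfolding QuadRes_def by blast
    qed
    with c0 int_mod3_cases[of p] n3 show ?thesis
      by (auto simp: Legendre_def chi3_def dvd_eq_mod_eq_0)
  qed
  moreover have "(- 1 :: int) ^ (nat ((3 - 1) div 2 * ((p - 1) div 2))) = chi4 p"
  proof -
    have "p mod 4 = 1 \<or> p mod 4 = 3" using o by presburger
    then show ?thesis
    proof
      assume m: "p mod 4 = 1"
      then have "even ((p - 1) div 2)" by presburger
      then have "even (nat ((p - 1) div 2))" using p2 by (simp add: even_nat_iff)
      with m show ?thesis by (simp add: chi4_def)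
    next
      assume m: "p mod 4 = 3"
      then have "odd ((p - 1) div 2)" by presburger
      then have "odd (nat ((p - 1) div 2))" using p2 by (simp add: even_nat_iff)
      with m show ?thesis by (simp add: chi4_def)
    qed
  qed
  ultimately have "Legendre 3 p * chi3 p = chi4 p" by simp
  then have "Legendre 3 p * (chi3 p * chi3 p) = chi4 p * chi3 p" by (metis mult.assoc)
  then show ?thesis by (simp add: chi3_square[OF n3] chi12_def)
qed

lemma chi12_power: "chi12 (p ^ k) = chi12 p ^ k"
  by (induction k) (simp_all add: chi12_mult, simp add: chi12_def)

lemma chi12_prod: "chi12 (\<Prod>p\<in>A. f p) = (\<Prod>p\<in>A. chi12 (f p))"
  by (induction A rule: infinite_finite_induct) (simp_all add: chi12_mult, simp_all add: chi12_def)

lemma kronecker_3: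
  assumes d: "0 < d" "odd d" "\<not> 3 dvd d"
  shows "kronecker 3 d = chi12 d"
proof -
  have "kronecker 3 d = (\<Prod>p\<in>prime_factors d. kronecker_prime 3 p ^ multiplicity p d)"
    using d by (simp add: kronecker_def)
  also have "\<dots> = (\<Prod>p\<in>prime_factors d. chi12 (p ^ multiplicity p d))"
  proof (rule prod.cong[OF refl])
    fix p assume "p \<in> prime_factors d"
    then have p: "prime p" "p dvd d" by (auto simp: in_prime_factors_iff)
    with d have "p \<noteq> 2" "p \<noteq> 3" by auto
    with p show "kronecker_prime 3 p ^ multiplicity p d = chi12 (p ^ multiplicity p d)"
      by (simp add: kronecker_prime_def Legendre_3 chi12_power)
  qed
  also have "\<dots> = chi12 (\<Prod>p\<in>prime_factors d. p ^ multiplicity p d)"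
    by (rule chi12_prod[symmetric])
  also have "(\<Prod>p\<in>prime_factors d. p ^ multiplicity p d) = d"
    using d by (subst prod_prime_factors) auto
  finally show ?thesis .
qed

section \<open>Splitting off the power of 3 and the final formula\<close>

lemma E1_power3: "E1 (3 ^ b * m) = E1 m"
  by (induction b) (simp_all add: E1_triple mult.assoc)

lemma E2_power3: "E2 (3 ^ b * m) = 3 ^ b * E2 m"
  by (induction b) (simp_all add: E2_triple mult.assoc)

theorem theorem4p1:
  fixes n n1 \<beta> :: nat
  assumes "n > 0"
    and "n1 > 0"
    and "8 * n + 9 = 3 ^ \<beta> * n1"
    and "\<not> 3 dvd n1"
  shows "real (tri_reps 1 1 3 4 n) =
      1 / 2 * (3 ^ (\<beta> + 1) * real_of_int (kronecker 3 (int n1)) - 1)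
        * (\<Sum>d | d dvd n1. real d * real_of_int (kronecker 3 (int d)))
      - (\<Sum>(a, b) \<in> {(a::nat, b::nat). a > 0 \<and> b > 0 \<and> odd a \<and> 4 * (8 * n + 9) = a\<^sup>2 + 3 * b\<^sup>2}.
           (- 1) ^ ((a - 1) div 2) * real a)"
proof -
  define N where "N = 8 * int n + 9"
  have N8: "N mod 8 = 1" and N0: "0 < N" unfolding N_def by presburger+
  have N4: "N mod 4 = 1" and oN: "odd N" using N8 by presburger+
  have Nn1: "N = 3 ^ \<beta> * int n1"
    unfolding N_def using arg_cong[OF assms(3), of int] by simp
  have on1: "odd (int n1)" using oN unfolding Nn1 by auto
  have n13: "\<not> 3 dvd int n1" using assms(4) by presburger
  let ?C = "\<Sum>(a, b)\<in>{(a, b). 0 < a \<and> 0 < b \<and> odd a \<and> a * a + 3 * (b * b) = 4 * N}. chi4 a * a"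
  have t: "2 * int (tri_reps 1 1 3 4 n) = 3 * E2 N - E1 N - 2 * ?C"
  proof -
    have "int (card {(x, y, p, q)\<in>quat 1 4 N. odd q}) = 2 * int (tri_reps 1 1 3 4 n)"
      using double_card_quat_odd[OF oN] tri_reps_eq_card_quat[of n] by (simp add: N_def)
    then have "4 * int (tri_reps 1 1 3 4 n) = 4 * (chi4_sum N + 6 * convX N) - 4 * ?C"
      using card_quat_odd[OF N8 N0] sum_quat_signed[OF N8] sum_cusp[OF N8] by linarith
    with convX_closed[OF N4 N0] show ?thesis by linarith
  qed
  have chi_sq: "chi12 (int n1) * chi12 (int n1) = 1"
    using chi4_square[OF on1] chi3_square[OF n13] by (simp add: chi12_def mult_ac)
  \<comment> \<open>\<open>chi12 (int n1)\<close> is its own inverse, so \<open>E1_eq_E2\<close> can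
    be solved for \<open>E2\<close>; the formula is to be expressed by \<open>E1\<close>, which is
    the sum over the divisors of \<open>n1\<close> in the theorem.\<close>
  have "E2 (int n1) = chi12 (int n1) * chi12 (int n1) * E2 (int n1)" by (simp only: chi_sq mult_1)
  then have "E2 (int n1) = chi12 (int n1) * E1 (int n1)" using E1_eq_E2[OF on1 n13] by simp
  then have E: "3 * E2 N - E1 N = (3 ^ (\<beta> + 1) * chi12 (int n1) - 1) * E1 (int n1)"
    unfolding Nn1 E1_power3 E2_power3 by (simp add: algebra_simps)
  have k: "kronecker 3 (int d) = chi12 (int d)" if "d dvd n1" for d
  proof (rule kronecker_3)
    show "0 < int d" using that assms(2) by (auto intro: Nat.gr0I)
    have "int d dvd int n1" using that by simp
    then show "odd (int d)" "\<not> 3 dvd int d" using on1 n13 by (meson dvd_trans)+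
  qed
  have E1: "(\<Sum>d | d dvd n1. real d * real_of_int (kronecker 3 (int d))) = real_of_int (E1 (int n1))"
  proof -
    have "E1 (int n1) = (\<Sum>d | d dvd n1. int d * chi12 (int d))"
      unfolding E1_def
    proof (rule sum.reindex_bij_witness[where i = "\<lambda>d. (int d, int (n1 div d))" and j = "\<lambda>(a, x). nat a"])
      fix z assume z: "z \<in> dpairs (int n1)"
      obtain a x where zz: "z = (a, x)" by (cases z)
      have *: "0 < a" "0 < x" "a * x = int n1" using z zz by (auto simp: dpairs_def)
      then have n: "nat a * nat x = n1" by (metis nat_int nat_mult_distrib less_imp_le)
      have "n1 div nat a = nat x" using * n by (metis nonzero_mult_div_cancel_left nat_0_iff not_le)
      with * zz show "(\<lambda>d. (int d, int (n1 div d))) (case z of (a, x) \<Rightarrow> nat a) = z" by simp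
      show "(case z of (a, x) \<Rightarrow> nat a) \<in> {d. d dvd n1}" using zz n by auto
      show "int (case z of (a, x) \<Rightarrow> nat a) * chi12 (int (case z of (a, x) \<Rightarrow> nat a)) = (case z of (a, x) \<Rightarrow> chi12 a * a)"
        using zz * by simp
    next
      fix d assume "d \<in> {d. d dvd n1}"
      then obtain k where k: "n1 = d * k" by auto
      with assms(2) have "0 < d" "0 < k" by auto
      with k show "(int d, int (n1 div d)) \<in> dpairs (int n1)" by (simp add: dpairs_def)
      show "(case (int d, int (n1 div d)) of (a, x) \<Rightarrow> nat a) = d" by simp
    qed
    then have "real_of_int (E1 (int n1)) = (\<Sum>d | d dvd n1. real d * real_of_int (chi12 (int d)))" by simp
    also have "\<dots> = (\<Sum>d | d dvd n1. real d * real_of_int (kronecker 3 (int d)))"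
      by (rule sum.cong) (simp_all add: k)
    finally show ?thesis by simp
  qed
  have C: "(\<Sum>(a, b) \<in> {(a::nat, b::nat). a > 0 \<and> b > 0 \<and> odd a \<and> 4 * (8 * n + 9) = a\<^sup>2 + 3 * b\<^sup>2}.
           (- 1) ^ ((a - 1) div 2) * real a) = real_of_int ?C"
  proof -
    let ?U = "{(a::nat, b::nat). a > 0 \<and> b > 0 \<and> odd a \<and> 4 * (8 * n + 9) = a\<^sup>2 + 3 * b\<^sup>2}"
    have eq: "4 * (8 * n + 9) = a\<^sup>2 + 3 * b\<^sup>2 \<longleftrightarrow> int a * int a + 3 * (int b * int b) = 4 * N" for a b :: nat
    proof -
      have "4 * (8 * n + 9) = a\<^sup>2 + 3 * b\<^sup>2 \<longleftrightarrow> int (4 * (8 * n + 9)) = int (a\<^sup>2 + 3 * b\<^sup>2)" by (simp only: of_nat_eq_iff)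
      then show ?thesis by (auto simp: N_def power2_eq_square)
    qed
    have U: "?U = {(a, b). a > 0 \<and> b > 0 \<and> odd a \<and> int a * int a + 3 * (int b * int b) = 4 * N}"
      by (simp only: eq)
    have "?C = (\<Sum>(a, b)\<in>?U. chi4 (int a) * int a)"
      unfolding U
      by (rule sum.reindex_bij_witness[where i = "\<lambda>(a, b). (int a, int b)" and j = "\<lambda>(a, b). (nat a, nat b)"])
         (auto simp: even_nat_iff)
    then have "real_of_int ?C = (\<Sum>(a, b)\<in>?U. real_of_int (chi4 (int a)) * real a)"
      by (simp add: case_prod_unfold)
    also have "\<dots> = (\<Sum>(a, b)\<in>?U. (- 1) ^ ((a - 1) div 2) * real a)"
    proof (rule sum.cong[OF refl])
      fix z assume "z \<in> ?U"
      obtain a b where zz: "z = (a, b)" by (cases z)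
      with \<open>z \<in> ?U\<close> have "odd a" by simp
      have "real_of_int (chi4 (int a)) = (- 1) ^ ((a - 1) div 2)"
      proof (cases "a mod 4 = 1")
        case True
        then have "even ((a - 1) div 2)" "int a mod 4 = 1" by presburger+
        then show ?thesis by (simp add: chi4_def)
      next
        case False
        with \<open>odd a\<close> have "odd ((a - 1) div 2)" "int a mod 4 = 3" by presburger+
        then show ?thesis by (simp add: chi4_def)
      qed
      then show "(case z of (a, b) \<Rightarrow> real_of_int (chi4 (int a)) * real a) = (case z of (a, b) \<Rightarrow> (- 1) ^ ((a - 1) div 2) * real a)"
        by (simp add: zz)
    qed
    finally show ?thesis by simp
  qed
  have "2 * int (tri_reps 1 1 3 4 n) = (3 ^ (\<beta> + 1) * chi12 (int n1) - 1) * E1 (int n1) - 2 * ?C"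
    using t E by simp
  then have "real_of_int (2 * int (tri_reps 1 1 3 4 n)) =
      real_of_int ((3 ^ (\<beta> + 1) * chi12 (int n1) - 1) * E1 (int n1) - 2 * ?C)"
    by (rule arg_cong)
  then have "2 * real (tri_reps 1 1 3 4 n) =
      (3 ^ (\<beta> + 1) * real_of_int (chi12 (int n1)) - 1) * real_of_int (E1 (int n1)) - 2 * real_of_int ?C"
    by (simp del: of_int_sum)
  then show ?thesis unfolding E1 C k[OF dvd_refl] by simp
qed

end
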